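(* Let $r>0$ and let $T$ be a finite metric tree of total length $L=|T|\ge 2r$. Then there is a probability measure $\nu$ on $\mathcal C(T,0)$ such that $E_\nu\le \frac{L}{r}\,U[0,r]$.
   Context: A finite metric tree is the metric realization of a finite combinatorial tree whose edges have positive lengths (the one-point tree, of length $0$, is also allowed; models differing only by edge subdivision represent the same metric tree). $|T|$ is the total edge length, $d_T$ the path metric, and $B_T(v,s)=\{x\in T: d_T(x,v)\le s\}$ for $v\in T$, $s\ge 0$. For $m\ge1$, a tuple $\mathbf r=(r_1,\dots,r_m)\in\mathbb R_{\ge0}^m$ is a cover of $T$ if there are centers $v_1,\dots,v_m\in T$ with $T\subseteq\bigcup_{i=1}^m B_T(v_i,r_i)$. $\mathcal C_m(T)$ is the set of such $m$-tuples, and $\mathcal C(T)=\bigsqcup_{m\ge1}\mathcal C_m(T)$ with the disjoint-union Borel structure. $\mathcal C(T,0)$ is the set of $0$-good covers, i.e. those $\mathbf r\in\mathcal C(T)$ with $\sum_i r_i\le |T|$. For a finite Borel measure $\nu$ on $\mathcal C(T)$ (a measure on $\mathcal C(T,0)$ is regarded as one on $\mathcal C(T)$), the expected radius measure is the possibly infinite Borel measure on $\mathbb R_{\ge0}$ given by $E_\nu(A)=\int |\{i: r_i\in A\}|\,d\nu(\mathbf r)$. For positive Borel measures on the same space, $\mu\le\mu'$ means $\mu(A)\le\mu'(A)$ for all Borel $A$. $U[0,r]$ is the uniform probability measure on $[0,r]$, viewed as a measure on $\mathbb R_{\ge0}$. *)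

theory Defs
  imports "HOL-Probability.Probability"
begin

section \<open>Finite metric trees\<close>

record 'v weighted_graph =
  verts :: "'v set"
  edges :: "'v set set"
  len :: "'v set \<Rightarrow> real"

definition adj :: "'v weighted_graph \<Rightarrow> 'v \<Rightarrow> 'v \<Rightarrow> bool" where
  "adj G u v \<longleftrightarrow> {u, v} \<in> edges G"

definition connected_graph :: "'v weighted_graph \<Rightarrow> bool" where
  "connected_graph G \<longleftrightarrow> (\<forall>u\<in>verts G. \<forall>v\<in>verts G. (adj G)\<^sup>*\<^sup>* u v)"

definition graph_cycle :: "'v weighted_graph \<Rightarrow> 'v list \<Rightarrow> bool" where
  "graph_cycle G c \<longleftrightarrow>
     3 \<le> length c \<and> distinct c \<and> successively (adj G) c \<and> adj G (last c) (hd c)"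

locale metric_tree =
  fixes T :: "'v weighted_graph"
  assumes finite_verts: "finite (verts T)"
    and verts_nonempty: "verts T \<noteq> {}"
    and edges_subset: "\<And>e. e \<in> edges T \<Longrightarrow> e \<subseteq> verts T \<and> card e = 2"
    and len_pos: "\<And>e. e \<in> edges T \<Longrightarrow> 0 < len T e"
    and connected: "connected_graph T"
    and acyclic: "\<And>c. \<not> graph_cycle T c"

definition total_length :: "'v weighted_graph \<Rightarrow> real" where
  "total_length T = (\<Sum>e\<in>edges T. len T e)"

text \<open>
  The points of the metric realization are given in barycentric coordinates. The vertex \<open>v\<close>
  is the coordinate function with \<open>p v = 1\<close> and \<open>p w = 0\<close> for \<open>w \<noteq> v\<close>; the point of the edge
  \<open>{u, v}\<close> at distance \<open>t\<close> from \<open>u\<close> has \<open>p v = t / len T {u, v}\<close> and \<open>p u = 1 - p v\<close>.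
\<close>

definition support :: "('v \<Rightarrow> real) \<Rightarrow> 'v set" where
  "support p = {v. p v \<noteq> 0}"

definition realization :: "'v weighted_graph \<Rightarrow> ('v \<Rightarrow> real) set" where
  "realization T = {p. (\<forall>v. 0 \<le> p v) \<and> (\<Sum>v\<in>verts T. p v) = 1 \<and>
     (support p \<in> edges T \<or> (\<exists>v\<in>verts T. support p = {v}))}"

text \<open>
  Piecewise linear paths with their lengths. Each piece stays in one closed edge \<open>e\<close>; the value
  \<open>\<bar>p x - q x\<bar>\<close> is the same for both endpoints \<open>x\<close> of \<open>e\<close>, as the coordinates sum to 1.
\<close>

inductive linear_path :: "'v weighted_graph \<Rightarrow> ('v \<Rightarrow> real) \<Rightarrow> real \<Rightarrow> ('v \<Rightarrow> real) \<Rightarrow> bool"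
  for T where
  trivial: "p \<in> realization T \<Longrightarrow> linear_path T p 0 p"
| piece: "\<lbrakk>p \<in> realization T; q \<in> realization T; e \<in> edges T; support p \<subseteq> e; support q \<subseteq> e; x \<in> e;
     linear_path T q a z\<rbrakk> \<Longrightarrow> linear_path T p (len T e * \<bar>p x - q x\<bar> + a) z"

definition path_dist :: "'v weighted_graph \<Rightarrow> ('v \<Rightarrow> real) \<Rightarrow> ('v \<Rightarrow> real) \<Rightarrow> real" where
  "path_dist T p q =
     (if p \<in> realization T \<and> q \<in> realization T then Inf {a. linear_path T p a q} else 0)"

lemma linear_path_points:
  assumes "linear_path T p a q"
  shows "p \<in> realization T" "q \<in> realization T"
  using assms by (induction) auto

lemma linear_path_trans:
  assumes "linear_path T p a q" "linear_path T q b z"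
  shows "linear_path T p (a + b) z"
  using assms
proof (induction)
  case (piece p q e x a z')
  then show ?case
    using linear_path.piece[of p T q e x "a + b" z] by (simp add: add.assoc)
qed simp

lemma linear_path_single:
  assumes "p \<in> realization T" "q \<in> realization T" "e \<in> edges T"
    "support p \<subseteq> e" "support q \<subseteq> e" "x \<in> e"
  shows "linear_path T p (len T e * \<bar>p x - q x\<bar>) q"
  using linear_path.piece[OF assms linear_path.trivial[OF assms(2)]] by simp

lemma linear_path_sym:
  assumes "linear_path T p a q"
  shows "linear_path T q a p"
  using assms
proof (induction)
  case (trivial p)
  then show ?case by (rule linear_path.trivial)
next
  case (piece p q e x a z)
  have "linear_path T q (len T e * \<bar>q x - p x\<bar>) p"
    using piece by (intro linear_path_single)
  from linear_path_trans[OF piece.IH this] show ?case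
    by (simp add: add.commute abs_minus_commute)
qed

context metric_tree
begin

lemma finite_edges: "finite (edges T)"
  by (rule finite_subset[of _ "Pow (verts T)"]) (use finite_verts edges_subset in auto)

lemma linear_path_nonneg: "linear_path T p a q \<Longrightarrow> 0 \<le> a"
  by (induction rule: linear_path.induct) (auto simp: len_pos less_imp_le)

lemma coord_lower_bound:
  assumes "linear_path T p a q" and c: "0 < c" "\<And>e. e \<in> edges T \<Longrightarrow> c \<le> len T e"
  shows "c * \<bar>p v - q v\<bar> \<le> a"
  using assms(1)
proof (induction)
  case (piece p q e x a z)
  have diff: "\<bar>p v - q v\<bar> \<le> \<bar>p x - q x\<bar>"
  proof (cases "v \<in> e")
    case False
    then have "p v = 0" "q v = 0" using piece by (auto simp: support_def)
    then show ?thesis by simp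
  next
    case True
    show ?thesis
    proof (cases "v = x")
      case False
      have e: "e = {v, x}"
        using edges_subset[OF piece.hyps(3)] True False piece.hyps(6)
        by (auto simp: card_2_iff)
      have "(\<Sum>w\<in>verts T. f w) = f v + f x" if "support f \<subseteq> e" for f :: "'v \<Rightarrow> real"
      proof -
        have "(\<Sum>w\<in>verts T. f w) = (\<Sum>w\<in>e. f w)"
          using that edges_subset[OF piece.hyps(3)] finite_verts
          by (intro sum.mono_neutral_right) (auto simp: support_def)
        then show ?thesis using e False by simp
      qed
      from this[OF piece.hyps(4)] this[OF piece.hyps(5)]
      have "p v + p x = 1" "q v + q x = 1"
        using piece.hyps(1,2) by (auto simp: realization_def)
      then show ?thesis by linarith
    qed simp
  qed
  have "c * \<bar>p v - z v\<bar> \<le> c * \<bar>p v - q v\<bar> + c * \<bar>q v - z v\<bar>"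
    using c by (simp flip: distrib_left)
  also have "c * \<bar>p v - q v\<bar> \<le> len T e * \<bar>p x - q x\<bar>"
    using c piece.hyps(3) diff by (intro mult_mono) (auto simp: len_pos less_imp_le)
  finally show ?case using piece.IH by simp
qed simp

lemma vertex_in_realization: "v \<in> verts T \<Longrightarrow> indicator {v} \<in> realization T"
  using finite_verts by (auto simp: realization_def support_def indicator_def sum.If_cases)

lemma support_indicator: "support (indicator {v}) = {v}"
  by (auto simp: support_def indicator_def)

lemma linear_path_to_vertex:
  assumes "p \<in> realization T"
  shows "\<exists>v\<in>verts T. \<exists>a. linear_path T p a (indicator {v})"
proof -
  have p: "\<forall>v. 0 \<le> p v" "(\<Sum>v\<in>verts T. p v) = 1"
    "support p \<in> edges T \<or> (\<exists>v\<in>verts T. support p = {v})"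
    using assms by (auto simp: realization_def)
  from p(3) show ?thesis
  proof
    assume e: "support p \<in> edges T"
    then obtain v where v: "v \<in> support p" "v \<in> verts T"
      using edges_subset[OF e] by (fastforce simp: card_2_iff)
    have "linear_path T p (len T (support p) * \<bar>p v - indicator {v} v\<bar>) (indicator {v})"
      using e v assms vertex_in_realization
      by (intro linear_path_single) (auto simp: support_indicator)
    then show ?thesis using v by blast
  next
    assume "\<exists>v\<in>verts T. support p = {v}"
    then obtain v where v: "v \<in> verts T" "support p = {v}" by blast
    have "(\<Sum>w\<in>verts T. p w) = (\<Sum>w\<in>{v}. p w)"
      using v finite_verts by (intro sum.mono_neutral_right) (auto simp: support_def)
    then have "p v = 1" using p by simp
    then have "p = indicator {v}" using v(2) by (auto simp: support_def indicator_def fun_eq_iff)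
    then show ?thesis using v assms linear_path.trivial by metis
  qed
qed

lemma linear_path_vertices:
  assumes "(adj T)\<^sup>*\<^sup>* u v" "u \<in> verts T"
  shows "v \<in> verts T \<and> (\<exists>a. linear_path T (indicator {u}) a (indicator {v}))"
  using assms
proof (induction rule: rtranclp_induct)
  case base
  then show ?case using linear_path.trivial vertex_in_realization by blast
next
  case (step v w)
  then have e: "{v, w} \<in> edges T" and v: "v \<in> verts T" by (auto simp: adj_def)
  then have w: "w \<in> verts T" using edges_subset by auto
  have "linear_path T (indicator {v})
      (len T {v, w} * \<bar>indicator {v} v - indicator {w} v\<bar>) (indicator {w})"
    using e v w by (intro linear_path_single vertex_in_realization) (auto simp: support_indicator)
  then show ?case using step w linear_path_trans by blast
qed

lemma linear_path_exists:
  assumes "p \<in> realization T" "q \<in> realization T"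
  shows "\<exists>a. linear_path T p a q"
proof -
  obtain u a where u: "u \<in> verts T" "linear_path T p a (indicator {u})"
    using linear_path_to_vertex[OF assms(1)] by blast
  obtain v b where v: "v \<in> verts T" "linear_path T q b (indicator {v})"
    using linear_path_to_vertex[OF assms(2)] by blast
  obtain c where "linear_path T (indicator {u}) c (indicator {v})"
    using linear_path_vertices connected u v unfolding connected_graph_def by blast
  then show ?thesis
    using linear_path_trans[OF u(2)] linear_path_trans linear_path_sym[OF v(2)] by blast
qed

lemma path_lengths_bdd_below: "bdd_below {a. linear_path T p a q}"
  using linear_path_nonneg by (auto intro!: bdd_belowI)

sublocale realization: Metric_space "realization T" "path_dist T"
proof
  show "0 \<le> path_dist T p q" for p q
    using linear_path_exists[of p q] linear_path_nonneg
    by (auto simp: path_dist_def intro!: cInf_greatest)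
  show "path_dist T p q = path_dist T q p" for p q
  proof -
    have "{a. linear_path T p a q} = {a. linear_path T q a p}"
      using linear_path_sym by blast
    then show ?thesis by (auto simp: path_dist_def)
  qed
  show "path_dist T p q = 0 \<longleftrightarrow> p = q" if pq: "p \<in> realization T" "q \<in> realization T" for p q
  proof
    assume "p = q"
    then have "path_dist T p q \<le> 0"
      using pq linear_path.trivial path_lengths_bdd_below by (auto simp: path_dist_def intro!: cInf_lower)
    moreover have "0 \<le> path_dist T p q"
      using linear_path_exists[OF pq] linear_path_nonneg
      by (auto simp: path_dist_def intro!: cInf_greatest)
    ultimately show "path_dist T p q = 0" by simp
  next
    assume 0: "path_dist T p q = 0"
    define c where "c = Min (insert 1 (len T ` edges T))"
    have c: "0 < c" "\<And>e. e \<in> edges T \<Longrightarrow> c \<le> len T e"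
      using finite_edges len_pos by (auto simp: c_def)
    have "c * \<bar>p v - q v\<bar> \<le> path_dist T p q" for v
      using pq linear_path_exists[OF pq] coord_lower_bound[OF _ c]
      by (auto simp: path_dist_def intro!: cInf_greatest)
    then have "\<bar>p v - q v\<bar> \<le> 0" for v
      using 0 c(1) by (metis mult_le_0_iff abs_ge_zero order.antisym not_less)
    then show "p = q" by (auto simp: fun_eq_iff)
  qed
  show "path_dist T p z \<le> path_dist T p q + path_dist T q z"
    if pts: "p \<in> realization T" "q \<in> realization T" "z \<in> realization T" for p q z
  proof -
    have 1: "path_dist T p z \<le> a + b" if "linear_path T p a q" "linear_path T q b z" for a b
      using pts linear_path_trans[OF that] path_lengths_bdd_below
      by (auto simp: path_dist_def intro!: cInf_lower)
    have "path_dist T p z - b \<le> path_dist T p q" if "linear_path T q b z" for b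
      using pts linear_path_exists 1[OF _ that]
      by (auto simp: path_dist_def[of T p q] intro!: cInf_greatest) (smt (verit))
    then have "path_dist T p z - path_dist T p q \<le> path_dist T q z"
      using pts linear_path_exists
      by (auto simp: path_dist_def[of T q z] intro!: cInf_greatest) (smt (verit))
    then show ?thesis by simp
  qed
qed

end

section \<open>Covers\<close>

definition covers :: "'v weighted_graph \<Rightarrow> real list set" where
  "covers T = {rs. 1 \<le> length rs \<and> (\<forall>i<length rs. 0 \<le> rs ! i) \<and>
     (\<exists>v :: nat \<Rightarrow> 'v \<Rightarrow> real. (\<forall>i<length rs. v i \<in> realization T) \<and>
        realization T \<subseteq>
          (\<Union>i<length rs. Metric_space.mcball (realization T) (path_dist T) (v i) (rs ! i)))}"

definition zero_good_covers :: "'v weighted_graph \<Rightarrow> real list set" where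
  "zero_good_covers T = {rs \<in> covers T. (\<Sum>i<length rs. rs ! i) \<le> total_length T}"

section \<open>Measures on tuples\<close>

text \<open>
  The disjoint union Borel structure on all real tuples: a set of tuples is measurable iff for
  every \<open>m\<close> its \<open>m\<close>-tuples form a Borel set (see \<open>sets_tuple_borel\<close>).
\<close>

definition tuple_borel :: "real list measure" where
  "tuple_borel = sigma UNIV {A. \<forall>m.
     {x \<in> space (Pi\<^sub>M {..<m} (\<lambda>_. borel)). map x [0..<m] \<in> A} \<in> sets (Pi\<^sub>M {..<m} (\<lambda>_. borel))}"

lemma sets_tuple_borel:
  "A \<in> sets tuple_borel \<longleftrightarrow> (\<forall>m.
     {x \<in> space (Pi\<^sub>M {..<m} (\<lambda>_. borel)). map x [0..<m] \<in> A} \<in> sets (Pi\<^sub>M {..<m} (\<lambda>_. borel)))"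
proof -
  let ?P = "\<lambda>m. Pi\<^sub>M {..<m} (\<lambda>_. borel :: real measure)"
  let ?F = "{A. \<forall>m. {x \<in> space (?P m). map x [0..<m] \<in> A} \<in> sets (?P m)}"
  have "sigma_algebra UNIV ?F"
    unfolding sigma_algebra_iff2
  proof (intro conjI ballI allI impI)
    fix A assume A: "A \<in> ?F"
    have "{x \<in> space (?P m). map x [0..<m] \<in> UNIV - A} =
        space (?P m) - {x \<in> space (?P m). map x [0..<m] \<in> A}" for m by auto
    with A show "UNIV - A \<in> ?F" by auto
  next
    fix A :: "nat \<Rightarrow> real list set" assume A: "range A \<subseteq> ?F"
    have "{x \<in> space (?P m). map x [0..<m] \<in> (\<Union>i. A i)} =
        (\<Union>i. {x \<in> space (?P m). map x [0..<m] \<in> A i})" for m by auto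
    with A show "(\<Union>i. A i) \<in> ?F" by auto
  qed auto
  then have "sets tuple_borel = ?F"
    unfolding tuple_borel_def by (simp add: sigma_algebra.sigma_sets_eq)
  then show ?thesis by auto
qed

lemma space_tuple_borel [simp]: "space tuple_borel = UNIV"
  by (simp add: tuple_borel_def)

definition nonneg_borel :: "real measure" where
  "nonneg_borel = restrict_space borel {0..}"

definition radius_count :: "real set \<Rightarrow> real list \<Rightarrow> nat" where
  "radius_count A rs = card {i. i < length rs \<and> rs ! i \<in> A}"

text \<open>
  \<open>measure_of\<close> gives the stated values because the set function is a measure whenever \<open>\<nu>\<close>
  carries the Borel structure of a set of tuples: \<open>emeasure_expected_radius_measure\<close>.
\<close>

definition expected_radius_measure :: "real list measure \<Rightarrow> real measure" where
  "expected_radius_measure \<nu> =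
     measure_of {0..} (sets nonneg_borel) (\<lambda>A. \<integral>\<^sup>+ rs. of_nat (radius_count A rs) \<partial>\<nu>)"

lemma radius_count_eq_sum: "radius_count A rs = (\<Sum>i<length rs. indicator A (rs ! i))"
proof -
  have "(\<Sum>i<length rs. indicator A (rs ! i)) = card {i\<in>{..<length rs}. rs ! i \<in> A}"
    by (subst sum.inter_filter[symmetric] | simp add: indicator_def sum.If_cases Int_def)+
  then show ?thesis by (simp add: radius_count_def)
qed

lemma measurable_radius_count [measurable]:
  assumes [measurable]: "A \<in> sets borel"
  shows "radius_count A \<in> measurable tuple_borel (count_space UNIV)"
proof (rule measurableI)
  fix B :: "nat set"
  show "radius_count A -` B \<inter> space tuple_borel \<in> sets tuple_borel"
    unfolding sets_tuple_borel
  proof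
    fix m
    have eq: "{x \<in> space (Pi\<^sub>M {..<m} (\<lambda>_. borel)).
          map x [0..<m] \<in> radius_count A -` B \<inter> space tuple_borel} =
        {x \<in> space (Pi\<^sub>M {..<m} (\<lambda>_. borel)). (\<Sum>i<m. indicator A (x i)) \<in> B}"
      by (auto simp: radius_count_eq_sum)
    show "{x \<in> space (Pi\<^sub>M {..<m} (\<lambda>_. borel)).
          map x [0..<m] \<in> radius_count A -` B \<inter> space tuple_borel}
        \<in> sets (Pi\<^sub>M {..<m} (\<lambda>_. borel))"
    proof -
      have [measurable]: "(\<lambda>x. indicator A (x i) :: nat) \<in>
          measurable (Pi\<^sub>M {..<m} (\<lambda>_. borel :: real measure)) (count_space UNIV)" if "i < m" for i
      proof -
        have [measurable]: "(\<lambda>x. x i) \<in> measurable (Pi\<^sub>M {..<m} (\<lambda>_. borel :: real measure)) borel"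
          using that by (intro measurable_component_singleton) simp
        show ?thesis unfolding indicator_def by measurable
      qed
      show ?thesis
        unfolding eq by measurable
    qed
  qed
qed simp

lemma emeasure_expected_radius_measure:
  assumes \<nu>: "sets \<nu> = sets (restrict_space tuple_borel \<Omega>)" and A: "A \<in> sets nonneg_borel"
  shows "emeasure (expected_radius_measure \<nu>) A = (\<integral>\<^sup>+ rs. of_nat (radius_count A rs) \<partial>\<nu>)"
proof -
  have sets: "B \<in> sets borel" if "B \<in> sets nonneg_borel" for B
    using that by (auto simp: nonneg_borel_def sets_restrict_space)
  have meas: "(\<lambda>rs. of_nat (radius_count B rs) :: ennreal) \<in> borel_measurable \<nu>"
    if "B \<in> sets nonneg_borel" for B
  proof -
    have "radius_count B \<in> measurable (restrict_space tuple_borel \<Omega>) (count_space UNIV)"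
      by (intro measurable_restrict_space1 measurable_radius_count sets that)
    then have [measurable]: "radius_count B \<in> measurable \<nu> (count_space UNIV)"
      using measurable_cong_sets[OF \<nu> refl] by blast
    show ?thesis by measurable
  qed
  have count: "(\<Sum>n. of_nat (radius_count (F n) rs)) =
      (of_nat (radius_count (\<Union>n. F n) rs) :: ennreal)"
    if "disjoint_family F" for F :: "nat \<Rightarrow> real set" and rs
  proof -
    have "(of_nat (radius_count B rs) :: ennreal) = (\<Sum>i<length rs. indicator B (rs ! i))" for B
      by (simp add: radius_count_eq_sum indicator_def of_nat_sum if_distrib cong: if_cong)
    then show ?thesis
      using that by (simp add: suminf_sum suminf_indicator)
  qed
  show ?thesis
    unfolding expected_radius_measure_def
  proof (rule emeasure_measure_of_sigma)
    show "sigma_algebra {0..} (sets nonneg_borel)"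
      using sets.sigma_algebra_axioms[of nonneg_borel]
      by (simp add: nonneg_borel_def space_restrict_space)
    show "positive (sets nonneg_borel) (\<lambda>A. \<integral>\<^sup>+ rs. of_nat (radius_count A rs) \<partial>\<nu>)"
      by (simp add: positive_def radius_count_def)
    show "countably_additive (sets nonneg_borel) (\<lambda>A. \<integral>\<^sup>+ rs. of_nat (radius_count A rs) \<partial>\<nu>)"
    proof (rule countably_additiveI)
      fix F :: "nat \<Rightarrow> real set"
      assume F: "range F \<subseteq> sets nonneg_borel" "disjoint_family F"
      have "(\<Sum>n. \<integral>\<^sup>+ rs. of_nat (radius_count (F n) rs) \<partial>\<nu>) =
          (\<integral>\<^sup>+ rs. (\<Sum>n. of_nat (radius_count (F n) rs)) \<partial>\<nu>)"
        using F meas by (intro nn_integral_suminf[symmetric]) auto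
      then show "(\<Sum>n. \<integral>\<^sup>+ rs. of_nat (radius_count (F n) rs) \<partial>\<nu>) =
          (\<integral>\<^sup>+ rs. of_nat (radius_count (\<Union>n. F n) rs) \<partial>\<nu>)"
        by (simp add: count[OF F(2)])
    qed
  qed (rule A)
qed

definition uniform_radius :: "real \<Rightarrow> real measure" where
  "uniform_radius r = restrict_space (uniform_measure lborel {0..r}) {0..}"

end

theory Submission
  imports Defs
begin

text \<open>
  Let \<open>L\<close> be the total length. Root the tree at an end of a longest path and cut it into paths that
  run away from the root: path \<open>0\<close> is a longest path, of length \<open>l 0\<close>, and path \<open>i > 0\<close> occupies the
  depths from \<open>y i\<close> to \<open>l i\<close>, leaves an earlier path at depth \<open>y i\<close>, and that earlier path reaches at
  least as deep. Since the root ends a longest path, \<open>l i \<le> 2 * y i\<close>.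

  Fix a width \<open>w\<close> with \<open>2 * w \<le> l 0\<close> and cut the depths into bands of height \<open>2 * w\<close> with a uniformly
  random offset. In the band with top \<open>t\<close>, a path that leaves the band or ends at depth \<open>t + e\<close>
  receives a ball of radius \<open>e / 2\<close> around its point at depth \<open>t + e / 2\<close>, unless that depth belongs to
  an earlier path; in this case a ball of an earlier path already covers its part of the band. This is
  \<open>band_cover\<close>, and it makes every offset a cover (\<open>band_covers\<close>). On average over the offset, path
  \<open>i > 0\<close> of length \<open>eta i = l i - y i\<close> contributes at most the mass \<open>(eta i - w) / (2 * w)\<close> at radius \<open>w\<close> and
  a uniform measure on \<open>[0, w]\<close> of mass \<open>1\<close> if \<open>eta i \<ge> w\<close>, and a uniform measure on \<open>[0, eta i]\<close> of mass
  \<open>eta i / w\<close> otherwise. In the second case the radii are stretched by \<open>w / eta i\<close>. Altogether, the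
  expected radius measure of width \<open>w\<close> is at most an atom of mass \<open>excess w / (2 * w)\<close> at \<open>w\<close> plus the
  density \<open>beta w / w\<close> on \<open>[0, w]\<close>, where \<open>excess w + w * beta w = L\<close>: see \<open>nn_integral_tuple_count_le\<close>.

  The stretching may push the sum of the radii above \<open>L\<close>. Then balls are dropped one at a time until
  the sum is at most \<open>L\<close>. All radii are at most \<open>l 0 / 2\<close>, so the sum remains above \<open>L - l 0 / 2\<close>, and
  radii with such a sum cover the tree in any case: place them along a walk of length \<open>2 * L - l 0\<close> that
  follows path \<open>0\<close> and makes a detour to and fro along every other path (\<open>covers_if_sum_large\<close>,
  \<open>trim_zero_good\<close>).

  It remains to choose \<open>w\<close> at random so that the atoms smear out to a bounded density. If \<open>2 * r < l 0\<close>,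
  let \<open>h\<close> solve \<open>h' = q * h\<close> with \<open>q = 2 * beta / excess\<close> and \<open>h r = 1 / r\<^sup>2\<close>, and give \<open>w\<close> the density
  \<open>(w\<^sup>2 * h w)' = 2 * w * h w * L / excess w\<close> on \<open>[0, r]\<close>. The atoms then contribute the density \<open>L * h s\<close>
  at \<open>s\<close>, and the widths beyond \<open>s\<close> contribute the integral of \<open>L * h * q = (L * h)'\<close> from \<open>s\<close> to \<open>r\<close>,
  that is \<open>L * h r - L * h s\<close>. The sum is the constant \<open>L / r\<^sup>2\<close>, the density of the right-hand side. If
  \<open>l 0 \<le> 2 * r\<close>, the atom vanishes at \<open>w = l 0 / 2\<close>, and one mixes this width with single balls of a
  radius between \<open>l 0 / 2\<close> and \<open>r\<close>; here \<open>2 * r \<le> L\<close> is what bounds the density.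
\<close>

section \<open>Pruning a tree at a pendant vertex\<close>

definition pendant :: "'v weighted_graph \<Rightarrow> 'v \<Rightarrow> 'v \<Rightarrow> bool" where
  "pendant T u a \<longleftrightarrow> {u, a} \<in> edges T \<and> (\<forall>b. {u, b} \<in> edges T \<longrightarrow> b = a)"

definition prune :: "'v weighted_graph \<Rightarrow> 'v \<Rightarrow> 'v \<Rightarrow> 'v weighted_graph" where
  "prune T u a = T\<lparr>verts := verts T - {u}, edges := edges T - {{u, a}}\<rparr>"

lemma prune_simps [simp]:
  "verts (prune T u a) = verts T - {u}" "edges (prune T u a) = edges T - {{u, a}}"
  "len (prune T u a) = len T"
  by (simp_all add: prune_def)

lemma (in metric_tree) edge_verts:
  assumes "{u, v} \<in> edges T"
  shows "u \<in> verts T" "v \<in> verts T" "u \<noteq> v"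
proof -
  have *: "{u, v} \<subseteq> verts T \<and> card {u, v} = 2" by (rule edges_subset[OF assms])
  then show "u \<in> verts T" "v \<in> verts T" by auto
  show "u \<noteq> v" using * by auto
qed

text \<open>
  The last vertex of a longest simple walk from \<open>p\<close> is pendant: a second neighbour would either
  prolong the walk or close a cycle. Starting at \<open>p\<close> makes this vertex differ from \<open>p\<close>.
\<close>
lemma (in metric_tree) pendant_exists:
  assumes p: "p \<in> verts T" and ne: "verts T \<noteq> {p}"
  shows "\<exists>u a. u \<noteq> p \<and> pendant T u a"
proof -
  define W where "W = {c. c \<noteq> [] \<and> hd c = p \<and> distinct c \<and> successively (adj T) c \<and> set c \<subseteq> verts T}"
  have "finite {c. set c \<subseteq> verts T \<and> distinct c}"
  proof (rule finite_subset[OF _ finite_lists_length_le[OF finite_verts, of "card (verts T)"]], rule subsetI)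
    fix c assume "c \<in> {c. set c \<subseteq> verts T \<and> distinct c}"
    then have c: "set c \<subseteq> verts T" "distinct c" by auto
    then have "length c \<le> card (verts T)"
      using card_mono[OF finite_verts c(1)] distinct_card[OF c(2)] by simp
    then show "c \<in> {xs. set xs \<subseteq> verts T \<and> length xs \<le> card (verts T)}" using c by simp
  qed
  then have finW: "finite W" by (rule rev_finite_subset) (auto simp: W_def)
  have pW: "[p] \<in> W" using p by (auto simp: W_def)
  obtain q where q: "q \<in> verts T" "q \<noteq> p" using p ne by auto
  have "(adj T)\<^sup>*\<^sup>* p q" using connected p q by (auto simp: connected_graph_def)
  then obtain n where n: "adj T p n"
    using q(2) by (metis converse_rtranclpE)
  then have nv: "n \<in> verts T" "n \<noteq> p" using edge_verts[of p n] by (auto simp: adj_def)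
  have pnW: "[p, n] \<in> W" using n nv p by (auto simp: W_def)
  obtain c where c: "c \<in> W" and mx: "\<And>c'. c' \<in> W \<Longrightarrow> length c' \<le> length c"
  proof -
    have "finite (length ` W)" "length ` W \<noteq> {}" using finW pW by auto
    then have "Max (length ` W) \<in> length ` W" and "\<And>c'. c' \<in> W \<Longrightarrow> length c' \<le> Max (length ` W)"
      by (auto intro: Max_in)
    then show ?thesis using that by (metis imageE)
  qed
  have len2: "2 \<le> length c" using mx[OF pnW] by simp
  have cne: "c \<noteq> []" and hdc: "hd c = p" and dc: "distinct c" and sc: "successively (adj T) c"
    and cv: "set c \<subseteq> verts T" using c by (auto simp: W_def)
  define u where "u = last c"
  define a where "a = c ! (length c - 2)"
  have uidx: "u = c ! (length c - 1)" using cne by (simp add: u_def last_conv_nth)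
  have up: "u \<noteq> p"
  proof -
    have "c ! 0 \<noteq> c ! (length c - 1)" using dc len2 by (subst nth_eq_iff_index_eq) auto
    then show ?thesis using hdc cne by (simp add: uidx hd_conv_nth)
  qed
  have au: "adj T a u"
  proof -
    have "adj T (c ! (length c - 2)) (c ! Suc (length c - 2))"
      using sc len2 by (simp add: successively_conv_nth)
    moreover have "Suc (length c - 2) = length c - 1" using len2 by simp
    ultimately show ?thesis by (simp add: a_def uidx)
  qed
  have "pendant T u a"
    unfolding pendant_def
  proof (intro conjI allI impI)
    show "{u, a} \<in> edges T" using au by (simp add: adj_def insert_commute)
    fix b assume b: "{u, b} \<in> edges T"
    show "b = a"
    proof (rule ccontr)
      assume ba: "b \<noteq> a"
      have bv: "b \<in> verts T" "b \<noteq> u" using edge_verts[OF b] by auto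
      have adjub: "adj T u b" using b by (simp add: adj_def)
      show False
      proof (cases "b \<in> set c")
        case False
        have "c @ [b] \<in> W"
          using cne hdc dc sc cv False bv adjub
          by (auto simp: W_def successively_append_iff u_def)
        from mx[OF this] show False by simp
      next
        case True
        then obtain i where i: "i < length c" "c ! i = b" by (auto simp: in_set_conv_nth)
        have "i \<noteq> length c - 1" using i bv uidx by auto
        moreover have "i \<noteq> length c - 2" using i ba a_def by auto
        ultimately have i3: "i + 3 \<le> length c" using i(1) by linarith
        have "graph_cycle T (drop i c)"
          unfolding graph_cycle_def
        proof (intro conjI)
          show "3 \<le> length (drop i c)" using i3 by simp
          show "distinct (drop i c)" using dc by simp
          show "successively (adj T) (drop i c)"
            using sc by (metis append_take_drop_id successively_append_iff)
          show "adj T (last (drop i c)) (hd (drop i c))"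
            using i adjub by (simp add: last_drop hd_drop_conv_nth u_def)
        qed
        then show False using acyclic by blast
      qed
    qed
  qed
  then show ?thesis using up by blast
qed

lemma (in metric_tree) metric_tree_prune:
  assumes P: "pendant T u a"
  shows "metric_tree (prune T u a)"
proof
  have ua: "{u, a} \<in> edges T" and uniq: "\<And>b. {u, b} \<in> edges T \<Longrightarrow> b = a"
    using P by (auto simp: pendant_def)
  note uav = edge_verts[OF ua]
  show "finite (verts (prune T u a))" using finite_verts by simp
  show "verts (prune T u a) \<noteq> {}" using uav by auto
  show "e \<subseteq> verts (prune T u a) \<and> card e = 2" if "e \<in> edges (prune T u a)" for e
  proof -
    have e: "e \<in> edges T" "e \<noteq> {u, a}" using that by auto
    have "u \<notin> e"
    proof
      assume "u \<in> e"
      then obtain b where "e = {u, b}" using edges_subset[OF e(1)] by (auto simp: card_2_iff)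
      then show False using uniq e by auto
    qed
    then show ?thesis using edges_subset[OF e(1)] by auto
  qed
  show "0 < len (prune T u a) e" if "e \<in> edges (prune T u a)" for e
    using that len_pos by auto
  have sub: "adj (prune T u a) x y \<Longrightarrow> adj T x y" for x y by (auto simp: adj_def)
  show "\<not> graph_cycle (prune T u a) c" for c
  proof
    assume "graph_cycle (prune T u a) c"
    then have "graph_cycle T c"
      unfolding graph_cycle_def using sub by (auto elim: successively_mono)
    then show False using acyclic by blast
  qed
  have reach: "(z \<noteq> u \<longrightarrow> (adj (prune T u a))\<^sup>*\<^sup>* x z) \<and> (z = u \<longrightarrow> (adj (prune T u a))\<^sup>*\<^sup>* x a)"
    if "(adj T)\<^sup>*\<^sup>* x z" "x \<noteq> u" for x z
    using that
  proof (induction rule: rtranclp_induct)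
    case base
    then show ?case by simp
  next
    case (step y z)
    have yz: "{y, z} \<in> edges T" using step by (simp add: adj_def)
    show ?case
    proof (cases "y = u")
      case True
      then have "z = a" using uniq yz by auto
      then show ?thesis using step True uav by auto
    next
      case False
      then have IH: "(adj (prune T u a))\<^sup>*\<^sup>* x y" using step by auto
      show ?thesis
      proof (cases "z = u")
        case True
        then have "y = a" using uniq[of y] yz by (simp add: insert_commute)
        then show ?thesis using IH True by auto
      next
        case False
        have "{y, z} \<noteq> {u, a}" using False \<open>y \<noteq> u\<close> by (auto simp: doubleton_eq_iff)
        then have "adj (prune T u a) y z" using yz by (simp add: adj_def)
        then show ?thesis using IH False by (auto intro: rtranclp.rtrancl_into_rtrancl)
      qed
    qed
  qed
  show "connected_graph (prune T u a)"
    unfolding connected_graph_def using connected reach by (auto simp: connected_graph_def)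
qed

lemma (in metric_tree) singleton_edges:
  assumes "verts T = {p}" shows "edges T = {}"
proof -
  have "False" if e: "e \<in> edges T" for e
  proof -
    have "e \<subseteq> {p}" "card e = 2" using edges_subset[OF e] assms by auto
    then show False by (auto simp: subset_singleton_iff)
  qed
  then show ?thesis by blast
qed

section \<open>Depth functions\<close>

definition depth_function :: "'v weighted_graph \<Rightarrow> 'v \<Rightarrow> ('v \<Rightarrow> real) \<Rightarrow> bool" where
  "depth_function T p d \<longleftrightarrow> d p = 0 \<and>
     (\<forall>u v. {u, v} \<in> edges T \<longrightarrow> \<bar>d u - d v\<bar> = len T {u, v}) \<and>
     (\<forall>v\<in>verts T. v \<noteq> p \<longrightarrow> (\<exists>w. {v, w} \<in> edges T \<and> d w < d v))"

lemma depth_function_exists: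
  assumes "metric_tree T" "p \<in> verts T"
  shows "\<exists>d. depth_function T p d"
  using assms
proof (induction "card (verts T)" arbitrary: T rule: less_induct)
  case less
  interpret metric_tree T by (rule less.prems)
  show ?case
  proof (cases "verts T = {p}")
    case True
    then show ?thesis using singleton_edges[OF True]
      by (intro exI[of _ "\<lambda>_. 0"]) (simp add: depth_function_def)
  next
    case False
    obtain u a where up: "u \<noteq> p" and P: "pendant T u a" using pendant_exists less.prems False by blast
    have ua: "{u, a} \<in> edges T" and uniq: "\<And>b. {u, b} \<in> edges T \<Longrightarrow> b = a"
      using P by (auto simp: pendant_def)
    note uav = edge_verts[OF ua]
    obtain d where d: "depth_function (prune T u a) p d"
      using less.hyps[of "prune T u a"] metric_tree_prune[OF P] less.prems up uav finite_verts
      by (metis Diff_iff card_Diff1_less empty_iff insert_iff prune_simps(1))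
    define d' where "d' = d(u := d a + len T {u, a})"
    have [simp]: "d' u = d a + len T {u, a}" "\<And>v. v \<noteq> u \<Longrightarrow> d' v = d v" by (auto simp: d'_def)
    have "depth_function T p d'"
      unfolding depth_function_def
    proof (intro conjI allI impI ballI)
      show "d' p = 0" using d up by (simp add: depth_function_def)
    next
      fix v w assume vw: "{v, w} \<in> edges T"
      show "\<bar>d' v - d' w\<bar> = len T {v, w}"
      proof (cases "{v, w} = {u, a}")
        case True
        then show ?thesis using uav len_pos[OF ua] by (auto simp: doubleton_eq_iff insert_commute)
      next
        case False
        have "v \<noteq> u" using False uniq vw by auto
        moreover have "w \<noteq> u" using False uniq[of v] vw by (auto simp: insert_commute)
        ultimately show ?thesis using d vw False by (auto simp: depth_function_def)
      qed
    next
      fix v assume v: "v \<in> verts T" "v \<noteq> p"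
      show "\<exists>w. {v, w} \<in> edges T \<and> d' w < d' v"
      proof (cases "v = u")
        case True
        then show ?thesis using ua len_pos[OF ua] uav by (intro exI[of _ a]) auto
      next
        case False
        then have "v \<in> verts (prune T u a)" using v by simp
        then obtain w where w: "{v, w} \<in> edges (prune T u a)" "d w < d v"
          using d v unfolding depth_function_def by blast
        interpret t: metric_tree "prune T u a" by (rule metric_tree_prune[OF P])
        have "w \<noteq> u" using t.edge_verts[OF w(1)] by auto
        then show ?thesis using w False by auto
      qed
    qed
    then show ?thesis by blast
  qed
qed

lemma (in metric_tree) sum_verts_eq_support:
  assumes "support z \<subseteq> X" "X \<subseteq> verts T"
  shows "(\<Sum>v\<in>verts T. z v * F v) = (\<Sum>v\<in>X. z v * F v)"
  using assms finite_verts by (intro sum.mono_neutral_right) (auto simp: support_def)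

text \<open>
  The tool for lower bounds on distances. The affine extension of \<open>F\<close> to the edges is
  1-Lipschitz along every piecewise linear path.
\<close>
lemma (in metric_tree) path_dist_ge_linear_extension:
  assumes F: "\<And>u v. {u, v} \<in> edges T \<Longrightarrow> \<bar>F u - F v\<bar> \<le> len T {u, v}"
    and zz: "z \<in> realization T" "z' \<in> realization T"
  shows "\<bar>(\<Sum>v\<in>verts T. z v * F v) - (\<Sum>v\<in>verts T. z' v * F v)\<bar> \<le> path_dist T z z'"
proof -
  have path: "\<bar>(\<Sum>v\<in>verts T. z v * F v) - (\<Sum>v\<in>verts T. z' v * F v)\<bar> \<le> a"
    if "linear_path T z a z'" for a
    using that
  proof (induction)
    case (trivial p)
    then show ?case by simp
  next
    case (piece p q e x a z)
    obtain y where e: "e = {x, y}" "x \<noteq> y"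
      using edges_subset[OF piece.hyps(3)] piece.hyps(6) by (auto simp: card_2_iff)
    have ev: "e \<subseteq> verts T" using edges_subset[OF piece.hyps(3)] by auto
    have one: "f x + f y = 1" if "f \<in> realization T" "support f \<subseteq> e" for f :: "'v \<Rightarrow> real"
    proof -
      have "(\<Sum>v\<in>verts T. f v * 1) = (\<Sum>v\<in>e. f v * 1)" by (rule sum_verts_eq_support[OF that(2) ev])
      then show ?thesis using that(1) e by (simp add: realization_def)
    qed
    have two: "(\<Sum>v\<in>verts T. f v * F v) = f x * F x + f y * F y" if "support f \<subseteq> e" for f :: "'v \<Rightarrow> real"
      using sum_verts_eq_support[OF that ev, of F] e by simp
    have "(\<Sum>v\<in>verts T. p v * F v) - (\<Sum>v\<in>verts T. q v * F v)
        = p x * F x + p y * F y - (q x * F x + q y * F y)"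
      using two piece.hyps by simp
    also have "\<dots> = (p x - q x) * (F x - F y)"
    proof -
      have py: "p y = 1 - p x" "q y = 1 - q x" using one[of p] one[of q] piece.hyps by simp_all
      show ?thesis unfolding py by (simp add: algebra_simps)
    qed
    finally have "\<bar>(\<Sum>v\<in>verts T. p v * F v) - (\<Sum>v\<in>verts T. q v * F v)\<bar> = \<bar>F x - F y\<bar> * \<bar>p x - q x\<bar>"
      by (simp add: abs_mult)
    also have "\<dots> \<le> len T e * \<bar>p x - q x\<bar>"
      using F[of x y] piece.hyps(3) e by (intro mult_right_mono) auto
    finally show ?case using piece.IH by linarith
  qed
  show ?thesis
    using zz linear_path_exists[OF zz] path by (auto simp: path_dist_def intro!: cInf_greatest)
qed

lemma (in metric_tree) path_dist_le:
  assumes "linear_path T z a z'"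
  shows "path_dist T z z' \<le> a"
  using linear_path_points[OF assms] assms path_lengths_bdd_below
  by (auto simp: path_dist_def intro!: cInf_lower)

section \<open>Decomposition into paths away from a root\<close>

definition segment :: "'v \<Rightarrow> 'v \<Rightarrow> real \<Rightarrow> 'v \<Rightarrow> real" where
  "segment a u c = (\<lambda>w. if w = u then c else if w = a then 1 - c else 0)"

lemma segment_0: "a \<noteq> u \<Longrightarrow> segment a u 0 = indicator {a}"
  by (auto simp: segment_def indicator_def fun_eq_iff)

lemma segment_1: "segment a u 1 = indicator {u}"
  by (auto simp: segment_def indicator_def fun_eq_iff)

lemma support_segment: "support (segment a u c) \<subseteq> {u, a}"
  by (auto simp: support_def segment_def)

lemma (in metric_tree) segment_in_realization:
  assumes e: "{u, a} \<in> edges T" and c: "0 \<le> c" "c \<le> 1"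
  shows "segment a u c \<in> realization T"
proof -
  note uav = edge_verts[OF e]
  consider "c = 0" | "c = 1" | "0 < c" "c < 1" using c by linarith
  then show ?thesis
  proof cases
    case 1
    then show ?thesis using vertex_in_realization[OF uav(2)] uav by (simp add: segment_0)
  next
    case 2
    then show ?thesis using vertex_in_realization[OF uav(1)] by (simp add: segment_1)
  next
    case 3
    then have supp: "support (segment a u c) = {u, a}"
      using uav by (auto simp: support_def segment_def)
    have "(\<Sum>v\<in>verts T. segment a u c v * 1) = (\<Sum>v\<in>{u, a}. segment a u c v * 1)"
      using supp uav by (intro sum_verts_eq_support) auto
    also have "\<dots> = 1" using uav by (simp add: segment_def)
    finally show ?thesis using supp e c by (simp add: realization_def segment_def)
  qed
qed

lemma (in metric_tree) path_dist_segment: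
  assumes e: "{u, a} \<in> edges T" and c: "0 \<le> c" "c \<le> 1" "0 \<le> c'" "c' \<le> 1"
  shows "path_dist T (segment a u c) (segment a u c') \<le> len T {u, a} * \<bar>c - c'\<bar>"
proof -
  have "linear_path T (segment a u c) (len T {u, a} * \<bar>segment a u c u - segment a u c' u\<bar>) (segment a u c')"
    using e c by (intro linear_path_single segment_in_realization support_segment) auto
  from path_dist_le[OF this] show ?thesis by (simp add: segment_def)
qed

lemma realization_edge_is_segment:
  assumes "metric_tree T" "z \<in> realization T" "support z = {u, a}" "u \<noteq> a" "{u, a} \<subseteq> verts T"
  shows "z = segment a u (z u)" "0 \<le> z u" "z u \<le> 1"
proof -
  interpret metric_tree T by fact
  have "(\<Sum>v\<in>verts T. z v * 1) = (\<Sum>v\<in>{u, a}. z v * 1)"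
    using assms by (intro sum_verts_eq_support) auto
  then have s: "z u + z a = 1" using assms by (simp add: realization_def)
  have nn: "0 \<le> z v" for v using assms by (simp add: realization_def)
  show "0 \<le> z u" "z u \<le> 1" using s nn[of u] nn[of a] by linarith+
  have "z w = 0" if "w \<noteq> u" "w \<noteq> a" for w using that assms(3) by (auto simp: support_def)
  then show "z = segment a u (z u)" using s by (auto simp: segment_def fun_eq_iff)
qed

lemma (in metric_tree) realization_point_vertex:
  assumes "z \<in> realization T" "support z = {v}" "v \<in> verts T"
  shows "z = indicator {v}"
proof -
  have "(\<Sum>w\<in>verts T. z w * 1) = (\<Sum>w\<in>{v}. z w * 1)"
    using assms by (intro sum_verts_eq_support) auto
  then have "z v = 1" using assms by (simp add: realization_def)
  then show ?thesis using assms(2) by (auto simp: support_def indicator_def fun_eq_iff)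
qed

lemma (in metric_tree) realization_prune_subset:
  assumes P: "pendant T u a"
  shows "realization (prune T u a) \<subseteq> realization T"
proof
  fix z assume z: "z \<in> realization (prune T u a)"
  interpret t: metric_tree "prune T u a" by (rule metric_tree_prune[OF P])
  have "support z \<in> edges (prune T u a) \<or> (\<exists>v\<in>verts (prune T u a). support z = {v})"
    using z by (auto simp: realization_def)
  moreover from this have "support z \<subseteq> verts (prune T u a)" using t.edges_subset by fastforce
  then have "(\<Sum>v\<in>verts T. z v * 1) = (\<Sum>v\<in>verts (prune T u a). z v * 1)"
    by (intro sum_verts_eq_support) auto
  then have "(\<Sum>v\<in>verts T. z v) = 1" using z by (simp add: realization_def)
  ultimately show "z \<in> realization T" using z by (auto simp: realization_def)
qed

lemma (in metric_tree) path_dist_prune: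
  assumes P: "pendant T u a"
    and z: "z \<in> realization (prune T u a)" "z' \<in> realization (prune T u a)"
  shows "path_dist T z z' \<le> path_dist (prune T u a) z z'"
proof -
  interpret t: metric_tree "prune T u a" by (rule metric_tree_prune[OF P])
  have "linear_path T x b x'" if "linear_path (prune T u a) x b x'" for x b x'
    using that
  proof (induction)
    case (trivial p)
    then show ?case using realization_prune_subset[OF P] by (auto intro: linear_path.trivial)
  next
    case (piece p q e x b z)
    then show ?case using realization_prune_subset[OF P] linear_path.piece[of p T q e x b z] by auto
  qed
  then have "path_dist T z z' \<le> b" if "linear_path (prune T u a) z b z'" for b
    using that path_dist_le by blast
  then show ?thesis
    using z t.linear_path_exists[OF z] by (auto simp: path_dist_def[of "prune T u a"] intro!: cInf_greatest)
qed

text \<open>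
  Path \<open>i\<close> is \<open>g i\<close> on \<open>[0, l i]\<close>, parametrized by depth from the root \<open>p\<close>; it runs along path \<open>par i\<close>
  up to depth \<open>y i\<close> and ends at the vertex \<open>e i\<close>. The last clauses carry the induction: all ends are
  pendant, so that a new pendant vertex of minimal depth can be attached without violating
  \<open>l i \<le> l (par i)\<close>; and \<open>S i\<close> is the part of the tree beyond the start of path \<open>i\<close>. It touches
  the rest at depth \<open>y i\<close> only, which later yields the distance between \<open>e i\<close> and \<open>e 0\<close>.
\<close>
definition decomposed ::
  "'v weighted_graph \<Rightarrow> 'v \<Rightarrow> ('v \<Rightarrow> real) \<Rightarrow> nat \<Rightarrow> (nat \<Rightarrow> real) \<Rightarrow> (nat \<Rightarrow> real) \<Rightarrow> (nat \<Rightarrow> nat) \<Rightarrow>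
   (nat \<Rightarrow> real \<Rightarrow> 'v \<Rightarrow> real) \<Rightarrow> (nat \<Rightarrow> 'v) \<Rightarrow> (nat \<Rightarrow> 'v set) \<Rightarrow> bool" where
  "decomposed T p d N y l par g e S \<longleftrightarrow>
     (0 < N \<and> y 0 = 0 \<and> 0 \<le> l 0) \<and>
     (\<forall>i. 0 < i \<and> i < N \<longrightarrow> par i < i \<and> 0 \<le> y i \<and> y i < l i \<and> l i \<le> l (par i) \<and>
        (\<forall>s. 0 \<le> s \<and> s \<le> y i \<longrightarrow> g i s = g (par i) s)) \<and>
     (\<forall>i<N. \<forall>s. 0 \<le> s \<and> s \<le> l i \<longrightarrow> g i s \<in> realization T) \<and>
     (\<forall>i<N. \<forall>s t. 0 \<le> s \<and> s \<le> l i \<and> 0 \<le> t \<and> t \<le> l i \<longrightarrow>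
        path_dist T (g i s) (g i t) \<le> \<bar>s - t\<bar>) \<and>
     (\<forall>z\<in>realization T. \<exists>i<N. \<exists>s. 0 \<le> s \<and> s \<le> l i \<and> z = g i s) \<and>
     total_length T = l 0 + (\<Sum>i\<in>{0<..<N}. l i - y i) \<and>
     (\<forall>i<N. e i \<in> verts T \<and> d (e i) = l i \<and> g i (l i) = indicator {e i}) \<and> inj_on e {..<N} \<and>
     (\<forall>i<N. g i 0 = indicator {p}) \<and>
     (\<forall>v\<in>verts T. \<exists>i<N. 0 \<le> d v \<and> d v \<le> l i \<and> g i (d v) = indicator {v}) \<and>
     (\<forall>i<N. verts T = {p} \<or> (e i \<noteq> p \<and> (\<exists>a. pendant T (e i) a))) \<and>
     (\<forall>i. 0 < i \<and> i < N \<longrightarrow> S i \<subseteq> verts T \<and> e i \<in> S i \<and> e 0 \<notin> S i \<and>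
        (\<forall>v w. {v, w} \<in> edges T \<and> v \<in> S i \<and> w \<notin> S i \<longrightarrow> d w = y i))"

text \<open>
  If the neighbour \<open>a\<close> of \<open>u\<close> is the end of a path, this path is prolonged to \<open>u\<close>; otherwise a new path
  leaves some path through \<open>a\<close>. In both cases the path on which \<open>u\<close> now hangs ends at a pendant vertex,
  which by the choice of \<open>u\<close> is at least as deep as \<open>u\<close>.
\<close>
lemma (in metric_tree) decomposed_prune_extend:
  assumes P: "pendant T u a" and up: "u \<noteq> p" and pv: "p \<in> verts T"
    and dl: "d u = d a + len T {u, a}"
    and minu: "\<And>v b. v \<noteq> p \<Longrightarrow> pendant T v b \<Longrightarrow> d u \<le> d v"
    and dec: "decomposed (prune T u a) p d N y l par g e S"
  shows "\<exists>N y l par g e S. decomposed T p d N y l par g e S"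
proof -
  have ua: "{u, a} \<in> edges T" and uniq: "\<And>b. {u, b} \<in> edges T \<Longrightarrow> b = a"
    using P by (auto simp: pendant_def)
  note uav = edge_verts[OF ua]
  have lpos: "0 < len T {u, a}" by (rule len_pos[OF ua])
  let ?T = "prune T u a"
  interpret t: metric_tree ?T by (rule metric_tree_prune[OF P])
  note D = dec[unfolded decomposed_def]
  note D0 = D[THEN conjunct1]
  note D1 = D[THEN conjunct2, THEN conjunct1]
  note D2 = D[THEN conjunct2, THEN conjunct2, THEN conjunct1]
  note D3 = D[THEN conjunct2, THEN conjunct2, THEN conjunct2, THEN conjunct1]
  note D4 = D[THEN conjunct2, THEN conjunct2, THEN conjunct2, THEN conjunct2, THEN conjunct1]
  note D5 = D[THEN conjunct2, THEN conjunct2, THEN conjunct2, THEN conjunct2, THEN conjunct2, THEN conjunct1]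
  note D6 = D[THEN conjunct2, THEN conjunct2, THEN conjunct2, THEN conjunct2, THEN conjunct2, THEN conjunct2, THEN conjunct1]
  note D7 = D[THEN conjunct2, THEN conjunct2, THEN conjunct2, THEN conjunct2, THEN conjunct2, THEN conjunct2, THEN conjunct2, THEN conjunct1]
  note D8 = D[THEN conjunct2, THEN conjunct2, THEN conjunct2, THEN conjunct2, THEN conjunct2, THEN conjunct2, THEN conjunct2, THEN conjunct2, THEN conjunct1]
  note D9 = D[THEN conjunct2, THEN conjunct2, THEN conjunct2, THEN conjunct2, THEN conjunct2, THEN conjunct2, THEN conjunct2, THEN conjunct2, THEN conjunct2, THEN conjunct1]
  note D10 = D[THEN conjunct2, THEN conjunct2, THEN conjunct2, THEN conjunct2, THEN conjunct2, THEN conjunct2, THEN conjunct2, THEN conjunct2, THEN conjunct2, THEN conjunct2, THEN conjunct1]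
  note D11 = D[THEN conjunct2, THEN conjunct2, THEN conjunct2, THEN conjunct2, THEN conjunct2, THEN conjunct2, THEN conjunct2, THEN conjunct2, THEN conjunct2, THEN conjunct2, THEN conjunct2]
  have N: "0 < N" "y 0 = 0" "0 \<le> l 0"
    using D0 by blast+
  have par: "\<And>i. 0 < i \<Longrightarrow> i < N \<Longrightarrow> par i < i \<and> 0 \<le> y i \<and> y i < l i \<and> l i \<le> l (par i)"
    using D1 by blast+
  have agree: "\<And>i s. 0 < i \<Longrightarrow> i < N \<Longrightarrow> 0 \<le> s \<Longrightarrow> s \<le> y i \<Longrightarrow> g i s = g (par i) s"
    using D1 by blast+
  have gr: "\<And>i s. i < N \<Longrightarrow> 0 \<le> s \<Longrightarrow> s \<le> l i \<Longrightarrow> g i s \<in> realization ?T"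
    using D2 by blast+
  have gd: "\<And>i s t. i < N \<Longrightarrow> 0 \<le> s \<Longrightarrow> s \<le> l i \<Longrightarrow> 0 \<le> t \<Longrightarrow> t \<le> l i \<Longrightarrow>
      path_dist ?T (g i s) (g i t) \<le> \<bar>s - t\<bar>"
    using D3 by blast+
  have onto: "\<And>z. z \<in> realization ?T \<Longrightarrow> \<exists>i<N. \<exists>s. 0 \<le> s \<and> s \<le> l i \<and> z = g i s"
    using D4 by blast+
  have tot: "total_length ?T = l 0 + (\<Sum>i\<in>{0<..<N}. l i - y i)"
    using D5 by blast+
  have e: "\<And>i. i < N \<Longrightarrow> e i \<in> verts ?T \<and> d (e i) = l i \<and> g i (l i) = indicator {e i}"
    using D6 by blast+
  have einj: "inj_on e {..<N}"
    using D7 by blast+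
  have g0: "\<And>i. i < N \<Longrightarrow> g i 0 = indicator {p}"
    using D8 by blast+
  have vx: "\<And>v. v \<in> verts ?T \<Longrightarrow> \<exists>i<N. 0 \<le> d v \<and> d v \<le> l i \<and> g i (d v) = indicator {v}"
    using D9 by blast+
  have ends: "\<And>i. i < N \<Longrightarrow> verts ?T = {p} \<or> (e i \<noteq> p \<and> (\<exists>a. pendant ?T (e i) a))"
    using D10 by blast+
  have S: "\<And>i. 0 < i \<Longrightarrow> i < N \<Longrightarrow> S i \<subseteq> verts ?T \<and> e i \<in> S i \<and> e 0 \<notin> S i"
    using D11 by blast+
  have Sb: "\<And>i v w. 0 < i \<Longrightarrow> i < N \<Longrightarrow> {v, w} \<in> edges ?T \<Longrightarrow> v \<in> S i \<Longrightarrow> w \<notin> S i \<Longrightarrow> d w = y i"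
    using D11 by blast+
  have lnn: "0 \<le> l i" if "i < N" for i
  proof (cases "i = 0")
    case False
    then show ?thesis using par[of i] that by linarith
  qed (use N in simp)
  have ends': "e i \<noteq> p \<and> (\<exists>b. pendant T (e i) b)" if i: "i < N" and ne: "e i \<noteq> a" for i
  proof -
    have "verts ?T \<noteq> {p}"
    proof
      assume "verts ?T = {p}"
      then have "e i = p" "a = p" using e[OF i] uav by auto
      then show False using ne by simp
    qed
    then obtain c where c: "e i \<noteq> p" "pendant ?T (e i) c" using ends[OF i] by auto
    have eu: "e i \<noteq> u" using e[OF i] by auto
    have "b = c" if b: "{e i, b} \<in> edges T" for b
    proof -
      have "{e i, b} \<noteq> {u, a}" using eu ne by (auto simp: doubleton_eq_iff)
      then show ?thesis using c(2) b by (auto simp: pendant_def)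
    qed
    then have "pendant T (e i) c" using c(2) by (auto simp: pendant_def)
    then show ?thesis using c by blast
  qed
  have du_le: "d u \<le> l i" if i: "i < N" and ne: "e i \<noteq> a" for i
    using ends'[OF i ne] minu e[OF i] by metis
  have pendu: "\<exists>b. pendant T u b" using P by blast
  have aT: "a \<in> verts ?T" using uav by auto
  have dann: "0 \<le> d a" using vx[OF aT] by blast
  have dau: "d a < d u" using dl lpos by simp
  have gr': "g i s \<in> realization T" if "i < N" "0 \<le> s" "s \<le> l i" for i s
    using gr[OF that] realization_prune_subset[OF P] by blast
  have gd': "path_dist T (g i s) (g i t) \<le> \<bar>s - t\<bar>"
    if "i < N" "0 \<le> s" "s \<le> l i" "0 \<le> t" "t \<le> l i" for i s t
    using path_dist_prune[OF P gr[OF that(1,2,3)] gr[OF that(1,4,5)]] gd[OF that] by linarith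
  have tot': "total_length T = total_length ?T + (d u - d a)"
    unfolding total_length_def dl using sum.remove[OF finite_edges ua, of "len T"] by simp
  \<comment> \<open>prolonging a path through \<open>a\<close> by the edge to \<open>u\<close>\<close>
  define G where "G j s = (if s \<le> d a then g j s else segment a u ((s - d a) / len T {u, a}))" for j s
  have Gsmall: "G j s = g j s" if "s \<le> d a" for j s using that by (simp add: G_def)
  have Gbig: "G j s = segment a u ((s - d a) / len T {u, a})"
    if "d a \<le> s" "g j (d a) = indicator {a}" for j s
    using that uav(3) by (auto simp: G_def segment_0)
  have Gu: "G j (d u) = indicator {u}" for j
    using dau dl lpos by (simp add: G_def segment_1)
  have frac: "0 \<le> (s - d a) / len T {u, a}" "(s - d a) / len T {u, a} \<le> 1" if "d a \<le> s" "s \<le> d u" for s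
    using that lpos dl by (auto simp: field_simps)
  have GR: "G j s \<in> realization T" if "j < N" "d a \<le> l j" "0 \<le> s" "s \<le> d u" for j s
    using that gr'[of j s] segment_in_realization[OF ua frac[of s]] by (auto simp: G_def)
  have GD: "path_dist T (G j s) (G j t) \<le> \<bar>s - t\<bar>"
    if j: "j < N" "d a \<le> l j" "g j (d a) = indicator {a}" and st: "0 \<le> s" "s \<le> d u" "0 \<le> t" "t \<le> d u" for j s t
  proof -
    have big: "path_dist T (G j s) (G j t) \<le> \<bar>s - t\<bar>" if "d a \<le> s" "d a \<le> t" "s \<le> d u" "t \<le> d u" for s t
    proof -
      have "path_dist T (G j s) (G j t) \<le> len T {u, a} * \<bar>(s - d a) / len T {u, a} - (t - d a) / len T {u, a}\<bar>"
        unfolding Gbig[OF that(1) j(3)] Gbig[OF that(2) j(3)]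
        using frac[of s] frac[of t] that by (intro path_dist_segment ua) auto
      also have "\<dots> = \<bar>s - t\<bar>"
        using lpos by (simp add: diff_divide_distrib[symmetric] abs_divide)
      finally show ?thesis .
    qed
    have mixed: "path_dist T (G j s) (G j t) \<le> t - s" if "0 \<le> s" "s \<le> d a" "d a \<le> t" "t \<le> d u" for s t
    proof -
      have "path_dist T (G j s) (G j t) \<le> path_dist T (G j s) (G j (d a)) + path_dist T (G j (d a)) (G j t)"
        using that j dau dann by (intro realization.triangle GR) auto
      also have "path_dist T (G j s) (G j (d a)) \<le> d a - s"
        using gd'[of j s "d a"] that j dann by (simp add: Gsmall)
      also have "path_dist T (G j (d a)) (G j t) \<le> t - d a"
        using big[of "d a" t] that dau by simp
      finally show ?thesis by simp
    qed
    consider "s \<le> d a" "t \<le> d a" | "d a \<le> s" "d a \<le> t" | "s \<le> d a" "d a \<le> t" | "t \<le> d a" "d a \<le> s"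
      by linarith
    then show ?thesis
    proof cases
      case 1
      then show ?thesis using gd'[of j s t] st j by (simp add: Gsmall)
    next
      case 2
      then show ?thesis using big st by simp
    next
      case 3
      then show ?thesis using mixed[of s t] st by simp
    next
      case 4
      then show ?thesis using mixed[of t s] st realization.commute[of "G j s" "G j t"] by simp
    qed
  qed
  have newpt: "\<exists>s. 0 \<le> s \<and> s \<le> d u \<and> z = G j s"
    if z: "z \<in> realization T" "z \<notin> realization ?T" and j: "j < N" "g j (d a) = indicator {a}" for z j
  proof -
    have "support z \<in> edges T \<or> (\<exists>v\<in>verts T. support z = {v})" using z by (auto simp: realization_def)
    moreover have "support z \<subseteq> verts ?T \<Longrightarrow> (\<Sum>v\<in>verts ?T. z v) = 1"
      using sum_verts_eq_support[of z "verts ?T" "\<lambda>_. 1"] z(1) by (simp add: realization_def)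
    ultimately have "support z = {u, a} \<or> support z = {u}"
      using z t.edges_subset by (auto simp: realization_def)
    then show ?thesis
    proof
      assume s: "support z = {u, a}"
      have seg: "z = segment a u (z u)" "0 \<le> z u" "z u \<le> 1"
        using realization_edge_is_segment[of T z u a] metric_tree_axioms z(1) s uav by auto
      have "G j (d a + z u * len T {u, a}) = z"
        using seg lpos j by (subst Gbig) auto
      moreover have "z u * len T {u, a} \<le> len T {u, a}" using seg lpos by (simp add: mult_left_le_one_le)
      ultimately show ?thesis using seg lpos dann dl
        by (intro exI[of _ "d a + z u * len T {u, a}"]) auto
    next
      assume "support z = {u}"
      then have "z = indicator {u}" using realization_point_vertex z(1) uav by blast
      then show ?thesis using Gu[of j] dann dau by (intro exI[of _ "d u"]) auto
    qed
  qed
  define S' where "S' i = (if a \<in> S i then insert u (S i) else S i)" for i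
  have uS: "u \<notin> S i" if "0 < i" "i < N" for i using S[OF that] by auto
  have eu: "e i \<noteq> u" if "i < N" for i using e[OF that] by auto
  have S'b: "d w = y i" if i: "0 < i" "i < N" and vw: "{v, w} \<in> edges T" "v \<in> S' i" "w \<notin> S' i" for i v w
  proof (cases "{v, w} = {u, a}")
    case True
    then show ?thesis using vw uS[OF i] by (auto simp: S'_def doubleton_eq_iff split: if_splits)
  next
    case False
    have "v \<noteq> u" using False uniq vw by auto
    moreover have "w \<noteq> u" using False uniq[of v] vw by (auto simp: insert_commute)
    ultimately show ?thesis using Sb[OF i, of v w] vw False by (auto simp: S'_def split: if_splits)
  qed
  have S'v: "S' i \<subseteq> verts T" if "0 < i" "i < N" for i using S[OF that] uav by (auto simp: S'_def)
  show ?thesis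
  proof (cases "\<exists>j<N. e j = a")
    case True
    then obtain j where j: "j < N" "e j = a" by blast
    have lj: "l j = d a" "g j (d a) = indicator {a}" using e[OF j(1)] j(2) by auto
    have other: "e i \<noteq> a" if "i < N" "i \<noteq> j" for i
      using einj j that by (auto simp: inj_on_def)
    have GR': "(g(j := G j)) i s \<in> realization T" if "i < N" "0 \<le> s" "s \<le> (l(j := d u)) i" for i s
      using GR[of j s] gr'[of i s] that lj by (cases "i = j") auto
    have "decomposed T p d N y (l(j := d u)) par (g(j := G j)) (e(j := u)) S'"
      unfolding decomposed_def
    proof (intro conjI allI ballI impI; (elim conjE)?)
      show "0 < N" "y 0 = 0" "0 \<le> (l(j := d u)) 0" using N dau dann by auto
      fix i assume i: "0 < i" "i < N"
      show "par i < i" "0 \<le> y i" using par[OF i] by auto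
      show "y i < (l(j := d u)) i" using par[OF i] lj dau by auto
      show "(l(j := d u)) i \<le> (l(j := d u)) (par i)"
        using par[OF i] lj dau du_le[OF _ other, of "par i"] i by auto
    next
      fix i s assume i: "0 < i" "i < N" "0 \<le> s" "s \<le> y i"
      show "(g(j := G j)) i s = (g(j := G j)) (par i) s"
        using agree[OF i] par[OF i(1,2)] lj i by (auto simp: Gsmall)
    next
      fix i s assume "i < N" "0 \<le> s" "s \<le> (l(j := d u)) i"
      then show "(g(j := G j)) i s \<in> realization T" by (rule GR')
    next
      fix i s t assume "i < N" "0 \<le> s" "s \<le> (l(j := d u)) i" "0 \<le> t" "t \<le> (l(j := d u)) i"
      then show "path_dist T ((g(j := G j)) i s) ((g(j := G j)) i t) \<le> \<bar>s - t\<bar>"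
        using GD[of j s t] gd'[of i s t] lj by (cases "i = j") auto
    next
      fix z assume z: "z \<in> realization T"
      show "\<exists>i<N. \<exists>s. 0 \<le> s \<and> s \<le> (l(j := d u)) i \<and> z = (g(j := G j)) i s"
      proof (cases "z \<in> realization ?T")
        case True
        then obtain i s where is0: "i < N" "0 \<le> s" "s \<le> l i" "z = g i s" using onto by blast
        then show ?thesis
          using lj dau by (intro exI[of _ i] conjI exI[of _ s]) (auto simp: Gsmall)
      next
        case False
        from newpt[OF z this j(1) lj(2)] show ?thesis using j(1) by (intro exI[of _ j]) auto
      qed
    next
      have "(\<Sum>i\<in>{0<..<N}. (l(j := d u)) i - y i) + (l(j := d u)) 0
          = (\<Sum>i\<in>{0<..<N}. l i - y i) + l 0 + (d u - d a)"
      proof (cases "j = 0")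
        case True
        then show ?thesis using lj by (auto intro!: sum.cong)
      next
        case False
        then have "j \<in> {0<..<N}" using j by auto
        then have "(\<Sum>i\<in>{0<..<N}. (l(j := d u)) i - y i) = (\<Sum>i\<in>{0<..<N}. l i - y i) + (d u - l j)"
          by (subst (1 2) sum.remove[of _ j]) (auto intro!: sum.cong)
        then show ?thesis using False lj by simp
      qed
      then show "total_length T = (l(j := d u)) 0 + (\<Sum>i\<in>{0<..<N}. (l(j := d u)) i - y i)"
        using tot tot' by simp
    next
      fix i assume i: "i < N"
      show "(e(j := u)) i \<in> verts T" "d ((e(j := u)) i) = (l(j := d u)) i"
        "(g(j := G j)) i ((l(j := d u)) i) = indicator {(e(j := u)) i}"
        using e[OF i] uav Gu by auto
    next
      show "inj_on (e(j := u)) {..<N}" using einj eu by (auto simp: inj_on_def)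
    next
      fix i assume i: "i < N"
      show "(g(j := G j)) i 0 = indicator {p}" using g0[OF i] dann by (auto simp: Gsmall)
    next
      fix v assume v: "v \<in> verts T"
      show "\<exists>i<N. 0 \<le> d v \<and> d v \<le> (l(j := d u)) i \<and> (g(j := G j)) i (d v) = indicator {v}"
      proof (cases "v = u")
        case True
        then show ?thesis using j Gu dann dau by (intro exI[of _ j]) auto
      next
        case False
        then obtain i where i: "i < N" "0 \<le> d v" "d v \<le> l i" "g i (d v) = indicator {v}"
          using vx[of v] v by auto
        then show ?thesis using lj dau by (intro exI[of _ i]) (auto simp: Gsmall)
      qed
    next
      fix i assume i: "i < N"
      show "verts T = {p} \<or> (e(j := u)) i \<noteq> p \<and> (\<exists>a. pendant T ((e(j := u)) i) a)"
        using up pendu ends'[OF i other[OF i]] by auto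
    next
      fix i assume i: "0 < i" "i < N"
      show "S' i \<subseteq> verts T" by (rule S'v[OF i])
      show "(e(j := u)) i \<in> S' i" using S[OF i] j by (auto simp: S'_def)
      show "(e(j := u)) 0 \<notin> S' i" using S[OF i] j uS[OF i] eu[OF N(1)] by (auto simp: S'_def)
    next
      fix i v w assume "0 < i" "i < N" "{v, w} \<in> edges T" "v \<in> S' i" "w \<notin> S' i"
      then show "d w = y i" by (rule S'b)
    qed
    then show ?thesis by blast
  next
    case False
    obtain j where j: "j < N" "d a \<le> l j" "g j (d a) = indicator {a}" using vx[OF aT] by auto
    have GR': "(g(N := G j)) i s \<in> realization T" if "i < Suc N" "0 \<le> s" "s \<le> (l(N := d u)) i" for i s
      using GR[of j s] gr'[of i s] that j by (cases "i = N") auto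
    have "decomposed T p d (Suc N) (y(N := d a)) (l(N := d u)) (par(N := j)) (g(N := G j)) (e(N := u)) (S'(N := {u}))"
      unfolding decomposed_def
    proof (intro conjI allI ballI impI; (elim conjE)?)
      show "0 < Suc N" "(y(N := d a)) 0 = 0" "0 \<le> (l(N := d u)) 0" using N by auto
      fix i assume i: "0 < i" "i < Suc N"
      show "(par(N := j)) i < i" "0 \<le> (y(N := d a)) i" "(y(N := d a)) i < (l(N := d u)) i"
        using par[of i] i j dann dau by (cases "i = N"; auto)+
      show "(l(N := d u)) i \<le> (l(N := d u)) ((par(N := j)) i)"
      proof (cases "i = N")
        case True
        then show ?thesis using du_le[of j] j False by auto
      next
        case False
        then show ?thesis using par[of i] i by auto
      qed
    next
      fix i s assume i: "0 < i" "i < Suc N" "0 \<le> s" "s \<le> (y(N := d a)) i"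
      show "(g(N := G j)) i s = (g(N := G j)) ((par(N := j)) i) s"
        using agree[of i s] par[of i] i j by (cases "i = N") (auto simp: Gsmall)
    next
      fix i s assume "i < Suc N" "0 \<le> s" "s \<le> (l(N := d u)) i"
      then show "(g(N := G j)) i s \<in> realization T" by (rule GR')
    next
      fix i s t assume "i < Suc N" "0 \<le> s" "s \<le> (l(N := d u)) i" "0 \<le> t" "t \<le> (l(N := d u)) i"
      then show "path_dist T ((g(N := G j)) i s) ((g(N := G j)) i t) \<le> \<bar>s - t\<bar>"
        using GD[of j s t] gd'[of i s t] j by (cases "i = N") auto
    next
      fix z assume z: "z \<in> realization T"
      show "\<exists>i<Suc N. \<exists>s. 0 \<le> s \<and> s \<le> (l(N := d u)) i \<and> z = (g(N := G j)) i s"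
      proof (cases "z \<in> realization ?T")
        case True
        then obtain i s where is0: "i < N" "0 \<le> s" "s \<le> l i" "z = g i s" using onto by blast
        then show ?thesis by (intro exI[of _ i] conjI exI[of _ s]) auto
      next
        case False
        from newpt[OF z this j(1,3)] show ?thesis by (intro exI[of _ N]) auto
      qed
    next
      have "{0<..<Suc N} = insert N {0<..<N}" using N by auto
      then have "(\<Sum>i\<in>{0<..<Suc N}. (l(N := d u)) i - (y(N := d a)) i) = (\<Sum>i\<in>{0<..<N}. l i - y i) + (d u - d a)"
        by (simp add: add.commute)
      then show "total_length T = (l(N := d u)) 0 + (\<Sum>i\<in>{0<..<Suc N}. (l(N := d u)) i - (y(N := d a)) i)"
        using tot tot' N by simp
    next
      fix i assume i: "i < Suc N"
      show "(e(N := u)) i \<in> verts T" "d ((e(N := u)) i) = (l(N := d u)) i"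
        "(g(N := G j)) i ((l(N := d u)) i) = indicator {(e(N := u)) i}"
        using e[of i] i uav Gu by (cases "i = N"; auto)+
    next
      show "inj_on (e(N := u)) {..<Suc N}" using einj eu by (auto simp: inj_on_def less_Suc_eq; blast)
    next
      fix i assume i: "i < Suc N"
      show "(g(N := G j)) i 0 = indicator {p}" using g0[of i] g0[of j] i j dann by (cases "i = N") (auto simp: Gsmall)
    next
      fix v assume v: "v \<in> verts T"
      show "\<exists>i<Suc N. 0 \<le> d v \<and> d v \<le> (l(N := d u)) i \<and> (g(N := G j)) i (d v) = indicator {v}"
      proof (cases "v = u")
        case True
        then show ?thesis using j Gu dann dau by (intro exI[of _ N]) auto
      next
        case False
        then obtain i where i: "i < N" "0 \<le> d v" "d v \<le> l i" "g i (d v) = indicator {v}"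
          using vx[of v] v by auto
        then show ?thesis by (intro exI[of _ i]) auto
      qed
    next
      fix i assume i: "i < Suc N"
      show "verts T = {p} \<or> (e(N := u)) i \<noteq> p \<and> (\<exists>a. pendant T ((e(N := u)) i) a)"
        using up pendu ends'[of i] False i by (cases "i = N") auto
    next
      fix i assume i: "0 < i" "i < Suc N"
      show "(S'(N := {u})) i \<subseteq> verts T" using S'v[of i] i uav by (cases "i = N") auto
      show "(e(N := u)) i \<in> (S'(N := {u})) i" using S[of i] i by (cases "i = N") (auto simp: S'_def)
      show "(e(N := u)) 0 \<notin> (S'(N := {u})) i"
        using S[of i] i uS[of i] eu[OF N(1)] N by (cases "i = N") (auto simp: S'_def)
    next
      fix i v w assume "0 < i" "i < Suc N" "{v, w} \<in> edges T" "v \<in> (S'(N := {u})) i" "w \<notin> (S'(N := {u})) i"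
      then show "d w = (y(N := d a)) i"
        using S'b[of i v w] uniq by (cases "i = N") auto
    qed
    then show ?thesis by blast
  qed
qed

lemma depth_function_prune:
  assumes T: "metric_tree T" and P: "pendant T u a" and d: "depth_function T p d"
    and up: "u \<noteq> p"
  shows "depth_function (prune T u a) p d" "d u = d a + len T {u, a}"
proof -
  interpret metric_tree T by fact
  have ua: "{u, a} \<in> edges T" and uniq: "\<And>b. {u, b} \<in> edges T \<Longrightarrow> b = a"
    using P by (auto simp: pendant_def)
  note uav = edge_verts[OF ua]
  have "\<exists>w. {u, w} \<in> edges T \<and> d w < d u" using d uav up by (auto simp: depth_function_def)
  then have dau: "d a < d u" using uniq by auto
  have "\<bar>d u - d a\<bar> = len T {u, a}" using d ua by (auto simp: depth_function_def)
  then show "d u = d a + len T {u, a}" using dau by simp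
  show "depth_function (prune T u a) p d"
    unfolding depth_function_def
  proof (intro conjI allI impI ballI)
    show "d p = 0" using d by (simp add: depth_function_def)
    show "\<bar>d v - d w\<bar> = len (prune T u a) {v, w}" if "{v, w} \<in> edges (prune T u a)" for v w
      using d that by (simp add: depth_function_def)
    fix v assume v: "v \<in> verts (prune T u a)" "v \<noteq> p"
    then obtain w where w: "{v, w} \<in> edges T" "d w < d v" using d by (auto simp: depth_function_def)
    have "{v, w} \<noteq> {u, a}"
      using w dau v by (auto simp: doubleton_eq_iff)
    then show "\<exists>w. {v, w} \<in> edges (prune T u a) \<and> d w < d v" using w by auto
  qed
qed

text \<open>
  The removed vertex is as shallow as possible, as \<open>decomposed_prune_extend\<close> requires; this is what
  makes every path at most as deep as the path that it leaves.
\<close>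
lemma decomposed_exists:
  assumes "metric_tree T" "p \<in> verts T" "depth_function T p d"
  shows "\<exists>N y l par g e S. decomposed T p d N y l par g e S"
  using assms
proof (induction "card (verts T)" arbitrary: T rule: less_induct)
  case less
  interpret metric_tree T by (rule less.prems)
  show ?case
  proof (cases "verts T = {p}")
    case True
    note E = singleton_edges[OF True]
    have pt: "z = indicator {p}" if z: "z \<in> realization T" for z
    proof -
      have "support z = {p}" using z True E by (auto simp: realization_def)
      then show ?thesis using realization_point_vertex[OF z] True by simp
    qed
    have pR: "indicator {p} \<in> realization T" using vertex_in_realization True by blast
    have R: "realization T = {indicator {p}}" using pt pR by blast
    have zero: "path_dist T (indicator {p}) (indicator {p}) = 0"
      using realization.zero pR by blast
    have dp: "d p = 0" using less.prems(3) by (simp add: depth_function_def)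
    have tl: "total_length T = 0" by (simp add: total_length_def E)
    have "decomposed T p d 1 (\<lambda>_. 0) (\<lambda>_. 0) (\<lambda>_. 0) (\<lambda>_ _. indicator {p}) (\<lambda>_. p) (\<lambda>_. {})"
      unfolding decomposed_def
      by (simp add: R zero dp tl True inj_on_def) auto
    then show ?thesis by blast
  next
    case False
    define X where "X = {u \<in> verts T. u \<noteq> p \<and> (\<exists>a. pendant T u a)}"
    have "finite X" using finite_verts by (simp add: X_def)
    have pendv: "u \<in> verts T" if "pendant T u a" for u a
      using that edge_verts by (auto simp: pendant_def)
    have "X \<noteq> {}" using pendant_exists[OF less.prems(2) False] pendv by (auto simp: X_def)
    then have "Min (d ` X) \<in> d ` X" and "\<And>v. v \<in> X \<Longrightarrow> Min (d ` X) \<le> d v"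
      using \<open>finite X\<close> by (auto intro: Min_in)
    then obtain u where u: "u \<in> X" "\<And>v. v \<in> X \<Longrightarrow> d u \<le> d v" by fastforce
    then obtain a where P: "pendant T u a" and up: "u \<noteq> p" by (auto simp: X_def)
    note dp = depth_function_prune[OF less.prems(1) P less.prems(3) up]
    have "card (verts (prune T u a)) < card (verts T)"
      using pendv[OF P] finite_verts by (simp only: prune_simps) (rule card_Diff1_less)
    then obtain N y l par g e S where "decomposed (prune T u a) p d N y l par g e S"
      using less.hyps[OF _ metric_tree_prune[OF P] _ dp(1)] less.prems(2) up by auto
    from decomposed_prune_extend[OF P up less.prems(2) dp(2) _ this]
    show ?thesis using u(2) pendv unfolding X_def by blast
  qed
qed

text \<open>
  The bound \<open>l i \<le> 2 * y i\<close> says that a side path is no longer than the way from the root to its start.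
\<close>
locale long_path_decomposition = metric_tree T for T :: "'v weighted_graph" +
  fixes N :: nat and y l :: "nat \<Rightarrow> real" and par :: "nat \<Rightarrow> nat"
    and g :: "nat \<Rightarrow> real \<Rightarrow> 'v \<Rightarrow> real"
  assumes N_pos: "0 < N" and y_0: "y 0 = 0" and l_0: "0 \<le> l 0"
    and par_less: "\<And>i. 0 < i \<Longrightarrow> i < N \<Longrightarrow> par i < i"
    and y_nonneg: "\<And>i. 0 < i \<Longrightarrow> i < N \<Longrightarrow> 0 \<le> y i"
    and y_less: "\<And>i. 0 < i \<Longrightarrow> i < N \<Longrightarrow> y i < l i"
    and l_le_par: "\<And>i. 0 < i \<Longrightarrow> i < N \<Longrightarrow> l i \<le> l (par i)"
    and l_le_2y: "\<And>i. 0 < i \<Longrightarrow> i < N \<Longrightarrow> l i \<le> 2 * y i"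
    and g_par: "\<And>i s. 0 < i \<Longrightarrow> i < N \<Longrightarrow> 0 \<le> s \<Longrightarrow> s \<le> y i \<Longrightarrow> g i s = g (par i) s"
    and g_in: "\<And>i s. i < N \<Longrightarrow> 0 \<le> s \<Longrightarrow> s \<le> l i \<Longrightarrow> g i s \<in> realization T"
    and g_dist: "\<And>i s t. i < N \<Longrightarrow> 0 \<le> s \<Longrightarrow> s \<le> l i \<Longrightarrow> 0 \<le> t \<Longrightarrow> t \<le> l i \<Longrightarrow>
        path_dist T (g i s) (g i t) \<le> \<bar>s - t\<bar>"
    and g_onto: "\<And>z. z \<in> realization T \<Longrightarrow> \<exists>i<N. \<exists>s. 0 \<le> s \<and> s \<le> l i \<and> z = g i s"
    and total_length_eq: "total_length T = l 0 + (\<Sum>i\<in>{0<..<N}. l i - y i)"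

text \<open>
  The root \<open>p\<close> is an end of a diametral pair of vertices. Reflecting the depth at level \<open>y i\<close> on \<open>S i\<close>
  gives a function that is 1-Lipschitz along the edges and separates \<open>e 0\<close> from \<open>e i\<close> by
  \<open>l 0 + l i - 2 * y i\<close>; this is at most the diameter, hence at most \<open>l 0\<close>.
\<close>
lemma (in metric_tree) long_path_decomposition_exists:
  "\<exists>N y l par g. long_path_decomposition T N y l par g"
proof -
  define X where "X = (\<lambda>(p, q). path_dist T (indicator {p}) (indicator {q})) ` (verts T \<times> verts T)"
  have finX: "finite X" and "X \<noteq> {}" using finite_verts verts_nonempty by (auto simp: X_def)
  then have "Max X \<in> X" by (rule Max_in)
  then obtain p q where pq: "p \<in> verts T" "q \<in> verts T" "path_dist T (indicator {p}) (indicator {q}) = Max X"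
    by (auto simp: X_def)
  have diam: "path_dist T (indicator {u}) (indicator {v}) \<le> path_dist T (indicator {p}) (indicator {q})"
    if "u \<in> verts T" "v \<in> verts T" for u v
    unfolding pq(3) using that finX by (intro Max_ge) (auto simp: X_def)
  obtain d where d: "depth_function T p d" using depth_function_exists[OF metric_tree_axioms pq(1)] by blast
  obtain N y l par g e S where dec: "decomposed T p d N y l par g e S"
    using decomposed_exists[OF metric_tree_axioms pq(1) d] by blast
  note D = dec[unfolded decomposed_def]
  note D0 = D[THEN conjunct1]
  note D1 = D[THEN conjunct2, THEN conjunct1]
  note D2 = D[THEN conjunct2, THEN conjunct2, THEN conjunct1]
  note D3 = D[THEN conjunct2, THEN conjunct2, THEN conjunct2, THEN conjunct1]
  note D4 = D[THEN conjunct2, THEN conjunct2, THEN conjunct2, THEN conjunct2, THEN conjunct1]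
  note D5 = D[THEN conjunct2, THEN conjunct2, THEN conjunct2, THEN conjunct2, THEN conjunct2, THEN conjunct1]
  note D6 = D[THEN conjunct2, THEN conjunct2, THEN conjunct2, THEN conjunct2, THEN conjunct2, THEN conjunct2, THEN conjunct1]
  note D7 = D[THEN conjunct2, THEN conjunct2, THEN conjunct2, THEN conjunct2, THEN conjunct2, THEN conjunct2, THEN conjunct2, THEN conjunct1]
  note D8 = D[THEN conjunct2, THEN conjunct2, THEN conjunct2, THEN conjunct2, THEN conjunct2, THEN conjunct2, THEN conjunct2, THEN conjunct2, THEN conjunct1]
  note D9 = D[THEN conjunct2, THEN conjunct2, THEN conjunct2, THEN conjunct2, THEN conjunct2, THEN conjunct2, THEN conjunct2, THEN conjunct2, THEN conjunct2, THEN conjunct1]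
  note D10 = D[THEN conjunct2, THEN conjunct2, THEN conjunct2, THEN conjunct2, THEN conjunct2, THEN conjunct2, THEN conjunct2, THEN conjunct2, THEN conjunct2, THEN conjunct2, THEN conjunct1]
  note D11 = D[THEN conjunct2, THEN conjunct2, THEN conjunct2, THEN conjunct2, THEN conjunct2, THEN conjunct2, THEN conjunct2, THEN conjunct2, THEN conjunct2, THEN conjunct2, THEN conjunct2]
  have N: "0 < N" "y 0 = 0" "0 \<le> l 0"
    using D0 by blast+
  have par: "\<And>i. 0 < i \<Longrightarrow> i < N \<Longrightarrow> par i < i \<and> 0 \<le> y i \<and> y i < l i \<and> l i \<le> l (par i)"
    using D1 by blast
  have gd: "\<And>i s t. i < N \<Longrightarrow> 0 \<le> s \<Longrightarrow> s \<le> l i \<Longrightarrow> 0 \<le> t \<Longrightarrow> t \<le> l i \<Longrightarrow>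
      path_dist T (g i s) (g i t) \<le> \<bar>s - t\<bar>"
    using D3 by blast
  have l_le_0: "l i \<le> l 0" if "i < N" for i
    using that
  proof (induction i rule: less_induct)
    case (less i)
    show ?case
    proof (cases "i = 0")
      case False
      then have "l i \<le> l (par i)" "par i < i" using par[of i] less.prems by auto
      then show ?thesis using less.IH[of "par i"] less.prems by simp
    qed simp
  qed
  have diam_le: "path_dist T (indicator {p}) (indicator {q}) \<le> l 0"
  proof -
    obtain i where i: "i < N" "0 \<le> d q" "d q \<le> l i" "g i (d q) = indicator {q}" using D9 pq(2) by blast
    have "g i 0 = indicator {p}" using D8 i by blast
    then have "path_dist T (indicator {p}) (indicator {q}) \<le> d q" using gd[of i 0 "d q"] i by simp
    then show ?thesis using i l_le_0[OF i(1)] by linarith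
  qed
  have l2y: "l i \<le> 2 * y i" if i: "0 < i" "i < N" for i
  proof -
    have S: "S i \<subseteq> verts T" "e i \<in> S i" "e 0 \<notin> S i"
      and Sb: "\<And>v w. {v, w} \<in> edges T \<Longrightarrow> v \<in> S i \<Longrightarrow> w \<notin> S i \<Longrightarrow> d w = y i"
      using D11 i by blast+
    have e: "e i \<in> verts T" "d (e i) = l i" "e 0 \<in> verts T" "d (e 0) = l 0" using D6 i N by blast+
    define F where "F v = (if v \<in> S i then 2 * y i - d v else d v)" for v
    have F: "\<bar>F u - F v\<bar> \<le> len T {u, v}" if uv: "{u, v} \<in> edges T" for u v
    proof -
      have "\<bar>d u - d v\<bar> = len T {u, v}" using d uv by (auto simp: depth_function_def)
      moreover have "u \<in> S i \<Longrightarrow> v \<notin> S i \<Longrightarrow> d v = y i" using Sb uv by blast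
      moreover have "v \<in> S i \<Longrightarrow> u \<notin> S i \<Longrightarrow> d u = y i" using Sb[of v u] uv by (simp add: insert_commute)
      ultimately show ?thesis by (auto simp: F_def)
    qed
    have val: "(\<Sum>v\<in>verts T. indicator {w} v * F v) = F w" if "w \<in> verts T" for w
      using sum_verts_eq_support[of "indicator {w}" "{w}" F] that by (simp add: support_indicator)
    have "F (e 0) - F (e i) \<le> path_dist T (indicator {e 0}) (indicator {e i})"
      using path_dist_ge_linear_extension[of F, OF F vertex_in_realization[OF e(3)] vertex_in_realization[OF e(1)]]
        val[OF e(1)] val[OF e(3)] by linarith
    also have "\<dots> \<le> l 0" using diam[OF e(3,1)] diam_le by linarith
    finally show ?thesis using S e by (simp add: F_def)
  qed
  have "long_path_decomposition T N y l par g"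
  proof
    show "0 < N" "y 0 = 0" "0 \<le> l 0" by fact+
    show "par i < i" "0 \<le> y i" "y i < l i" "l i \<le> l (par i)" if "0 < i" "i < N" for i
      using par[OF that] by auto
    show "l i \<le> 2 * y i" if "0 < i" "i < N" for i by (rule l2y[OF that])
    show "g i s = g (par i) s" if "0 < i" "i < N" "0 \<le> s" "s \<le> y i" for i s using D1 that by blast
    show "g i s \<in> realization T" if "i < N" "0 \<le> s" "s \<le> l i" for i s using D2 that by blast
    show "path_dist T (g i s) (g i t) \<le> \<bar>s - t\<bar>"
      if "i < N" "0 \<le> s" "s \<le> l i" "0 \<le> t" "t \<le> l i" for i s t using gd that by blast
    show "\<exists>i<N. \<exists>s. 0 \<le> s \<and> s \<le> l i \<and> z = g i s" if "z \<in> realization T" for z using D4 that by blast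
    show "total_length T = l 0 + (\<Sum>i\<in>{0<..<N}. l i - y i)" by (rule D5)
  qed
  then show ?thesis by blast
qed

section \<open>Covers along a walk\<close>

lemma partial_sums_cover:
  fixes f :: "nat \<Rightarrow> real"
  assumes "0 < n" "0 \<le> u" "u \<le> (\<Sum>j<n. f j)"
  shows "\<exists>k<n. (\<Sum>j<k. f j) \<le> u \<and> u \<le> (\<Sum>j<Suc k. f j)"
  using assms
proof (induction n)
  case (Suc n)
  show ?case
  proof (cases "0 < n \<and> u \<le> (\<Sum>j<n. f j)")
    case True
    then obtain k where "k < n" "(\<Sum>j<k. f j) \<le> u \<and> u \<le> (\<Sum>j<Suc k. f j)" using Suc by blast
    then show ?thesis by (intro exI[of _ k]) auto
  next
    case False
    then have "(\<Sum>j<n. f j) \<le> u" using Suc.prems by (cases "n = 0") auto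
    then show ?thesis using Suc.prems by (intro exI[of _ n]) auto
  qed
qed simp

context metric_tree
begin

lemma covers_mapI:
  assumes "J \<noteq> []" "\<And>j. j \<in> set J \<Longrightarrow> 0 \<le> f j" "\<And>j. j \<in> set J \<Longrightarrow> C j \<in> realization T"
    and "\<And>z. z \<in> realization T \<Longrightarrow> \<exists>j\<in>set J. path_dist T (C j) z \<le> f j"
  shows "map f J \<in> covers T"
proof -
  have "z \<in> (\<Union>i<length J. realization.mcball (C (J ! i)) (f (J ! i)))" if z: "z \<in> realization T" for z
  proof -
    obtain j where j: "j \<in> set J" "path_dist T (C j) z \<le> f j" using assms(4)[OF z] by blast
    then obtain i where "i < length J" "J ! i = j" by (auto simp: in_set_conv_nth)
    then show ?thesis using j z assms(3)[OF j(1)] by auto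
  qed
  then show ?thesis
    using assms(1-3) unfolding covers_def
    by (auto simp: Suc_le_eq intro!: exI[of _ "\<lambda>i. C (J ! i)"])
qed

definition walk :: "(real \<Rightarrow> 'v \<Rightarrow> real) \<Rightarrow> real \<Rightarrow> real \<Rightarrow> bool" where
  "walk f a b \<longleftrightarrow> (\<forall>s. a \<le> s \<and> s \<le> b \<longrightarrow> f s \<in> realization T) \<and>
     (\<forall>s t. a \<le> s \<and> s \<le> t \<and> t \<le> b \<longrightarrow> path_dist T (f s) (f t) \<le> t - s)"

lemma walk_dist:
  assumes "walk f a b" "a \<le> s" "s \<le> b" "a \<le> t" "t \<le> b"
  shows "path_dist T (f s) (f t) \<le> \<bar>s - t\<bar>"
proof (cases "s \<le> t")
  case True
  then show ?thesis using assms by (simp add: walk_def)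
next
  case False
  then have "path_dist T (f t) (f s) \<le> s - t" using assms by (simp add: walk_def)
  then show ?thesis using False realization.commute[of "f s" "f t"] by simp
qed

lemma walk_concat:
  assumes f: "walk f a b" "walk f b c" and ab: "a \<le> b" "b \<le> c"
  shows "walk f a c"
  unfolding walk_def
proof (intro conjI allI impI)
  show R: "f s \<in> realization T" if "a \<le> s \<and> s \<le> c" for s
    using that f by (cases "s \<le> b") (auto simp: walk_def)
  fix s t assume st: "a \<le> s \<and> s \<le> t \<and> t \<le> c"
  consider "t \<le> b" | "b \<le> s" | "s \<le> b" "b \<le> t" by linarith
  then show "path_dist T (f s) (f t) \<le> t - s"
  proof cases
    case 3
    have "path_dist T (f s) (f t) \<le> path_dist T (f s) (f b) + path_dist T (f b) (f t)"
      using st ab by (intro realization.triangle R) auto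
    moreover have "path_dist T (f s) (f b) \<le> b - s" "path_dist T (f b) (f t) \<le> t - b"
      using f st 3 by (auto simp: walk_def)
    ultimately show ?thesis by simp
  qed (use st f in \<open>auto simp: walk_def\<close>)
qed

lemma walk_cong:
  assumes "walk f a b" "\<And>s. a \<le> s \<Longrightarrow> s \<le> b \<Longrightarrow> h s = f s"
  shows "walk h a b"
  using assms by (auto simp: walk_def)

lemma walk_shift:
  assumes "walk f (a + c) (b + c)"
  shows "walk (\<lambda>s. f (s + c)) a b"
  unfolding walk_def
proof (intro conjI allI impI)
  show "f (s + c) \<in> realization T" if "a \<le> s \<and> s \<le> b" for s using assms that by (auto simp: walk_def)
  show "path_dist T (f (s + c)) (f (t + c)) \<le> t - s" if "a \<le> s \<and> s \<le> t \<and> t \<le> b" for s t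
    using walk_dist[OF assms, of "s + c" "t + c"] that by auto
qed

lemma walk_reverse:
  assumes "walk f (c - b) (c - a)"
  shows "walk (\<lambda>s. f (c - s)) a b"
  unfolding walk_def
proof (intro conjI allI impI)
  show "f (c - s) \<in> realization T" if "a \<le> s \<and> s \<le> b" for s using assms that by (auto simp: walk_def)
  show "path_dist T (f (c - s)) (f (c - t)) \<le> t - s" if "a \<le> s \<and> s \<le> t \<and> t \<le> b" for s t
    using walk_dist[OF assms, of "c - s" "c - t"] that by auto
qed

text \<open>
  Consecutive intervals of lengths twice the radii cover \<open>[0, M]\<close>; the centers are their midpoints,
  moved back to \<open>M\<close> if they lie beyond.
\<close>
lemma walk_covers:
  assumes w: "walk f 0 M" and M: "0 \<le> M" and onto: "\<And>z. z \<in> realization T \<Longrightarrow> \<exists>s. 0 \<le> s \<and> s \<le> M \<and> z = f s"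
    and rs: "rs \<noteq> []" "\<And>r. r \<in> set rs \<Longrightarrow> 0 \<le> r" and sum: "M \<le> 2 * sum_list rs"
  shows "rs \<in> covers T"
proof -
  define P where "P k = (\<Sum>j<k. 2 * rs ! j)" for k
  define C where "C k = f (min M (P k + rs ! k))" for k
  have nn: "0 \<le> rs ! k" if "k < length rs" for k using rs(2) that by simp
  have P0: "0 \<le> P k" if "k \<le> length rs" for k
    unfolding P_def using that by (intro sum_nonneg) (auto intro!: nn)
  have "map ((!) rs) [0..<length rs] \<in> covers T"
  proof (rule covers_mapI[where C = C])
    show "[0..<length rs] \<noteq> []" using rs by simp
    show "0 \<le> rs ! j" if "j \<in> set [0..<length rs]" for j using nn that by simp
    show "C j \<in> realization T" if "j \<in> set [0..<length rs]" for j
      using w M nn[of j] P0[of j] that by (auto simp: C_def walk_def)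
    fix z assume "z \<in> realization T"
    then obtain u where u: "0 \<le> u" "u \<le> M" "z = f u" using onto by blast
    have "u \<le> (\<Sum>j<length rs. 2 * rs ! j)"
      using u sum by (simp add: sum_list_sum_nth sum_distrib_left atLeast0LessThan)
    then obtain k where k: "k < length rs" "P k \<le> u" "u \<le> P (Suc k)"
      using partial_sums_cover[of "length rs" u "\<lambda>j. 2 * rs ! j"] rs u by (auto simp: P_def)
    have "path_dist T (C k) z \<le> \<bar>min M (P k + rs ! k) - u\<bar>"
      unfolding C_def u(3) using u M nn[OF k(1)] P0[of k] k by (intro walk_dist[OF w]) auto
    also have "\<dots> \<le> rs ! k" using k u by (auto simp: P_def)
    finally show "\<exists>j\<in>set [0..<length rs]. path_dist T (C j) z \<le> rs ! j" using k(1) by auto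
  qed
  then show ?thesis by (simp add: map_nth)
qed

end

context long_path_decomposition
begin

lemma l_le_0: "i < N \<Longrightarrow> l i \<le> l 0"
proof (induction i rule: less_induct)
  case (less i)
  show ?case
  proof (cases "i = 0")
    case False
    then show ?thesis using less.IH[of "par i"] par_less[of i] l_le_par[of i] less.prems by simp
  qed simp
qed

lemma g_walk:
  assumes "i < N" "0 \<le> a" "b \<le> l i"
  shows "walk (g i) a b"
  unfolding walk_def
proof (intro conjI allI impI)
  show "g i s \<in> realization T" if "a \<le> s \<and> s \<le> b" for s
    by (rule g_in) (use assms that in auto)
  show "path_dist T (g i s) (g i t) \<le> t - s" if "a \<le> s \<and> s \<le> t \<and> t \<le> b" for s t
    using g_dist[of i s t] assms that by simp
qed

text \<open>
  Paths are visited one at a time: when the walk passes the start of the next path, it runs to the end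
  of that path and back, which costs twice its length.
\<close>
lemma walk_exists_upto:
  assumes "n < N"
  shows "\<exists>f. walk f 0 (l 0 + 2 * (\<Sum>i\<in>{0<..n}. l i - y i)) \<and>
    (\<forall>i\<le>n. \<forall>s. 0 \<le> s \<and> s \<le> l i \<longrightarrow>
       (\<exists>u. 0 \<le> u \<and> u \<le> l 0 + 2 * (\<Sum>i\<in>{0<..n}. l i - y i) \<and> f u = g i s))"
  using assms
proof (induction n)
  case 0
  then show ?case using g_walk[of 0 0 "l 0"] by (intro exI[of _ "g 0"]) auto
next
  case (Suc n)
  define M where "M = l 0 + 2 * (\<Sum>i\<in>{0<..n}. l i - y i)"
  obtain f where f: "walk f 0 M" and on: "\<And>i s. i \<le> n \<Longrightarrow> 0 \<le> s \<Longrightarrow> s \<le> l i \<Longrightarrow> \<exists>u. 0 \<le> u \<and> u \<le> M \<and> f u = g i s"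
    using Suc unfolding M_def by fastforce
  let ?n = "Suc n"
  define h where "h = l ?n - y ?n"
  have ny: "0 \<le> y ?n" "y ?n < l ?n" "par ?n < ?n" "l ?n \<le> l (par ?n)"
    using y_nonneg y_less par_less l_le_par Suc.prems by auto
  have h: "0 < h" using ny by (simp add: h_def)
  have M': "l 0 + 2 * (\<Sum>i\<in>{0<..?n}. l i - y i) = M + 2 * h"
  proof -
    have "{0<..?n} = insert ?n {0<..n}" by auto
    then show ?thesis by (simp add: M_def h_def)
  qed
  obtain m where m: "0 \<le> m" "m \<le> M" "f m = g (par ?n) (y ?n)"
    using on[of "par ?n" "y ?n"] ny by auto
  have fm: "f m = g ?n (y ?n)" using m g_par[of ?n "y ?n"] ny Suc.prems by simp
  \<comment> \<open>at time \<open>m\<close> the walk makes an excursion along the new path and back\<close>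
  define f' where "f' s = (if s \<le> m then f s else if s \<le> m + h then g ?n (s + (y ?n - m))
      else if s \<le> m + 2 * h then g ?n (l ?n + h + m - s) else f (s + - 2 * h))" for s
  have w1: "walk f' 0 m"
    by (rule walk_cong[of f]) (use f m in \<open>auto simp: walk_def f'_def\<close>)
  have w2: "walk f' m (m + h)"
  proof (rule walk_cong)
    show "walk (\<lambda>s. g ?n (s + (y ?n - m))) m (m + h)"
      using ny Suc.prems by (intro walk_shift g_walk) (auto simp: h_def)
    show "f' s = g ?n (s + (y ?n - m))" if "m \<le> s" "s \<le> m + h" for s
      using that fm by (cases "s = m") (auto simp: f'_def)
  qed
  have w3: "walk f' (m + h) (m + 2 * h)"
  proof (rule walk_cong)
    show "walk (\<lambda>s. g ?n (l ?n + h + m - s)) (m + h) (m + 2 * h)"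
      using ny Suc.prems h by (intro walk_reverse g_walk) (auto simp: h_def)
    show "f' s = g ?n (l ?n + h + m - s)" if "m + h \<le> s" "s \<le> m + 2 * h" for s
    proof (cases "s = m + h")
      case True
      then show ?thesis using h by (simp add: f'_def) (simp add: h_def)
    qed (use that h in \<open>auto simp: f'_def\<close>)
  qed
  have w4: "walk f' (m + 2 * h) (M + 2 * h)"
  proof (rule walk_cong)
    show "walk (\<lambda>s. f (s + - 2 * h)) (m + 2 * h) (M + 2 * h)"
      by (rule walk_shift) (use f m in \<open>auto simp: walk_def\<close>)
    show "f' s = f (s + - 2 * h)" if "m + 2 * h \<le> s" "s \<le> M + 2 * h" for s
    proof (cases "s = m + 2 * h")
      case True
      then show ?thesis using h fm by (simp add: f'_def) (simp add: h_def)
    qed (use that h in \<open>auto simp: f'_def\<close>)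
  qed
  have "walk f' 0 (m + h)" by (rule walk_concat[OF w1 w2]) (use h m in auto)
  then have "walk f' 0 (m + 2 * h)" by (rule walk_concat[OF _ w3]) (use h m in auto)
  then have w: "walk f' 0 (M + 2 * h)" by (rule walk_concat[OF _ w4]) (use h m in auto)
  have on': "\<exists>u. 0 \<le> u \<and> u \<le> M + 2 * h \<and> f' u = g i s" if i: "i \<le> ?n" "0 \<le> s" "s \<le> l i" for i s
  proof -
    have old: "\<exists>u. 0 \<le> u \<and> u \<le> M + 2 * h \<and> f' u = g i s" if i: "i \<le> n" "0 \<le> s" "s \<le> l i" for i s
    proof -
      obtain u where u: "0 \<le> u" "u \<le> M" "f u = g i s" using on[OF i] by blast
      show ?thesis
      proof (cases "u \<le> m")
        case True
        then show ?thesis using u h by (intro exI[of _ u]) (auto simp: f'_def)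
      next
        case False
        then show ?thesis using u h m by (intro exI[of _ "u + 2 * h"]) (auto simp: f'_def)
      qed
    qed
    show ?thesis
    proof (cases "i = ?n")
      case False
      then show ?thesis using old i by simp
    next
      case True
      show ?thesis
      proof (cases "s \<le> y ?n")
        case True
        then have "g i s = g (par ?n) s" using g_par[of ?n s] \<open>i = ?n\<close> i Suc.prems by simp
        then show ?thesis using old[of "par ?n" s] ny i True by auto
      next
        case False
        then show ?thesis using \<open>i = ?n\<close> i m h
          by (intro exI[of _ "s - y ?n + m"]) (auto simp: f'_def h_def)
      qed
    qed
  qed
  show ?case unfolding M' using w on' by blast
qed

lemma covers_if_sum_large:
  assumes "rs \<noteq> []" "\<And>r. r \<in> set rs \<Longrightarrow> 0 \<le> r" "total_length T - l 0 / 2 \<le> sum_list rs"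
  shows "rs \<in> covers T"
proof -
  define M where "M = l 0 + 2 * (\<Sum>i\<in>{0<..N - 1}. l i - y i)"
  have "{0<..N - 1} = {0<..<N}" 
  proof (rule set_eqI)
    show "i \<in> {0<..N - 1} \<longleftrightarrow> i \<in> {0<..<N}" for i
      unfolding greaterThanAtMost_iff greaterThanLessThan_iff by linarith
  qed
  then have M: "M = 2 * total_length T - l 0" by (simp add: M_def total_length_eq)
  have "N - 1 < N" using N_pos by simp
  from walk_exists_upto[OF this, folded M_def]
  obtain f where f: "walk f 0 M" and on: "\<And>i s. i \<le> N - 1 \<Longrightarrow> 0 \<le> s \<Longrightarrow> s \<le> l i \<Longrightarrow> \<exists>u. 0 \<le> u \<and> u \<le> M \<and> f u = g i s"
    by blast
  show ?thesis
  proof (rule walk_covers[OF f])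
    show "0 \<le> M"
      unfolding M_def using l_0 y_less by (intro add_nonneg_nonneg mult_nonneg_nonneg sum_nonneg) (auto simp: less_imp_le)
    show "\<exists>s. 0 \<le> s \<and> s \<le> M \<and> z = f s" if z: "z \<in> realization T" for z
    proof -
      obtain i s where is0: "i < N" "0 \<le> s" "s \<le> l i" "z = g i s" using g_onto[OF z] by blast
      have "i \<le> N - 1" using is0(1) by linarith
      from on[OF this is0(2,3)] obtain u where u: "0 \<le> u" "u \<le> M" "f u = g i s" by blast
      then have "z = f u" by (simp only: is0(4))
      with u show ?thesis by blast
    qed
    show "M \<le> 2 * sum_list rs" using assms(3) M by simp
  qed (use assms in auto)
qed

definition trim :: "('i \<Rightarrow> real) \<Rightarrow> 'i list \<Rightarrow> 'i list" where
  "trim f J = drop (LEAST d. sum_list (map f (drop d J)) \<le> total_length T) J"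

text \<open>
  No radius exceeds \<open>l 0 / 2\<close>, so the step that brings the sum below the total length leaves it
  large enough for \<open>covers_if_sum_large\<close>.
\<close>
lemma trim_zero_good:
  assumes J: "map f J \<in> covers T" and f: "\<And>j. j \<in> set J \<Longrightarrow> 0 \<le> f j \<and> f j \<le> l 0 / 2" and l0: "0 < l 0"
  shows "map f (trim f J) \<in> zero_good_covers T"
proof -
  let ?L = "total_length T"
  define s where "s d = sum_list (map f (drop d J))" for d
  define d where "d = (LEAST d. s d \<le> ?L)"
  have Lpos: "l 0 \<le> ?L"
    unfolding total_length_eq using y_less by (auto intro!: sum_nonneg simp: less_imp_le)
  have "s (length J) \<le> ?L" using Lpos l0 by (simp add: s_def)
  then have d: "s d \<le> ?L" unfolding d_def by (rule LeastI)
  have tr: "trim f J = drop d J" by (simp add: trim_def d_def s_def)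
  have "map f (drop d J) \<in> covers T"
  proof (cases d)
    case 0
    then show ?thesis using J by simp
  next
    case (Suc c)
    have c: "?L < s c" using not_less_Least[of c "\<lambda>d. s d \<le> ?L"] Suc by (simp add: d_def)
    have cl: "c < length J"
    proof (rule ccontr)
      assume "\<not> c < length J"
      then show False using c Lpos l0 by (simp add: s_def)
    qed
    then have "drop c J = J ! c # drop d J" using Suc by (simp add: Cons_nth_drop_Suc)
    then have "s c = f (J ! c) + s d" by (simp add: s_def)
    moreover have "f (J ! c) \<le> l 0 / 2" using f cl by simp
    ultimately have big: "?L - l 0 / 2 \<le> s d" using c by simp
    then have "0 < s d" using Lpos l0 by simp
    then have ne: "drop d J \<noteq> []" by (auto simp: s_def)
    show ?thesis
      using ne big f by (intro covers_if_sum_large) (auto simp: s_def dest: in_set_dropD)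
  qed
  then show ?thesis
    using d unfolding tr zero_good_covers_def s_def
    by (simp add: sum_list_sum_nth atLeast0LessThan)
qed

section \<open>Covers of a band of depths\<close>

lemma band_midpoint:
  fixes W t a :: real
  assumes "0 < W" "t < a"
  shows "t < t + min W (a - t) / 2" "t + min W (a - t) / 2 \<le> a"
  using assms by (auto simp: min_def field_simps)

text \<open>
  Going from path \<open>i\<close> to its parent, then to the parent of that, and so on, one meets a path \<open>k\<close> that
  receives a ball in the band with top \<open>t\<close> and height \<open>W\<close>. Every path passed before starts below the
  middle of its part of the band, hence below the middle of the shorter part of path \<open>i\<close>; so \<open>k\<close> and
  \<open>i\<close> agree down to some depth \<open>m\<close> beyond this middle.
\<close>
lemma band_anchor:
  assumes W: "0 < W" and i: "i < N" "t < l i" and t: "0 \<le> t"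
  shows "\<exists>k m. k < N \<and> t < l k \<and> y k - t < min W (l k - t) / 2 \<and> l i \<le> l k \<and>
    t + min W (l i - t) / 2 \<le> m \<and> m \<le> l i \<and> m \<le> l k \<and> (\<forall>s. 0 \<le> s \<and> s \<le> m \<longrightarrow> g i s = g k s)"
  using i
proof (induction i rule: less_induct)
  case (less i)
  show ?case
  proof (cases "y i - t < min W (l i - t) / 2")
    case True
    then show ?thesis using less.prems band_midpoint[OF W less.prems(2)]
      by (intro exI[of _ i] exI[of _ "l i"]) auto
  next
    case False
    have i0: "0 < i"
    proof (rule ccontr)
      assume "\<not> 0 < i"
      then show False using False y_0 W t less.prems by auto
    qed
    have P: "par i < i" "par i < N" "l i \<le> l (par i)" "y i < l i"
      using par_less[of i] l_le_par[of i] y_less[of i] i0 less.prems by auto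
    then obtain k m where k: "k < N" "t < l k" "y k - t < min W (l k - t) / 2" "l (par i) \<le> l k"
        "t + min W (l (par i) - t) / 2 \<le> m" "m \<le> l (par i)" "m \<le> l k"
        "\<forall>s. 0 \<le> s \<and> s \<le> m \<longrightarrow> g (par i) s = g k s"
      using less.IH[of "par i"] less.prems by fastforce
    have "min W (l i - t) \<le> min W (l (par i) - t)" using P(3) by (intro min.mono) auto
    then have "t + min W (l i - t) / 2 \<le> m" using k(5) by argo
    moreover have "t + min W (l i - t) / 2 \<le> y i" using False by argo
    ultimately have m: "t + min W (l i - t) / 2 \<le> min m (y i)" by (rule min.boundedI)
    show ?thesis
    proof (intro exI conjI allI impI)
      show "k < N" "t < l k" "y k - t < min W (l k - t) / 2" by fact+
      show "l i \<le> l k" using P k by linarith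
      show "t + min W (l i - t) / 2 \<le> min m (y i)" by (rule m)
      show "min m (y i) \<le> l i" "min m (y i) \<le> l k" using P k by auto
      show "g i s = g k s" if "0 \<le> s \<and> s \<le> min m (y i)" for s
        using g_par[OF i0 less.prems(1), of s] k(8) that by auto
    qed
  qed
qed

text \<open>
  The ball of the path \<open>k\<close> of \<open>band_anchor\<close> works. If \<open>z\<close> and the center lie on different branches
  beyond depth \<open>m\<close>, the way through the branching point has length at most \<open>(t + h - m) + (z - m)\<close>,
  and \<open>z - m \<le> m - t\<close>.
\<close>
lemma band_cover:
  assumes W: "0 < W" and i: "i < N" "t < l i" and t: "0 \<le> t" and z: "t \<le> z" "z \<le> t + W" "z \<le> l i"
  shows "\<exists>k<N. t < l k \<and> y k - t < min W (l k - t) / 2 \<and>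
    path_dist T (g k (t + min W (l k - t) / 2)) (g i z) \<le> min W (l k - t) / 2"
proof -
  obtain k m where k: "k < N" "t < l k" "y k - t < min W (l k - t) / 2" "l i \<le> l k"
      "t + min W (l i - t) / 2 \<le> m" "m \<le> l i" "m \<le> l k"
      and eq: "\<And>s. 0 \<le> s \<Longrightarrow> s \<le> m \<Longrightarrow> g i s = g k s"
    using band_anchor[OF W i t] by blast
  define h where "h = min W (l k - t) / 2"
  have h: "0 < h" "t + 2 * h \<le> l k" using W k by (auto simp: h_def)
  have zh: "z \<le> t + 2 * h" using z k by (auto simp: h_def)
  have m0: "0 \<le> m" using k(5) t band_midpoint(1)[OF W i(2)] by linarith
  have "path_dist T (g k (t + h)) (g i z) \<le> h"
  proof (cases "z \<le> m")
    case True
    then have "g i z = g k z" using eq z t by auto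
    moreover have "path_dist T (g k (t + h)) (g k z) \<le> \<bar>t + h - z\<bar>"
      using h t z zh k by (intro g_dist) auto
    ultimately show ?thesis using z zh by auto
  next
    case zm: False
    show ?thesis
    proof (cases "t + h \<le> m")
      case True
      then have "g k (t + h) = g i (t + h)" using eq h t by auto
      moreover have "path_dist T (g i (t + h)) (g i z) \<le> \<bar>t + h - z\<bar>"
        using h t z zh k i True by (intro g_dist) auto
      ultimately show ?thesis using z zh by auto
    next
      case False
      have "path_dist T (g k (t + h)) (g i z) \<le> path_dist T (g k (t + h)) (g k m) + path_dist T (g k m) (g i z)"
        using h t z zh k i False m0 by (intro realization.triangle g_in) auto
      also have "path_dist T (g k (t + h)) (g k m) \<le> \<bar>t + h - m\<bar>"
        using h t k m0 by (intro g_dist) auto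
      also have "g k m = g i m" using eq m0 by auto
      also have "path_dist T (g i m) (g i z) \<le> \<bar>m - z\<bar>"
        using h t z k m0 i by (intro g_dist) auto
      finally have "path_dist T (g k (t + h)) (g i z) \<le> t + h - m + (z - m)" using False zm by simp
      also have "\<dots> \<le> h"
      proof -
        have "z \<le> t + min W (l i - t)" using z by auto
        then show ?thesis using k(5) by argo
      qed
      finally show ?thesis .
    qed
  qed
  then show ?thesis using k(1-3) unfolding h_def by blast
qed

text \<open>
  In the band that starts at the root, only path \<open>0\<close> receives a ball, since \<open>l i \<le> 2 * y i\<close>.
\<close>
lemma top_band_cover:
  assumes W: "0 < W" "W \<le> l 0" and z: "0 \<le> z" "z \<le> W" "z \<le> l i" and i: "i < N"
  shows "path_dist T (g 0 (W / 2)) (g i z) \<le> W / 2"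
proof (cases "0 < l i")
  case True
  obtain k where k: "k < N" "0 < l k" "y k < min W (l k) / 2"
      "path_dist T (g k (min W (l k) / 2)) (g i z) \<le> min W (l k) / 2"
    using band_cover[OF W(1) i True order_refl] z by auto
  have "k = 0"
  proof (rule ccontr)
    assume "k \<noteq> 0"
    then show False using l_le_2y[of k] k by auto
  qed
  then show ?thesis using k W by auto
next
  case False
  then have "i = 0" using y_less[of i] y_nonneg[of i] i by (cases "i = 0") auto
  then show ?thesis using False W by auto
qed

lemma single_ball_cover:
  assumes "0 < l 0" "l 0 \<le> 2 * w"
  shows "[w] \<in> covers T"
proof -
  have "map (\<lambda>_. w) [()] \<in> covers T"
  proof (rule covers_mapI[where C = "\<lambda>_. g 0 (l 0 / 2)"])
    fix z assume "z \<in> realization T"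
    then obtain i s where is0: "i < N" "0 \<le> s" "s \<le> l i" "z = g i s" using g_onto by blast
    have "path_dist T (g 0 (l 0 / 2)) z \<le> l 0 / 2"
      unfolding is0(4) using is0 assms l_le_0[OF is0(1)] by (intro top_band_cover) auto
    then show "\<exists>j\<in>set [()]. path_dist T (g 0 (l 0 / 2)) z \<le> w" using assms by auto
  qed (use assms N_pos in \<open>auto intro: g_in\<close>)
  then show ?thesis by simp
qed

definition eta :: "nat \<Rightarrow> real" where "eta i = l i - y i"

lemma eta_pos: "0 < l 0 \<Longrightarrow> i < N \<Longrightarrow> 0 < eta i"
  using y_less[of i] y_0 by (cases "i = 0") (auto simp: eta_def)

text \<open>
  For width \<open>w\<close> and offset \<open>b\<close>, the first band is \<open>[0, b]\<close>, and \<open>(i, k)\<close> stands for path \<open>i\<close> in the band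
  of height \<open>2 * w\<close> with top \<open>b + 2 * w * k\<close>.
\<close>
definition selected :: "real \<Rightarrow> real \<Rightarrow> nat \<times> nat \<Rightarrow> bool" where
  "selected w b = (\<lambda>(i, k). b + 2 * w * real k < l i \<and>
     y i - (b + 2 * w * real k) < min (2 * w) (l i - (b + 2 * w * real k)) / 2)"

text \<open>
  The index \<open>N\<close> stands for the ball of the first band. The factor \<open>max w (eta i) / eta i\<close> is \<open>1\<close> for
  paths of length at least \<open>w\<close>; for shorter ones it stretches radii that are uniform on \<open>[0, eta i]\<close> to
  radii uniform on \<open>[0, w]\<close>.
\<close>
definition band_radius :: "real \<Rightarrow> real \<Rightarrow> nat \<times> nat \<Rightarrow> real" where
  "band_radius w b = (\<lambda>(i, k). if i = N then b / 2
     else min w ((l i - (b + 2 * w * real k)) / 2 * (max w (eta i) / eta i)))"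

definition band_index :: "real \<Rightarrow> real \<Rightarrow> (nat \<times> nat) list" where
  "band_index w b = (N, 0) # filter (selected w b) (List.product [0..<N] [0..<nat \<lceil>l 0 / (2 * w)\<rceil>])"

lemma band_radius_bounds:
  assumes w: "0 < w" and b: "0 < b" "b \<le> 2 * w" and l0: "0 < l 0" and j: "j \<in> set (band_index w b)"
  shows "0 \<le> band_radius w b j" "band_radius w b j \<le> w"
proof -
  consider "j = (N, 0)" | i k where "j = (i, k)" "i < N" "selected w b (i, k)"
    using j by (auto simp: band_index_def)
  then have "0 \<le> band_radius w b j \<and> band_radius w b j \<le> w"
  proof cases
    case 1
    then show ?thesis using b by (simp add: band_radius_def)
  next
    case 2
    have "0 \<le> (l i - (b + 2 * w * real k)) / 2 * (max w (eta i) / eta i)"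
      using 2 eta_pos[OF l0 2(2)] w by (intro mult_nonneg_nonneg) (auto simp: selected_def)
    then show ?thesis using 2 w by (auto simp: band_radius_def)
  qed
  then show "0 \<le> band_radius w b j" "band_radius w b j \<le> w" by auto
qed

lemma band_covers:
  assumes w: "0 < w" "2 * w \<le> l 0" and b: "0 < b" "b \<le> 2 * w"
  shows "map (band_radius w b) (band_index w b) \<in> covers T"
proof (rule covers_mapI)
  have l0: "0 < l 0" using w by simp
  define top where "top k = b + 2 * w * real k" for k :: nat
  define C where "C = (\<lambda>(i, k). if i = N then g 0 (b / 2) else g i (top k + min (2 * w) (l i - top k) / 2))"
  show "band_index w b \<noteq> []" by (simp add: band_index_def)
  show "0 \<le> band_radius w b j" if "j \<in> set (band_index w b)" for j
    using band_radius_bounds[OF w(1) b l0 that] by simp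
  have top0: "0 \<le> top k" for k using w b by (simp add: top_def)
  show "C j \<in> realization T" if j: "j \<in> set (band_index w b)" for j
  proof -
    consider "j = (N, 0)" | i k where "j = (i, k)" "i < N" "selected w b (i, k)"
      using j by (auto simp: band_index_def)
    then show ?thesis
    proof cases
      case 1
      then show ?thesis using N_pos b w by (auto simp: C_def intro!: g_in)
    next
      case 2
      then have "top k < l i" by (simp add: selected_def top_def)
      then have "top k < top k + min (2 * w) (l i - top k) / 2" "top k + min (2 * w) (l i - top k) / 2 \<le> l i"
        using band_midpoint[of "2 * w" "top k" "l i"] w by simp_all
      then show ?thesis using 2 top0[of k] by (auto simp: C_def intro!: g_in)
    qed
  qed
  fix z assume "z \<in> realization T"
  then obtain i s where is0: "i < N" "0 \<le> s" "s \<le> l i" "z = g i s" using g_onto by blast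
  show "\<exists>j\<in>set (band_index w b). path_dist T (C j) z \<le> band_radius w b j"
  proof (cases "s \<le> b")
    case True
    have "path_dist T (g 0 (b / 2)) z \<le> b / 2"
      unfolding is0(4) using is0 True b w by (intro top_band_cover) auto
    then show ?thesis by (intro bexI[of _ "(N, 0)"]) (auto simp: C_def band_radius_def band_index_def)
  next
    case False
    define k where "k = nat (\<lceil>(s - b) / (2 * w)\<rceil> - 1)"
    have pos: "0 < (s - b) / (2 * w)" using False w by simp
    then have "1 \<le> \<lceil>(s - b) / (2 * w)\<rceil>" by linarith
    then have rk: "real k = of_int \<lceil>(s - b) / (2 * w)\<rceil> - 1" by (simp add: k_def)
    have "real k < (s - b) / (2 * w)" "(s - b) / (2 * w) \<le> real k + 1"
      unfolding rk by linarith+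
    then have tk: "top k < s" "s \<le> top k + 2 * w"
      using w by (auto simp: top_def field_simps)
    obtain n where n: "n < N" "top k < l n" "y n - top k < min (2 * w) (l n - top k) / 2"
        "path_dist T (g n (top k + min (2 * w) (l n - top k) / 2)) (g i s) \<le> min (2 * w) (l n - top k) / 2"
      using band_cover[of "2 * w" i "top k" s] w is0 tk top0[of k] by auto
    have sel: "selected w b (n, k)" using n by (auto simp: selected_def top_def)
    have "2 * w * real k < l 0" using n(2) l_le_0[OF n(1)] b by (simp add: top_def)
    then have "real k < l 0 / (2 * w)" using w by (simp add: field_simps)
    then have "k < nat \<lceil>l 0 / (2 * w)\<rceil>" by linarith
    then have mem: "(n, k) \<in> set (band_index w b)" using sel n by (simp add: band_index_def)
    have e: "0 < eta n" by (rule eta_pos[OF l0 n(1)])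
    have "1 \<le> max w (eta n) / eta n" using e by (simp add: field_simps)
    then have "(l n - top k) / 2 * 1 \<le> (l n - top k) / 2 * (max w (eta n) / eta n)"
      using n by (intro mult_left_mono) auto
    then have "min (2 * w) (l n - top k) / 2 \<le> band_radius w b (n, k)"
      using n by (auto simp: band_radius_def top_def)
    then show ?thesis using n mem is0 by (intro bexI[OF _ mem]) (auto simp: C_def)
  qed
qed

end

section \<open>Integration over the offset\<close>

lemma measurable_map_tuple_fixed:
  assumes [measurable]: "\<And>j. f j \<in> borel_measurable M"
  shows "(\<lambda>x. map (\<lambda>j. f j x) J) \<in> measurable M tuple_borel"
proof (rule measurableI)
  fix A :: "real list set" assume A: "A \<in> sets tuple_borel"
  let ?m = "length J" and ?h = "\<lambda>x. \<lambda>j\<in>{..<length J}. f (J ! j) x"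
  let ?P = "Pi\<^sub>M {..<?m} (\<lambda>_. borel :: real measure)"
  let ?B = "{z \<in> space ?P. map z [0..<?m] \<in> A}"
  have B: "?B \<in> sets ?P" using A unfolding sets_tuple_borel by blast
  have h: "?h \<in> measurable M ?P" by (rule measurable_restrict) measurable
  have "map (?h x) [0..<?m] = map (\<lambda>j. f j x) J" for x
    by (rule nth_equalityI) auto
  then have "(\<lambda>x. map (\<lambda>j. f j x) J) -` A \<inter> space M = ?h -` ?B \<inter> space M"
    using measurable_space[OF h] by auto
  also have "\<dots> \<in> sets M" by (rule measurable_sets[OF h B])
  finally show "(\<lambda>x. map (\<lambda>j. f j x) J) -` A \<inter> space M \<in> sets M" .
qed simp

lemma measurable_map_tuple:
  fixes J :: "'a \<Rightarrow> 'i::countable list"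
  assumes J: "J \<in> measurable M (count_space UNIV)" and f: "\<And>j. f j \<in> borel_measurable M"
  shows "(\<lambda>x. map (\<lambda>j. f j x) (J x)) \<in> measurable M tuple_borel"
  by (rule measurable_compose_countable[OF measurable_map_tuple_fixed[OF f] J])

lemma radius_count_map: "radius_count A (map f J) = length (filter (\<lambda>j. f j \<in> A) J)"
  unfolding radius_count_def length_filter_conv_card
  by (rule arg_cong[of _ _ card]) auto

lemma nn_integral_shifts_le:
  fixes G :: "real \<Rightarrow> ennreal"
  assumes [measurable]: "G \<in> borel_measurable borel"
  shows "(\<integral>\<^sup>+x. (\<Sum>k. G (x + real k)) * indicator {0<..<1} x \<partial>lborel) \<le> (\<integral>\<^sup>+v. G v * indicator {0<..} v \<partial>lborel)"
proof -
  have "(\<integral>\<^sup>+x. (\<Sum>k. G (x + real k)) * indicator {0<..<1} x \<partial>lborel)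
      = (\<integral>\<^sup>+x. (\<Sum>k. G (x + real k) * indicator {0<..<1} x) \<partial>lborel)"
    by (simp add: ennreal_suminf_multc)
  also have "\<dots> = (\<Sum>k. \<integral>\<^sup>+x. G (x + real k) * indicator {0<..<1} x \<partial>lborel)"
    by (rule nn_integral_suminf) measurable
  also have "\<dots> = (\<Sum>k. \<integral>\<^sup>+v. G v * indicator {real k<..<real k + 1} v \<partial>lborel)"
  proof (rule suminf_cong)
    fix k :: nat
    have "(\<integral>\<^sup>+v. G v * indicator {real k<..<real k + 1} v \<partial>lborel)
        = (\<integral>\<^sup>+x. G (real k + 1 * x) * indicator {real k<..<real k + 1} (real k + 1 * x) \<partial>lborel)"
      by (subst nn_integral_real_affine[where c = 1 and t = "real k"]) auto
    also have "\<dots> = (\<integral>\<^sup>+x. G (x + real k) * indicator {0<..<1} x \<partial>lborel)"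
      by (intro nn_integral_cong) (auto simp: indicator_def add.commute)
    finally show "(\<integral>\<^sup>+x. G (x + real k) * indicator {0<..<1} x \<partial>lborel)
        = (\<integral>\<^sup>+v. G v * indicator {real k<..<real k + 1} v \<partial>lborel)" by simp
  qed
  also have "\<dots> = (\<integral>\<^sup>+v. (\<Sum>k. G v * indicator {real k<..<real k + 1} v) \<partial>lborel)"
    by (rule nn_integral_suminf[symmetric]) measurable
  also have "\<dots> \<le> (\<integral>\<^sup>+v. G v * indicator {0<..} v \<partial>lborel)"
  proof (rule nn_integral_mono)
    fix v :: real
    have disj: "disjoint_family (\<lambda>k. {real k<..<real k + 1})"
      unfolding disjoint_family_on_def
    proof (intro ballI impI)
      fix m n :: nat assume "m \<noteq> n"
      then have "real m + 1 \<le> real n \<or> real n + 1 \<le> real m" by linarith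
      then show "{real m<..<real m + 1} \<inter> {real n<..<real n + 1} = {}" by auto
    qed
    have "(\<Sum>k. G v * indicator {real k<..<real k + 1} v) = G v * indicator (\<Union>k. {real k<..<real k + 1}) v"
      by (simp add: ennreal_suminf_cmult suminf_indicator[OF disj])
    also have "\<dots> \<le> G v * indicator {0<..} v"
      by (intro mult_left_mono) (auto simp: indicator_def)
    finally show "(\<Sum>k. G v * indicator {real k<..<real k + 1} v) \<le> G v * indicator {0<..} v" .
  qed
  finally show ?thesis .
qed

text \<open>
  Averaging over the offset and summing over the bands amounts to one integral over all band tops.
\<close>
lemma nn_integral_periodic_le:
  fixes G :: "real \<Rightarrow> ennreal"
  assumes [measurable]: "G \<in> borel_measurable borel" and p: "0 < p"
  shows "ennreal p * (\<integral>\<^sup>+x. (\<Sum>k. G (p * (x + real k))) * indicator {0<..<1} x \<partial>lborel)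
    \<le> (\<integral>\<^sup>+t. G t * indicator {0<..} t \<partial>lborel)"
proof -
  have "(\<integral>\<^sup>+t. G t * indicator {0<..} t \<partial>lborel) = ennreal p * (\<integral>\<^sup>+v. G (p * v) * indicator {0<..} v \<partial>lborel)"
    using p by (subst nn_integral_real_affine[where c = p and t = 0])
      (auto intro!: arg_cong2[where f = "(*)"] nn_integral_cong simp: indicator_def zero_less_mult_iff)
  moreover have "(\<integral>\<^sup>+x. (\<Sum>k. G (p * (x + real k))) * indicator {0<..<1} x \<partial>lborel)
      \<le> (\<integral>\<^sup>+v. G (p * v) * indicator {0<..} v \<partial>lborel)"
    by (rule nn_integral_shifts_le[of "\<lambda>v. G (p * v)"]) measurable
  ultimately show ?thesis by (simp add: mult_left_mono)
qed

lemma nn_integral_scaled_indicator: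
  assumes [measurable]: "A \<in> sets borel" and c: "0 < c" and w: "0 \<le> w"
  shows "(\<integral>\<^sup>+s. indicator A (s / c) * indicator {0..c * w} s \<partial>lborel) = ennreal c * emeasure lborel (A \<inter> {0..w})"
proof -
  have "(\<integral>\<^sup>+s. indicator A (s / c) * indicator {0..c * w} s \<partial>lborel)
      = ennreal c * (\<integral>\<^sup>+u. indicator A ((0 + c * u) / c) * indicator {0..c * w} (0 + c * u) \<partial>lborel)"
    using c by (subst nn_integral_real_affine[where c = c and t = 0]) auto
  also have "(\<integral>\<^sup>+u. indicator A ((0 + c * u) / c) * indicator {0..c * w} (0 + c * u) \<partial>lborel)
      = (\<integral>\<^sup>+u. indicator (A \<inter> {0..w}) u \<partial>lborel)"
    using c w by (intro nn_integral_cong) (auto simp: indicator_def zero_le_mult_iff)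
  finally show ?thesis by simp
qed

context long_path_decomposition
begin

text \<open>
  The contribution of path \<open>i\<close> in the band with top \<open>t\<close> to the number of radii in \<open>A\<close>, for a real
  variable \<open>t\<close>, so that it can be integrated over all band tops.
\<close>
definition band_hits :: "real \<Rightarrow> real set \<Rightarrow> nat \<Rightarrow> real \<Rightarrow> ennreal" where
  "band_hits w A i t = indicator {t. t < l i \<and> y i - t < min (2 * w) (l i - t) / 2 \<and>
     min w ((l i - t) / 2 * (max w (eta i) / eta i)) \<in> A} t"

lemma measurable_band_hits [measurable]:
  assumes [measurable]: "A \<in> sets borel"
  shows "band_hits w A i \<in> borel_measurable borel"
  unfolding band_hits_def by measurable

text \<open>
  Substitute \<open>s = l i - t\<close>, the length of the path below the band top. For \<open>s \<le> 2 * w\<close> the radius is \<open>s / 2\<close>,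
  and for larger \<open>s\<close> it is \<open>w\<close>. The constant \<open>c\<close> bounds the \<open>s\<close> that occur: it is \<open>eta i + w\<close> for a side path,
  and \<open>l 0\<close> for path \<open>0\<close>, where band tops are positive.
\<close>
lemma nn_integral_band_hits_long:
  assumes A [measurable]: "A \<in> sets borel" and w: "0 < w" and eta: "w \<le> eta i" and c: "2 * w \<le> c"
    and bound: "\<And>t. 0 < t \<Longrightarrow> t < l i \<Longrightarrow> y i - t < w \<Longrightarrow> l i - t \<le> c"
  shows "(\<integral>\<^sup>+t. band_hits w A i t * indicator {0<..} t \<partial>lborel)
    \<le> 2 * emeasure lborel (A \<inter> {0..w}) + ennreal (c - 2 * w) * indicator A w"
proof -
  have e: "0 < eta i" using w eta by simp
  have "(\<integral>\<^sup>+t. band_hits w A i t * indicator {0<..} t \<partial>lborel)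
      = (\<integral>\<^sup>+s. band_hits w A i (l i + -1 * s) * indicator {0<..} (l i + -1 * s) \<partial>lborel)"
    by (subst nn_integral_real_affine[where c = "-1" and t = "l i"]) (auto simp: one_ennreal_def[symmetric])
  also have "\<dots> \<le> (\<integral>\<^sup>+s. indicator A (s / 2) * indicator {0..2 * w} s + indicator A w * indicator {2 * w..c} s \<partial>lborel)"
  proof (rule nn_integral_mono)
    fix s :: real
    have *: "s \<le> c" "0 < s" "min w (s / 2) \<in> A"
      if "0 < l i - s" "0 < s" "y i - (l i - s) < min (2 * w) s / 2" "min w (s / 2 * (max w (eta i) / eta i)) \<in> A"
    proof -
      have "y i - (l i - s) < w" using that by auto
      then show "s \<le> c" using bound[of "l i - s"] that by auto
      show "0 < s" by fact
      show "min w (s / 2) \<in> A" using that(4) e eta by (simp add: max_absorb2)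
    qed
    show "band_hits w A i (l i + -1 * s) * indicator {0<..} (l i + -1 * s)
        \<le> indicator A (s / 2) * indicator {0..2 * w} s + indicator A w * indicator {2 * w..c} s"
    proof (cases "0 < l i - s \<and> 0 < s \<and> y i - (l i - s) < min (2 * w) s / 2 \<and> min w (s / 2 * (max w (eta i) / eta i)) \<in> A")
      case True
      then have "s \<le> c" "0 < s" "min w (s / 2) \<in> A" using * by blast+
      then show ?thesis by (cases "s \<le> 2 * w") (auto simp: band_hits_def indicator_def min_def split: if_splits)
    next
      case False
      then have "band_hits w A i (l i + -1 * s) * indicator {0<..} (l i + -1 * s) = 0"
        by (auto simp: band_hits_def indicator_def)
      then show ?thesis by (simp only: zero_le)
    qed
  qed
  also have "\<dots> = (\<integral>\<^sup>+s. indicator A (s / 2) * indicator {0..2 * w} s \<partial>lborel) + (\<integral>\<^sup>+s. indicator A w * indicator {2 * w..c} s \<partial>lborel)"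
    by (rule nn_integral_add) measurable
  also have "\<dots> = 2 * emeasure lborel (A \<inter> {0..w}) + ennreal (c - 2 * w) * indicator A w"
    using nn_integral_scaled_indicator[OF A, of 2 w] w c by (simp add: nn_integral_cmult mult.commute)
  finally show ?thesis .
qed

text \<open>
  A path shorter than \<open>w\<close> receives a ball only for \<open>s < 2 * eta i\<close>, and the radius \<open>s / 2\<close> is stretched.
\<close>
lemma nn_integral_band_hits_short:
  assumes A [measurable]: "A \<in> sets borel" and eta: "0 < eta i" "eta i < w"
  shows "(\<integral>\<^sup>+t. band_hits w A i t * indicator {0<..} t \<partial>lborel)
    \<le> ennreal (2 * eta i / w) * emeasure lborel (A \<inter> {0..w})"
proof -
  define c where "c = 2 * eta i / w"
  have w: "0 < w" using eta by simp
  have c: "0 < c" "c * w = 2 * eta i" using eta w by (auto simp: c_def)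
  have "(\<integral>\<^sup>+t. band_hits w A i t * indicator {0<..} t \<partial>lborel)
      = (\<integral>\<^sup>+s. band_hits w A i (l i + -1 * s) * indicator {0<..} (l i + -1 * s) \<partial>lborel)"
    by (subst nn_integral_real_affine[where c = "-1" and t = "l i"]) (auto simp: one_ennreal_def[symmetric])
  also have "\<dots> \<le> (\<integral>\<^sup>+s. indicator A (s / c) * indicator {0..c * w} s \<partial>lborel)"
  proof (rule nn_integral_mono)
    fix s :: real
    show "band_hits w A i (l i + -1 * s) * indicator {0<..} (l i + -1 * s)
        \<le> indicator A (s / c) * indicator {0..c * w} s"
    proof (cases "0 < l i - s \<and> 0 < s \<and> y i - (l i - s) < min (2 * w) s / 2 \<and> min w (s / 2 * (max w (eta i) / eta i)) \<in> A")
      case True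
      then have s: "0 < s" "s < c * w" unfolding c by (auto simp: eta_def)
      have sc: "s / 2 * (max w (eta i) / eta i) = s / c" using eta by (simp add: c_def max_absorb1)
      have "s / c \<le> w" using s c by (simp add: field_simps)
      then have "s / c \<in> A" using True sc by (auto simp: min_def split: if_splits)
      then show ?thesis using s by (auto simp: indicator_def band_hits_def)
    next
      case False
      then have "band_hits w A i (l i + -1 * s) * indicator {0<..} (l i + -1 * s) = 0"
        by (auto simp: band_hits_def indicator_def)
      then show ?thesis by (simp only: zero_le)
    qed
  qed
  also have "\<dots> = ennreal c * emeasure lborel (A \<inter> {0..w})"
    using c w by (intro nn_integral_scaled_indicator A) auto
  finally show ?thesis by (simp add: c_def)
qed

text \<open>
  By \<open>nn_integral_tuple_count_le\<close>, for width \<open>w\<close> the expected radius measure is at most the density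
  \<open>beta w / w\<close> on \<open>[0, w]\<close> plus an atom of mass \<open>excess w / (2 * w)\<close> at \<open>w\<close>.
\<close>
definition beta :: "real \<Rightarrow> real" where
  "beta w = 2 + (\<Sum>i\<in>{0<..<N}. eta i / max w (eta i))"

definition excess :: "real \<Rightarrow> real" where
  "excess w = l 0 - 2 * w + (\<Sum>i\<in>{0<..<N}. max w (eta i) - w)"

text \<open>
  The conservation law behind the constant density in \<open>cover_measure_if_diameter_gt\<close>.
\<close>
lemma excess_eq:
  assumes "0 < l 0" "0 \<le> w"
  shows "excess w = total_length T - w * beta w"
proof -
  have "eta i - w * (eta i / max w (eta i)) = max w (eta i) - w" if "i \<in> {0<..<N}" for i
    using eta_pos[of i] that assms by (auto simp: max_def)
  then have "(\<Sum>i\<in>{0<..<N}. eta i) - w * (\<Sum>i\<in>{0<..<N}. eta i / max w (eta i)) = (\<Sum>i\<in>{0<..<N}. max w (eta i) - w)"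
    unfolding sum_distrib_left by (simp add: sum_subtractf[symmetric])
  then show ?thesis by (simp add: excess_def beta_def total_length_eq eta_def algebra_simps)
qed

lemma nn_integral_band_hits:
  assumes A: "A \<in> sets borel" and w: "0 < w" "2 * w \<le> l 0" and i: "0 < i" "i < N"
  shows "(\<integral>\<^sup>+t. band_hits w A i t * indicator {0<..} t \<partial>lborel)
    \<le> ennreal (2 * eta i / max w (eta i)) * emeasure lborel (A \<inter> {0..w}) + ennreal (max w (eta i) - w) * indicator A w"
proof (cases "w \<le> eta i")
  case True
  have "(\<integral>\<^sup>+t. band_hits w A i t * indicator {0<..} t \<partial>lborel)
    \<le> 2 * emeasure lborel (A \<inter> {0..w}) + ennreal (eta i + w - 2 * w) * indicator A w"
    using True w by (intro nn_integral_band_hits_long A) (auto simp: eta_def)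
  then show ?thesis using True w by (simp add: max_absorb2)
next
  case False
  have e: "0 < eta i" using eta_pos[of i] i w by simp
  show ?thesis
    using nn_integral_band_hits_short[OF A e, of w] False by (simp add: max_absorb1)
qed

lemma nn_integral_band_hits_0:
  assumes A: "A \<in> sets borel" and w: "0 < w" "2 * w \<le> l 0"
  shows "(\<integral>\<^sup>+t. band_hits w A 0 t * indicator {0<..} t \<partial>lborel)
    \<le> 2 * emeasure lborel (A \<inter> {0..w}) + ennreal (l 0 - 2 * w) * indicator A w"
  using w by (intro nn_integral_band_hits_long A) (auto simp: eta_def y_0)

definition tuple_count :: "real \<Rightarrow> real \<Rightarrow> real set \<Rightarrow> ennreal" where
  "tuple_count w b A = of_nat (radius_count A (map (band_radius w b) (band_index w b)))"

lemma tuple_count_le: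
  assumes w: "0 < w"
  shows "tuple_count w b A \<le> indicator A (b / 2) + (\<Sum>i<N. \<Sum>k. band_hits w A i (b + 2 * w * real k))"
proof -
  let ?K = "nat \<lceil>l 0 / (2 * w)\<rceil>"
  let ?P = "\<lambda>j. selected w b j \<and> band_radius w b j \<in> A"
  let ?X = "List.product [0..<N] [0..<?K]"
  have "of_nat (length (filter Q X)) = (\<Sum>j\<leftarrow>X. if Q j then 1 else 0 :: ennreal)" for Q and X :: "(nat \<times> nat) list"
    by (induction X) auto
  then have "of_nat (length (filter ?P ?X)) = (\<Sum>j\<leftarrow>?X. if ?P j then 1 else 0 :: ennreal)" .
  also have "\<dots> = (\<Sum>j\<in>{..<N} \<times> {..<?K}. if ?P j then 1 else 0)"
    by (subst sum_list_distinct_conv_sum_set) (auto simp: distinct_product lessThan_atLeast0)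
  also have "\<dots> = (\<Sum>i<N. \<Sum>k<?K. if ?P (i, k) then 1 else 0)"
    by (simp add: sum.cartesian_product)
  also have "\<dots> \<le> (\<Sum>i<N. \<Sum>k. band_hits w A i (b + 2 * w * real k))"
  proof (rule sum_mono)
    fix i assume i: "i \<in> {..<N}"
    have "(\<Sum>k<?K. if ?P (i, k) then 1 else 0) = (\<Sum>k<?K. band_hits w A i (b + 2 * w * real k))"
      using i by (intro sum.cong) (auto simp: band_hits_def selected_def band_radius_def)
    also have "\<dots> \<le> (\<Sum>k. band_hits w A i (b + 2 * w * real k))"
      by (rule sum_le_suminf) auto
    finally show "(\<Sum>k<?K. if ?P (i, k) then 1 else 0) \<le> (\<Sum>k. band_hits w A i (b + 2 * w * real k))" .
  qed
  finally have main: "of_nat (length (filter ?P ?X)) \<le> (\<Sum>i<N. \<Sum>k. band_hits w A i (b + 2 * w * real k))" .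
  have flt: "filter (\<lambda>j. band_radius w b j \<in> A) (filter (selected w b) ?X) = filter ?P ?X"
    by (simp add: conj_commute)
  have "tuple_count w b A = indicator A (b / 2) + of_nat (length (filter ?P ?X))"
    unfolding tuple_count_def radius_count_map band_index_def flt
    by (simp add: band_radius_def flt indicator_def)
  then show ?thesis using main by (simp add: add_left_mono)
qed

end

section \<open>Random covers\<close>

lemma measurable_filter_list:
  assumes [measurable]: "\<And>j. Measurable.pred M (\<lambda>x. P x j)"
  shows "(\<lambda>x. filter (P x) xs) \<in> measurable M (count_space UNIV)"
proof (induction xs)
  case (Cons a xs)
  note [measurable] = Cons
  have [measurable]: "(\<lambda>x. a # filter (P x) xs) \<in> measurable M (count_space UNIV)"
    by (rule measurable_compose[OF Cons]) simp
  show ?case by simp measurable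
qed simp

lemma measurable_sum_list_map:
  assumes [measurable]: "\<And>j. f j \<in> borel_measurable M"
  shows "(\<lambda>x. sum_list (map (\<lambda>j. f j x) J) :: real) \<in> borel_measurable M"
proof (induction J)
  case (Cons a J)
  note [measurable] = Cons
  show ?case by simp
qed simp

context long_path_decomposition
begin

lemma excess_nonneg: "2 * w \<le> l 0 \<Longrightarrow> 0 \<le> excess w"
  unfolding excess_def by (intro add_nonneg_nonneg sum_nonneg) auto

lemma beta_nonneg: "0 < l 0 \<Longrightarrow> 0 \<le> beta w"
  unfolding beta_def using eta_pos
  by (intro add_nonneg_nonneg sum_nonneg divide_nonneg_nonneg) (auto simp: less_imp_le max.coboundedI2)

text \<open>
  For \<open>2 * w > l 0\<close> a single ball of radius \<open>w\<close> covers the tree.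
\<close>
definition width_bound :: "real \<Rightarrow> real set \<Rightarrow> ennreal" where
  "width_bound w A = (if 2 * w \<le> l 0
     then ennreal (beta w / w) * emeasure lborel (A \<inter> {0..w}) + ennreal (excess w / (2 * w)) * indicator A w
     else indicator A w)"

text \<open>
  The term \<open>2\<close> in \<open>beta\<close> comes from path \<open>0\<close>: its first and its last ball have a uniform radius on \<open>[0, w]\<close>.
\<close>
lemma nn_integral_tuple_count_le:
  assumes A [measurable]: "A \<in> sets borel" and w: "0 < w" "2 * w \<le> l 0"
  shows "(\<integral>\<^sup>+x. tuple_count w (2 * w * x) A * indicator {0<..<1} x \<partial>lborel) \<le> width_bound w A"
proof -
  have l0: "0 < l 0" using w by simp
  let ?V = "emeasure lborel (A \<inter> {0..w})"
  have "?V \<le> emeasure lborel {0..w}" by (intro emeasure_mono) auto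
  then have "?V < top" using w by (simp add: le_less_trans)
  then obtain v where v: "0 \<le> v" "?V = ennreal v" by (metis ennreal_cases less_irrefl top.not_eq_extremum)
  define \<iota> :: real where "\<iota> = indicator A w"
  have \<iota>: "0 \<le> \<iota>" "(indicator A w :: ennreal) = ennreal \<iota>" by (auto simp: \<iota>_def indicator_def)
  let ?I = "\<lambda>i. \<integral>\<^sup>+t. band_hits w A i t * indicator {0<..} t \<partial>lborel"
  let ?S = "\<lambda>i x. \<Sum>k. band_hits w A i (2 * w * (x + real k))"
  have e: "0 < eta i" if "i < N" for i using eta_pos[OF l0 that] .
  have coef: "0 \<le> 2 * eta i / max w (eta i)" "0 \<le> max w (eta i) - w" if "i < N" for i
    using e[OF that] w by (auto intro!: divide_nonneg_nonneg)
  have "(\<integral>\<^sup>+x. tuple_count w (2 * w * x) A * indicator {0<..<1} x \<partial>lborel)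
      \<le> (\<integral>\<^sup>+x. indicator A (x / (1 / w)) * indicator {0..1 / w * w} x + (\<Sum>i<N. ?S i x * indicator {0<..<1} x) \<partial>lborel)"
  proof (rule nn_integral_mono)
    fix x :: real
    show "tuple_count w (2 * w * x) A * indicator {0<..<1} x
        \<le> indicator A (x / (1 / w)) * indicator {0..1 / w * w} x + (\<Sum>i<N. ?S i x * indicator {0<..<1} x)"
    proof (cases "x \<in> {0<..<1}")
      case True
      have "tuple_count w (2 * w * x) A \<le> indicator A (w * x) + (\<Sum>i<N. ?S i x)"
        using tuple_count_le[OF w(1), of "2 * w * x" A] by (simp add: algebra_simps)
      then show ?thesis using True w by (simp add: mult.commute)
    qed simp
  qed
  also have "\<dots> = (\<integral>\<^sup>+x. indicator A (x / (1 / w)) * indicator {0..1 / w * w} x \<partial>lborel)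
      + (\<Sum>i<N. \<integral>\<^sup>+x. ?S i x * indicator {0<..<1} x \<partial>lborel)"
  proof -
    have "(\<integral>\<^sup>+x. (\<Sum>i<N. ?S i x * indicator {0<..<1} x) \<partial>lborel) = (\<Sum>i<N. \<integral>\<^sup>+x. ?S i x * indicator {0<..<1} x \<partial>lborel)"
      by (rule nn_integral_sum) measurable
    then show ?thesis by (subst nn_integral_add) measurable
  qed
  also have "(\<integral>\<^sup>+x. indicator A (x / (1 / w)) * indicator {0..1 / w * w} x \<partial>lborel) = ennreal (1 / w) * ?V"
    using w by (intro nn_integral_scaled_indicator A) auto
  finally have le: "(\<integral>\<^sup>+x. tuple_count w (2 * w * x) A * indicator {0<..<1} x \<partial>lborel)
      \<le> ennreal (1 / w) * ?V + (\<Sum>i<N. \<integral>\<^sup>+x. ?S i x * indicator {0<..<1} x \<partial>lborel)" .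
  have "ennreal (2 * w) * (\<integral>\<^sup>+x. tuple_count w (2 * w * x) A * indicator {0<..<1} x \<partial>lborel)
      \<le> ennreal (2 * w) * (ennreal (1 / w) * ?V + (\<Sum>i<N. \<integral>\<^sup>+x. ?S i x * indicator {0<..<1} x \<partial>lborel))"
    by (rule mult_left_mono[OF le]) simp
  also have "\<dots> = 2 * ?V + (\<Sum>i<N. ennreal (2 * w) * (\<integral>\<^sup>+x. ?S i x * indicator {0<..<1} x \<partial>lborel))"
    using w by (simp add: distrib_left sum_distrib_left mult.assoc[symmetric] ennreal_mult[symmetric])
  also have "\<dots> \<le> 2 * ?V + (\<Sum>i<N. ?I i)"
    using w by (intro add_left_mono sum_mono nn_integral_periodic_le) auto
  also have "(\<Sum>i<N. ?I i) = ?I 0 + (\<Sum>i\<in>{0<..<N}. ?I i)"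
  proof -
    have "{..<N} = insert 0 {0<..<N}" using N_pos by auto
    then show ?thesis by simp
  qed
  also have "2 * ?V + (?I 0 + (\<Sum>i\<in>{0<..<N}. ?I i)) \<le> 2 * ?V + ((2 * ?V + ennreal (l 0 - 2 * w) * indicator A w) +
      (\<Sum>i\<in>{0<..<N}. ennreal (2 * eta i / max w (eta i)) * ?V + ennreal (max w (eta i) - w) * indicator A w))"
    by (intro add_left_mono add_mono sum_mono nn_integral_band_hits nn_integral_band_hits_0 A w) auto
  also have "\<dots> = ennreal (2 * v + ((2 * v + (l 0 - 2 * w) * \<iota>) +
      (\<Sum>i\<in>{0<..<N}. 2 * eta i / max w (eta i) * v + (max w (eta i) - w) * \<iota>)))"
  proof -
    have tn: "0 \<le> 2 * eta i / max w (eta i) * v + (max w (eta i) - w) * \<iota>" if "i \<in> {0<..<N}" for i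
      using that by (intro add_nonneg_nonneg mult_nonneg_nonneg coef v \<iota>) auto
    have "(\<Sum>i\<in>{0<..<N}. ennreal (2 * eta i / max w (eta i)) * ennreal v + ennreal (max w (eta i) - w) * ennreal \<iota>)
        = (\<Sum>i\<in>{0<..<N}. ennreal (2 * eta i / max w (eta i) * v + (max w (eta i) - w) * \<iota>))"
    proof (intro sum.cong refl)
      fix i assume "i \<in> {0<..<N}"
      then have c: "0 \<le> 2 * eta i / max w (eta i)" "0 \<le> max w (eta i) - w" using coef by auto
      show "ennreal (2 * eta i / max w (eta i)) * ennreal v + ennreal (max w (eta i) - w) * ennreal \<iota>
          = ennreal (2 * eta i / max w (eta i) * v + (max w (eta i) - w) * \<iota>)"
        unfolding ennreal_plus[OF mult_nonneg_nonneg[OF c(1) v(1)] mult_nonneg_nonneg[OF c(2) \<iota>(1)]]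
          ennreal_mult[OF c(1) v(1)] ennreal_mult[OF c(2) \<iota>(1)] ..
    qed
    also have "\<dots> = ennreal (\<Sum>i\<in>{0<..<N}. 2 * eta i / max w (eta i) * v + (max w (eta i) - w) * \<iota>)"
      by (rule sum_ennreal[OF tn])
    finally have sums: "(\<Sum>i\<in>{0<..<N}. ennreal (2 * eta i / max w (eta i)) * ennreal v + ennreal (max w (eta i) - w) * ennreal \<iota>)
        = ennreal (\<Sum>i\<in>{0<..<N}. 2 * eta i / max w (eta i) * v + (max w (eta i) - w) * \<iota>)" .
    have nn: "0 \<le> (\<Sum>i\<in>{0<..<N}. 2 * eta i / max w (eta i) * v + (max w (eta i) - w) * \<iota>)"
      by (rule sum_nonneg[OF tn])
    have two: "2 * ennreal v = ennreal (2 * v)" using v by (simp add: ennreal_mult)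
    show ?thesis
      unfolding v(2) \<iota>(2) sums two using v \<iota> nn w
      by (simp add: ennreal_mult[symmetric] flip: ennreal_plus)
  qed
  also have "\<dots> = ennreal (2 * w * (beta w / w * v + excess w / (2 * w) * \<iota>))"
  proof (rule arg_cong[of _ _ ennreal])
    have "2 * w * (beta w / w * v + excess w / (2 * w) * \<iota>) = 2 * beta w * v + excess w * \<iota>"
      using w by (simp add: field_simps)
    also have "\<dots> = 2 * v + ((2 * v + (l 0 - 2 * w) * \<iota>) +
      (\<Sum>i\<in>{0<..<N}. 2 * eta i / max w (eta i) * v + (max w (eta i) - w) * \<iota>))"
    proof -
      have "(\<Sum>i\<in>{0<..<N}. 2 * eta i / max w (eta i) * v + (max w (eta i) - w) * \<iota>)
          = 2 * v * (\<Sum>i\<in>{0<..<N}. eta i / max w (eta i)) + \<iota> * (\<Sum>i\<in>{0<..<N}. max w (eta i) - w)"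
        unfolding sum.distrib sum_distrib_left
        by (intro arg_cong2[where f = "(+)"] sum.cong) (simp_all add: mult_ac)
      then show ?thesis unfolding beta_def excess_def by (simp only:) argo
    qed
    finally show "2 * v + ((2 * v + (l 0 - 2 * w) * \<iota>) +
      (\<Sum>i\<in>{0<..<N}. 2 * eta i / max w (eta i) * v + (max w (eta i) - w) * \<iota>))
      = 2 * w * (beta w / w * v + excess w / (2 * w) * \<iota>)" by simp
  qed
  also have "\<dots> = ennreal (2 * w) * width_bound w A"
  proof -
    have c: "0 \<le> beta w / w" "0 \<le> excess w / (2 * w)"
      using w excess_nonneg[OF w(2)] beta_nonneg[OF l0, of w] by auto
    have "width_bound w A = ennreal (beta w / w * v + excess w / (2 * w) * \<iota>)"
      unfolding ennreal_plus[OF mult_nonneg_nonneg[OF c(1) v(1)] mult_nonneg_nonneg[OF c(2) \<iota>(1)]]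
        ennreal_mult[OF c(1) v(1)] ennreal_mult[OF c(2) \<iota>(1)]
      using w by (simp add: width_bound_def v(2) \<iota>(2))
    moreover have "0 \<le> beta w / w * v + excess w / (2 * w) * \<iota>"
      by (intro add_nonneg_nonneg mult_nonneg_nonneg c v \<iota>)
    ultimately show ?thesis using w by (simp only: ennreal_mult)
  qed
  finally show ?thesis
    using w by (subst (asm) ennreal_mult_le_mult_iff) auto
qed

text \<open>
  A value outside \<open>(0, 1)\<close> has probability \<open>0\<close>; it is replaced so that every sample is a cover.
\<close>
definition offset :: "real \<Rightarrow> real" where "offset x = (if 0 < x \<and> x < 1 then x else 1)"

definition chosen_radius :: "real \<Rightarrow> real \<Rightarrow> nat \<times> nat \<Rightarrow> real" where
  "chosen_radius w x j = (if 2 * w \<le> l 0 then band_radius w (2 * w * offset x) j else w)"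

definition chosen_index :: "real \<Rightarrow> real \<Rightarrow> (nat \<times> nat) list" where
  "chosen_index w x = (if 2 * w \<le> l 0 then trim (chosen_radius w x) (band_index w (2 * w * offset x)) else [(0, 0)])"

lemma offset_bounds: "0 < offset x" "offset x \<le> 1" by (auto simp: offset_def)

lemma chosen_zero_good:
  assumes l0: "0 < l 0" and w: "0 < w" "w \<le> total_length T"
  shows "map (chosen_radius w x) (chosen_index w x) \<in> zero_good_covers T"
proof (cases "2 * w \<le> l 0")
  case True
  define b where "b = 2 * w * offset x"
  have b: "0 < b" "b \<le> 2 * w" using offset_bounds[of x] w by (auto simp: b_def mult_left_le)
  have cr: "chosen_radius w x = band_radius w b" using True by (auto simp: chosen_radius_def b_def fun_eq_iff)
  have "map (band_radius w b) (trim (band_radius w b) (band_index w b)) \<in> zero_good_covers T"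
  proof (rule trim_zero_good)
    show "map (band_radius w b) (band_index w b) \<in> covers T" by (rule band_covers[OF w(1) True b])
    show "0 < l 0" by (rule l0)
    fix j assume "j \<in> set (band_index w b)"
    from band_radius_bounds[OF w(1) b l0 this] True
    show "0 \<le> band_radius w b j \<and> band_radius w b j \<le> l 0 / 2" by auto
  qed
  then show ?thesis using True by (simp add: chosen_index_def cr b_def[symmetric])
next
  case False
  then have "[w] \<in> covers T" using l0 by (intro single_ball_cover) auto
  then show ?thesis using False w by (simp add: chosen_index_def chosen_radius_def zero_good_covers_def)
qed

lemma chosen_count_le:
  assumes A [measurable]: "A \<in> sets borel" and w: "0 < w"
  shows "(\<integral>\<^sup>+x. of_nat (radius_count A (map (chosen_radius w x) (chosen_index w x))) * indicator {0<..<1} x \<partial>lborel)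
    \<le> width_bound w A"
proof (cases "2 * w \<le> l 0")
  case True
  have "(\<integral>\<^sup>+x. of_nat (radius_count A (map (chosen_radius w x) (chosen_index w x))) * indicator {0<..<1} x \<partial>lborel)
      \<le> (\<integral>\<^sup>+x. tuple_count w (2 * w * x) A * indicator {0<..<1} x \<partial>lborel)"
  proof (rule nn_integral_mono)
    fix x :: real
    have drop_le: "length (filter P (drop d J)) \<le> length (filter P J)" for P d and J :: "(nat \<times> nat) list"
      using arg_cong[OF append_take_drop_id[of d J], of "\<lambda>J. length (filter P J)"]
      unfolding filter_append length_append by linarith
    have "radius_count A (map (chosen_radius w x) (chosen_index w x))
        \<le> radius_count A (map (band_radius w (2 * w * x)) (band_index w (2 * w * x)))" if x: "x \<in> {0<..<1}"
    proof -
      have "chosen_radius w x = band_radius w (2 * w * x)" "offset x = x"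
        using True x by (auto simp: chosen_radius_def offset_def fun_eq_iff)
      then show ?thesis using True by (simp add: chosen_index_def trim_def radius_count_map drop_le)
    qed
    then show "of_nat (radius_count A (map (chosen_radius w x) (chosen_index w x))) * indicator {0<..<1} x
      \<le> tuple_count w (2 * w * x) A * (indicator {0<..<1} x :: ennreal)"
      by (auto simp: tuple_count_def indicator_def)
  qed
  also have "\<dots> \<le> width_bound w A" by (rule nn_integral_tuple_count_le[OF A w True])
  finally show ?thesis .
next
  case False
  have "(of_nat (radius_count A (map (chosen_radius w x) (chosen_index w x))) :: ennreal) = indicator A w" for x
    using False radius_count_map[of A "\<lambda>_. w" "[()]"] by (simp add: chosen_radius_def chosen_index_def indicator_def)
  then show ?thesis using False by (simp add: width_bound_def nn_integral_cmult)
qed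

lemma measurable_chosen_radius [measurable]:
  assumes [measurable]: "w \<in> borel_measurable M" "x \<in> borel_measurable M"
  shows "(\<lambda>z. chosen_radius (w z) (x z) j) \<in> borel_measurable M"
  unfolding chosen_radius_def band_radius_def offset_def by (cases j) (simp; measurable)

lemma measurable_chosen_index:
  assumes [measurable]: "w \<in> borel_measurable M" "x \<in> borel_measurable M"
  shows "(\<lambda>z. chosen_index (w z) (x z)) \<in> measurable M (count_space UNIV)"
proof -
  have [measurable]: "(\<lambda>z. offset (x z)) \<in> borel_measurable M" unfolding offset_def by measurable
  have sel [measurable]: "Measurable.pred M (\<lambda>z. selected (w z) (2 * w z * offset (x z)) j)" for j
    unfolding selected_def by (cases j) (simp; measurable)
  have flt: "(\<lambda>z. filter (selected (w z) (2 * w z * offset (x z))) (List.product [0..<N] [0..<nat \<lceil>l 0 / (2 * w z)\<rceil>]))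
      \<in> measurable M (count_space UNIV)"
    by (rule measurable_compose_countable[where
          f = "\<lambda>K z. filter (selected (w z) (2 * w z * offset (x z))) (List.product [0..<N] [0..<K])"])
      (rule measurable_filter_list[OF sel], measurable)
  have idx: "(\<lambda>z. band_index (w z) (2 * w z * offset (x z))) \<in> measurable M (count_space UNIV)"
    unfolding band_index_def by (rule measurable_compose[OF flt]) simp
  have "(\<lambda>z. trim (chosen_radius (w z) (x z)) J) \<in> measurable M (count_space UNIV)" for J
  proof -
    have [measurable]: "(\<lambda>z. sum_list (map (chosen_radius (w z) (x z)) (drop d J))) \<in> borel_measurable M" for d
      by (rule measurable_sum_list_map) measurable
    have "(\<lambda>z. LEAST d. sum_list (map (chosen_radius (w z) (x z)) (drop d J)) \<le> total_length T) \<in> measurable M (count_space UNIV)"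
      by measurable
    then show ?thesis unfolding trim_def by (rule measurable_compose) simp
  qed
  then have "(\<lambda>z. trim (chosen_radius (w z) (x z)) (band_index (w z) (2 * w z * offset (x z)))) \<in> measurable M (count_space UNIV)"
    by (rule measurable_compose_countable[OF _ idx])
  then show ?thesis unfolding chosen_index_def by measurable
qed

text \<open>
  The cover is a function of two independent samples: the point that determines the width, and the
  offset.
\<close>
lemma exists_cover_measure:
  fixes M :: "real measure" and w :: "real \<Rightarrow> real"
  assumes M: "prob_space M" and [measurable]: "w \<in> borel_measurable M"
    and w: "\<And>s. 0 < w s" "\<And>s. w s \<le> total_length T" and l0: "0 < l 0"
  shows "\<exists>\<nu>. prob_space \<nu> \<and> sets \<nu> = sets (restrict_space tuple_borel (zero_good_covers T)) \<and>
    (\<forall>A\<in>sets nonneg_borel. emeasure (expected_radius_measure \<nu>) A \<le> (\<integral>\<^sup>+s. width_bound (w s) A \<partial>M))"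
proof -
  interpret M: prob_space M by fact
  define U :: "real measure" where "U = uniform_measure lborel {0<..<1}"
  interpret U: prob_space U unfolding U_def by (rule prob_space_uniform_measure) auto
  have [measurable_cong]: "sets U = sets borel" by (simp add: U_def)
  interpret P: pair_prob_space M U ..
  let ?Z = "zero_good_covers T"
  define R where "R = restrict_space tuple_borel ?Z"
  define X where "X z = map (chosen_radius (w (fst z)) (snd z)) (chosen_index (w (fst z)) (snd z))" for z :: "real \<times> real"
  have "X \<in> measurable (M \<Otimes>\<^sub>M U) tuple_borel"
    unfolding X_def by (intro measurable_map_tuple measurable_chosen_index measurable_chosen_radius) measurable
  then have X [measurable]: "X \<in> measurable (M \<Otimes>\<^sub>M U) R"
    unfolding R_def using chosen_zero_good[OF l0 w] by (intro measurable_restrict_space2) (auto simp: X_def)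
  define \<nu> where "\<nu> = distr (M \<Otimes>\<^sub>M U) R X"
  have "prob_space \<nu>" unfolding \<nu>_def by (rule P.prob_space_distr[OF X])
  moreover have sets\<nu>: "sets \<nu> = sets (restrict_space tuple_borel ?Z)" by (simp add: \<nu>_def R_def)
  moreover have "emeasure (expected_radius_measure \<nu>) A \<le> (\<integral>\<^sup>+s. width_bound (w s) A \<partial>M)"
    if A: "A \<in> sets nonneg_borel" for A
  proof -
    have Ab [measurable]: "A \<in> sets borel" using A by (auto simp: nonneg_borel_def sets_restrict_space)
    have [measurable]: "radius_count A \<in> measurable R (count_space UNIV)"
      unfolding R_def by (intro measurable_restrict_space1 measurable_radius_count Ab)
    have [measurable]: "(\<lambda>rs. of_nat (radius_count A rs) :: ennreal) \<in> borel_measurable R" by measurable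
    have "emeasure (expected_radius_measure \<nu>) A = (\<integral>\<^sup>+rs. of_nat (radius_count A rs) \<partial>\<nu>)"
      by (rule emeasure_expected_radius_measure[OF sets\<nu> A])
    also have "\<dots> = (\<integral>\<^sup>+z. of_nat (radius_count A (X z)) \<partial>(M \<Otimes>\<^sub>M U))"
      unfolding \<nu>_def by (rule nn_integral_distr[OF X]) measurable
    also have "\<dots> = (\<integral>\<^sup>+s. \<integral>\<^sup>+x. of_nat (radius_count A (X (s, x))) \<partial>U \<partial>M)"
      by (rule U.nn_integral_fst[symmetric]) measurable
    also have "\<dots> \<le> (\<integral>\<^sup>+s. width_bound (w s) A \<partial>M)"
    proof (rule nn_integral_mono)
      fix s assume s: "s \<in> space M"
      have "(\<lambda>x. (s, x)) \<in> measurable U (M \<Otimes>\<^sub>M U)" by (rule measurable_Pair1'[OF s])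
      then have "(\<lambda>x. of_nat (radius_count A (X (s, x))) :: ennreal) \<in> borel_measurable U" by measurable
      then have m [measurable]: "(\<lambda>x. of_nat (radius_count A (X (s, x))) :: ennreal) \<in> borel_measurable lborel"
        by (simp add: U_def cong: measurable_cong_sets)
      have "(\<integral>\<^sup>+x. of_nat (radius_count A (X (s, x))) \<partial>U)
          = (\<integral>\<^sup>+x. of_nat (radius_count A (X (s, x))) * indicator {0<..<1} x \<partial>lborel)"
        unfolding U_def by (subst nn_integral_uniform_measure[OF m]) (auto simp: divide_ennreal_def)
      also have "\<dots> \<le> width_bound (w s) A"
        unfolding X_def by (simp add: chosen_count_le[OF Ab w(1)])
      finally show "(\<integral>\<^sup>+x. of_nat (radius_count A (X (s, x))) \<partial>U) \<le> width_bound (w s) A" .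
    qed
    finally show ?thesis .
  qed
  ultimately show ?thesis by blast
qed

end

section \<open>Mixing the widths\<close>

lemma nn_integral_FTC_within:
  fixes f F :: "real \<Rightarrow> real"
  assumes [measurable]: "f \<in> borel_measurable borel"
    and F: "\<And>x. a \<le> x \<Longrightarrow> x \<le> b \<Longrightarrow> (F has_real_derivative f x) (at x within {a..b})"
    and nn: "\<And>x. a \<le> x \<Longrightarrow> x \<le> b \<Longrightarrow> 0 \<le> f x" and ab: "a \<le> b"
  shows "(\<integral>\<^sup>+x. ennreal (f x) * indicator {a..b} x \<partial>lborel) = ennreal (F b - F a)"
proof -
  have "(f has_integral F b - F a) {a..b}"
    using ab F by (intro fundamental_theorem_of_calculus)
      (auto simp: has_real_derivative_iff_has_vector_derivative[symmetric])
  then have "((\<lambda>x. if x \<in> {a..b} then f x else 0) has_integral F b - F a) UNIV"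
    by (simp only: has_integral_restrict_UNIV)
  then have "(\<integral>\<^sup>+x. ennreal (if x \<in> {a..b} then f x else 0) \<partial>lborel) = ennreal (F b - F a)"
    by (intro nn_integral_has_integral_lborel) (auto simp: nn)
  moreover have "ennreal (f x) * indicator {a..b} x = ennreal (if x \<in> {a..b} then f x else 0)" for x
    by (simp add: indicator_def)
  ultimately show ?thesis by (simp only:)
qed

context long_path_decomposition
begin

lemma exists_cover_measure_density:
  fixes k w :: "real \<Rightarrow> real"
  assumes k [measurable]: "k \<in> borel_measurable borel" and k1: "(\<integral>\<^sup>+s. ennreal (k s) \<partial>lborel) = 1"
    and w [measurable]: "w \<in> borel_measurable borel"
    and wb: "\<And>s. 0 < w s" "\<And>s. w s \<le> total_length T" and l0: "0 < l 0"
    and bound: "\<And>A. A \<in> sets borel \<Longrightarrow>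
      (\<integral>\<^sup>+s. ennreal (k s) * width_bound (w s) A \<partial>lborel) \<le> ennreal c * emeasure lborel (A \<inter> {0..r})"
  shows "\<exists>\<nu>. prob_space \<nu> \<and> sets \<nu> = sets (restrict_space tuple_borel (zero_good_covers T)) \<and>
    (\<forall>A\<in>sets nonneg_borel. emeasure (expected_radius_measure \<nu>) A \<le> ennreal c * emeasure lborel (A \<inter> {0..r}))"
proof -
  define M where "M = density lborel (\<lambda>s. ennreal (k s))"
  have M: "prob_space M"
    by (rule prob_spaceI) (simp add: M_def emeasure_density k1)
  have wM: "w \<in> borel_measurable M" by (simp add: M_def)
  obtain \<nu> where \<nu>: "prob_space \<nu>" "sets \<nu> = sets (restrict_space tuple_borel (zero_good_covers T))"
    and E: "\<And>A. A \<in> sets nonneg_borel \<Longrightarrow> emeasure (expected_radius_measure \<nu>) A \<le> (\<integral>\<^sup>+s. width_bound (w s) A \<partial>M)"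
    using exists_cover_measure[OF M wM wb l0] by blast
  have "emeasure (expected_radius_measure \<nu>) A \<le> ennreal c * emeasure lborel (A \<inter> {0..r})"
    if A: "A \<in> sets nonneg_borel" for A
  proof -
    have Ab [measurable]: "A \<in> sets borel" using A by (auto simp: nonneg_borel_def sets_restrict_space)
    have [measurable]: "(\<lambda>s. emeasure lborel (A \<inter> {0..w s})) \<in> borel_measurable borel"
    proof -
      have "(\<lambda>s. \<integral>\<^sup>+u. indicator A u * indicator {0..w s} u \<partial>lborel) \<in> borel_measurable borel"
        unfolding indicator_def atLeastAtMost_iff by measurable
      moreover have "(\<integral>\<^sup>+u. indicator A u * indicator {0..w s} u \<partial>lborel) = emeasure lborel (A \<inter> {0..w s})" for s
        by (simp add: indicator_inter_arith[symmetric])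
      ultimately show ?thesis by simp
    qed
    have m [measurable]: "(\<lambda>s. width_bound (w s) A) \<in> borel_measurable borel"
      unfolding width_bound_def beta_def excess_def by measurable
    have "(\<integral>\<^sup>+s. width_bound (w s) A \<partial>M) = (\<integral>\<^sup>+s. ennreal (k s) * width_bound (w s) A \<partial>lborel)"
      unfolding M_def by (rule nn_integral_density) (use m in simp_all)
    then show ?thesis using E[OF A] bound[OF Ab] by simp
  qed
  with \<nu> show ?thesis by blast
qed

lemma l_0_le_total: "l 0 \<le> total_length T"
  unfolding total_length_eq using y_less by (auto intro!: sum_nonneg simp: less_imp_le)

lemma l_0_pos: "0 < total_length T \<Longrightarrow> 0 < l 0"
proof (rule ccontr)
  assume L: "0 < total_length T" and "\<not> 0 < l 0"
  then have "l 0 = 0" using l_0 by simp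
  have "{0<..<N} = {}"
  proof (rule ccontr)
    assume "{0<..<N} \<noteq> {}"
    then obtain i where "0 < i" "i < N" by auto
    then show False using y_less[of i] y_nonneg[of i] l_le_0[of i] \<open>l 0 = 0\<close> by simp
  qed
  then show False using L \<open>l 0 = 0\<close> by (simp add: total_length_eq)
qed

text \<open>
  At \<open>w0 = l 0 / 2\<close> no side path is longer than \<open>w0\<close>, so \<open>excess w0 = 0\<close> and the density is \<open>L / w0\<^sup>2\<close>
  on \<open>[0, w0]\<close>. With probability \<open>w0\<^sup>2 / r\<^sup>2\<close> this becomes \<open>L / r\<^sup>2\<close>. The remaining probability is spread
  evenly over single balls of radii in \<open>(w0, r]\<close>, with density \<open>(r + w0) / r\<^sup>2 \<le> 2 * r / r\<^sup>2 \<le> L / r\<^sup>2\<close>.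
\<close>
lemma cover_measure_if_diameter_le:
  assumes r: "0 < r" "2 * r \<le> total_length T" and short: "l 0 \<le> 2 * r"
  shows "\<exists>\<nu>. prob_space \<nu> \<and> sets \<nu> = sets (restrict_space tuple_borel (zero_good_covers T)) \<and>
    (\<forall>A\<in>sets nonneg_borel. emeasure (expected_radius_measure \<nu>) A
       \<le> ennreal (total_length T / r\<^sup>2) * emeasure lborel (A \<inter> {0..r}))"
proof -
  let ?L = "total_length T"
  define w0 where "w0 = l 0 / 2"
  have l0: "0 < l 0" using r by (intro l_0_pos) simp
  have w0: "0 < w0" "w0 \<le> r" "2 * w0 = l 0" using l0 short by (auto simp: w0_def)
  define w where "w s = (if s \<le> w0 then w0 else if s \<le> r then s else r)" for s
  define k where "k s = (if 0 \<le> s \<and> s \<le> w0 then w0 / r\<^sup>2 else if w0 < s \<and> s \<le> r then (r + w0) / r\<^sup>2 else 0)" for s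
  have k_eq: "ennreal (k s) = ennreal (w0 / r\<^sup>2) * indicator {0..w0} s + ennreal ((r + w0) / r\<^sup>2) * indicator {w0<..r} s" for s
    by (auto simp: k_def indicator_def)
  have ex0: "excess w0 = 0"
  proof -
    have "max w0 (eta i) = w0" if "i \<in> {0<..<N}" for i
    proof -
      have "eta i \<le> l i / 2" using l_le_2y[of i] that by (auto simp: eta_def)
      also have "\<dots> \<le> w0" using l_le_0[of i] that by (simp add: w0_def)
      finally show ?thesis by simp
    qed
    then show ?thesis using w0 by (simp add: excess_def)
  qed
  then have beta0: "beta w0 = ?L / w0" using excess_eq[of w0] w0 l0 by (simp add: field_simps)
  show ?thesis
  proof (rule exists_cover_measure_density[of k w])
    show "k \<in> borel_measurable borel" "w \<in> borel_measurable borel" unfolding k_def w_def by measurable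
    show "0 < w s" "w s \<le> ?L" for s using w0 r by (auto simp: w_def)
    show "0 < l 0" by fact
    have "(\<integral>\<^sup>+s. ennreal (k s) \<partial>lborel) = ennreal (w0 / r\<^sup>2) * ennreal w0 + ennreal ((r + w0) / r\<^sup>2) * ennreal (r - w0)"
      unfolding k_eq using w0 by (subst nn_integral_add) (auto simp: nn_integral_cmult)
    also have "\<dots> = ennreal (w0 / r\<^sup>2 * w0 + (r + w0) / r\<^sup>2 * (r - w0))"
    proof -
      have c: "0 \<le> w0 / r\<^sup>2" "0 \<le> w0" "0 \<le> (r + w0) / r\<^sup>2" "0 \<le> r - w0" using w0 r by auto
      show ?thesis
        unfolding ennreal_plus[OF mult_nonneg_nonneg[OF c(1,2)] mult_nonneg_nonneg[OF c(3,4)]]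
          ennreal_mult[OF c(1,2)] ennreal_mult[OF c(3,4)] ..
    qed
    also have "w0 / r\<^sup>2 * w0 + (r + w0) / r\<^sup>2 * (r - w0) = 1"
      using r by (simp add: field_simps power2_eq_square)
    finally show "(\<integral>\<^sup>+s. ennreal (k s) \<partial>lborel) = 1" by simp
    fix A :: "real set" assume A [measurable]: "A \<in> sets borel"
    let ?V = "emeasure lborel (A \<inter> {0..w0})" and ?V' = "emeasure lborel (A \<inter> {w0<..r})"
    have "ennreal (k s) * width_bound (w s) A
        = ennreal (w0 / r\<^sup>2) * (ennreal (?L / w0 / w0) * ?V) * indicator {0..w0} s
          + ennreal ((r + w0) / r\<^sup>2) * indicator (A \<inter> {w0<..r}) s" for s
    proof -
      consider "s < 0" | "0 \<le> s" "s \<le> w0" | "w0 < s" "s \<le> r" | "r < s" by linarith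
      then show ?thesis
      proof cases
        case 2
        then show ?thesis using w0 by (simp add: k_def w_def width_bound_def ex0 beta0)
      next
        case 3
        then show ?thesis using w0 by (simp add: k_def w_def width_bound_def indicator_def)
      qed (use w0 in \<open>auto simp: k_def\<close>)
    qed
    then have "(\<integral>\<^sup>+s. ennreal (k s) * width_bound (w s) A \<partial>lborel)
        = (\<integral>\<^sup>+s. ennreal (w0 / r\<^sup>2) * (ennreal (?L / w0 / w0) * ?V) * indicator {0..w0} s
          + ennreal ((r + w0) / r\<^sup>2) * indicator (A \<inter> {w0<..r}) s \<partial>lborel)"
      by (intro nn_integral_cong) auto
    also have "\<dots> = ennreal (w0 / r\<^sup>2) * (ennreal (?L / w0 / w0) * ?V) * ennreal w0 + ennreal ((r + w0) / r\<^sup>2) * ?V'"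
      using w0 by (subst nn_integral_add) (auto simp: nn_integral_cmult)
    also have "ennreal (w0 / r\<^sup>2) * (ennreal (?L / w0 / w0) * ?V) * ennreal w0
        = (ennreal (w0 / r\<^sup>2) * ennreal (?L / w0 / w0) * ennreal w0) * ?V" by (simp add: mult_ac)
    also have "ennreal (w0 / r\<^sup>2) * ennreal (?L / w0 / w0) * ennreal w0 = ennreal (?L / r\<^sup>2)"
      using w0 r by (simp add: ennreal_mult[symmetric])
    also have "ennreal ((r + w0) / r\<^sup>2) * ?V' \<le> ennreal (?L / r\<^sup>2) * ?V'"
      using w0 r by (intro mult_right_mono ennreal_leI divide_right_mono) auto
    also have "ennreal (?L / r\<^sup>2) * ?V + ennreal (?L / r\<^sup>2) * ?V' = ennreal (?L / r\<^sup>2) * emeasure lborel ((A \<inter> {0..w0}) \<union> (A \<inter> {w0<..r}))"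
      by (subst plus_emeasure[symmetric]) (auto simp: distrib_left)
    also have "(A \<inter> {0..w0}) \<union> (A \<inter> {w0<..r}) = A \<inter> {0..r}" using w0 by auto
    finally show "(\<integral>\<^sup>+s. ennreal (k s) * width_bound (w s) A \<partial>lborel) \<le> ennreal (?L / r\<^sup>2) * emeasure lborel (A \<inter> {0..r})"
      by (simp add: add_left_mono)
  qed
qed

text \<open>
  The width has density \<open>k = (s\<^sup>2 * h s)'\<close> with \<open>h' = q * h\<close>. As \<open>excess\<close> is positive on \<open>[0, r]\<close>, \<open>q\<close> is
  continuous, and \<open>h\<close> is the exponential of an antiderivative \<open>Q\<close>.
\<close>
lemma cover_measure_if_diameter_gt:
  assumes r: "0 < r" and long: "2 * r < l 0"
  shows "\<exists>\<nu>. prob_space \<nu> \<and> sets \<nu> = sets (restrict_space tuple_borel (zero_good_covers T)) \<and>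
    (\<forall>A\<in>sets nonneg_borel. emeasure (expected_radius_measure \<nu>) A
       \<le> ennreal (total_length T / r\<^sup>2) * emeasure lborel (A \<inter> {0..r}))"
proof -
  let ?L = "total_length T"
  have l0: "0 < l 0" using r long by simp
  have L: "l 0 \<le> ?L" by (rule l_0_le_total)
  have ex: "0 < excess s" if "s \<le> r" for s
    unfolding excess_def using that long by (intro add_pos_nonneg sum_nonneg) auto
  define q where "q s = 2 * beta s / excess s" for s
  have q0: "0 \<le> q s" if "s \<le> r" for s
    using ex[OF that] beta_nonneg[OF l0, of s] by (simp add: q_def)
  have eta0: "max s (eta i) \<noteq> 0" if "i \<in> {0<..<N}" for s i
    using eta_pos[OF l0, of i] that by auto
  have "continuous_on {0..r} q"
    unfolding q_def beta_def excess_def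
    using ex[unfolded excess_def] eta0 by (intro continuous_intros) (auto simp: less_imp_neq[symmetric])
  then obtain Q where Q: "\<And>s. s \<in> {0..r} \<Longrightarrow> (Q has_vector_derivative q s) (at s within {0..r})"
    using antiderivative_continuous by blast
  have Qd: "(Q has_real_derivative q s) (at s within {0..r})" if "0 \<le> s" "s \<le> r" for s
    using Q[of s] that by (simp add: has_real_derivative_iff_has_vector_derivative)
  define h where "h s = exp (Q s - Q r) / r\<^sup>2" for s
  have h0: "0 \<le> h s" for s by (simp add: h_def)
  have hr: "h r = 1 / r\<^sup>2" by (simp add: h_def)
  have hd: "(h has_real_derivative h s * q s) (at s within {0..r})" if "0 \<le> s" "s \<le> r" for s
  proof -
    have "((\<lambda>s. exp (Q s - Q r)) has_real_derivative exp (Q s - Q r) * q s) (at s within {0..r})"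
      by (auto intro!: derivative_eq_intros Qd[OF that])
    from DERIV_cdivide[OF this, of "r\<^sup>2"] show ?thesis by (simp add: h_def[abs_def])
  qed
  have contQ: "continuous_on {0..r} Q"
    using Qd by (intro DERIV_continuous_on) auto
  have conth: "continuous_on {0..r} h" unfolding h_def using r by (intro continuous_intros contQ) auto
  have [measurable]: "(\<lambda>s. h s * indicator {0..r} s) \<in> borel_measurable borel"
    using borel_measurable_continuous_on_indicator[OF _ conth] by (simp add: mult.commute)
  have [measurable]: "q \<in> borel_measurable borel" "excess \<in> borel_measurable borel" "beta \<in> borel_measurable borel"
    unfolding q_def beta_def excess_def by measurable
  \<comment> \<open>\<open>Q\<close> is arbitrary outside \<open>[0, r]\<close>, so \<open>h\<close> is cut off to be measurable.\<close>
  define H where "H s = h s * indicator {0..r} s" for s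
  have Hm [measurable]: "H \<in> borel_measurable borel" unfolding H_def by measurable
  have H0: "0 \<le> H s" for s using h0 by (simp add: H_def indicator_def)
  define k where "k s = 2 * s * H s * ?L / excess s" for s
  have km [measurable]: "k \<in> borel_measurable borel" unfolding k_def by measurable
  have k_in: "k s = 2 * s * h s * ?L / excess s" "0 \<le> k s" if "0 \<le> s" "s \<le> r" for s
    using that ex[of s] h0[of s] L l0 by (auto simp: k_def H_def)
  have k_out: "k s = 0" if "\<not> (0 \<le> s \<and> s \<le> r)" for s
    using that by (auto simp: k_def H_def indicator_def)
  \<comment> \<open>By the product rule and \<open>L = excess s + s * beta s\<close>, the density integrates to \<open>r\<^sup>2 * h r = 1\<close>.\<close>
  have kd: "((\<lambda>s. s\<^sup>2 * h s) has_real_derivative k s) (at s within {0..r})" if s: "0 \<le> s" "s \<le> r" for s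
  proof -
    have "((\<lambda>s. s\<^sup>2 * h s) has_real_derivative 2 * s * h s + h s * q s * s\<^sup>2) (at s within {0..r})"
      using hd[OF s] by (auto intro!: derivative_eq_intros)
    also have "2 * s * h s + h s * q s * s\<^sup>2 = k s"
    proof -
      have "excess s = ?L - s * beta s" by (rule excess_eq[OF l0 s(1)])
      then have "?L = excess s + s * beta s" by simp
      then have "k s = 2 * s * h s * (excess s + s * beta s) / excess s" unfolding k_in(1)[OF s] by simp
      then show ?thesis using ex[OF s(2)] by (simp add: q_def field_simps power2_eq_square)
    qed
    finally show ?thesis .
  qed
  define w where "w s = (if 0 < s \<and> s \<le> r then s else r)" for s
  show ?thesis
  proof (rule exists_cover_measure_density[of k w])
    show "k \<in> borel_measurable borel" "w \<in> borel_measurable borel" unfolding w_def by measurable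
    show "0 < w s" "w s \<le> ?L" for s using r long L by (auto simp: w_def)
    show "0 < l 0" by fact
    have "(\<integral>\<^sup>+s. ennreal (k s) \<partial>lborel) = (\<integral>\<^sup>+s. ennreal (k s) * indicator {0..r} s \<partial>lborel)"
      by (intro nn_integral_cong) (auto simp: indicator_def k_out)
    also have "\<dots> = ennreal (r\<^sup>2 * h r - 0\<^sup>2 * h 0)"
      using r by (intro nn_integral_FTC_within km kd k_in) auto
    also have "\<dots> = 1" using r by (simp add: hr)
    finally show "(\<integral>\<^sup>+s. ennreal (k s) \<partial>lborel) = 1" .
    fix A :: "real set" assume A [measurable]: "A \<in> sets borel"
    let ?f = "\<lambda>s. ?L * H s * q s"
    have f0: "0 \<le> ?f s" for s
      using H0[of s] q0[of s] L l0 by (cases "s \<le> r") (auto simp: H_def)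
    \<comment> \<open>The first term is the atom of width \<open>s\<close>. The second one is the uniform part, written as an
      integral over the radius \<open>u\<close> to prepare the exchange of the order of integration.\<close>
    have pointwise: "ennreal (k s) * width_bound (w s) A
        = ennreal (?L * H s) * indicator A s + (\<integral>\<^sup>+u. ennreal (?f s) * indicator A u * indicator {0..s} u \<partial>lborel)"
      if "s \<noteq> 0" for s
    proof (cases "0 < s \<and> s \<le> r")
      case True
      then have s: "0 < s" "s \<le> r" by auto
      have Hs: "H s = h s" using s by (simp add: H_def)
      have "2 * s \<le> l 0" using s long by simp
      then have "ennreal (k s) * width_bound (w s) A
          = (ennreal (k s) * ennreal (beta s / s)) * emeasure lborel (A \<inter> {0..s}) + (ennreal (k s) * ennreal (excess s / (2 * s))) * indicator A s"
        using s by (simp add: w_def width_bound_def distrib_left mult.assoc)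
      also have "ennreal (k s) * ennreal (beta s / s) = ennreal (?f s)"
      proof -
        have "k s * (beta s / s) = ?f s" using s k_in[of s] ex[OF s(2)] by (simp add: q_def Hs field_simps)
        then show ?thesis using s k_in[of s] beta_nonneg[OF l0, of s] by (simp add: ennreal_mult[symmetric])
      qed
      also have "ennreal (k s) * ennreal (excess s / (2 * s)) = ennreal (?L * H s)"
      proof -
        have "k s * (excess s / (2 * s)) = ?L * H s" using s k_in[of s] ex[OF s(2)] by (simp add: Hs field_simps)
        moreover have "0 \<le> k s" "0 \<le> excess s / (2 * s)" using s k_in[of s] ex[OF s(2)] by auto
        ultimately show ?thesis by (metis ennreal_mult)
      qed
      also have "ennreal (?f s) * emeasure lborel (A \<inter> {0..s}) = (\<integral>\<^sup>+u. ennreal (?f s) * indicator A u * indicator {0..s} u \<partial>lborel)"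
        by (simp add: mult.assoc indicator_inter_arith[symmetric] nn_integral_cmult_indicator)
      finally show ?thesis by (simp add: add.commute)
    next
      case False
      then have "H s = 0" using that by (auto simp: H_def indicator_def)
      then show ?thesis by (simp add: k_def)
    qed
    have "(\<integral>\<^sup>+s. ennreal (k s) * width_bound (w s) A \<partial>lborel)
        = (\<integral>\<^sup>+s. ennreal (?L * H s) * indicator A s + (\<integral>\<^sup>+u. ennreal (?f s) * indicator A u * indicator {0..s} u \<partial>lborel) \<partial>lborel)"
      by (rule nn_integral_cong_AE) (use AE_lborel_singleton[of 0] pointwise in auto)
    also have "\<dots> = (\<integral>\<^sup>+s. ennreal (?L * H s) * indicator A s \<partial>lborel)
        + (\<integral>\<^sup>+s. \<integral>\<^sup>+u. ennreal (?f s) * indicator A u * indicator {0..s} u \<partial>lborel \<partial>lborel)"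
      by (rule nn_integral_add) (auto simp: indicator_def)
    also have "(\<integral>\<^sup>+s. \<integral>\<^sup>+u. ennreal (?f s) * indicator A u * indicator {0..s} u \<partial>lborel \<partial>lborel)
        = (\<integral>\<^sup>+u. \<integral>\<^sup>+s. ennreal (?f s) * indicator A u * indicator {0..s} u \<partial>lborel \<partial>lborel)"
      by (rule lborel_pair.Fubini'[symmetric]) (unfold indicator_def atLeastAtMost_iff, measurable)
    also have "\<dots> = (\<integral>\<^sup>+u. ennreal (?L / r\<^sup>2 - ?L * h u) * indicator (A \<inter> {0..r}) u \<partial>lborel)"
    proof (rule nn_integral_cong)
      fix u :: real
      show "(\<integral>\<^sup>+s. ennreal (?f s) * indicator A u * indicator {0..s} u \<partial>lborel)
          = ennreal (?L / r\<^sup>2 - ?L * h u) * indicator (A \<inter> {0..r}) u"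
      proof (cases "0 \<le> u \<and> u \<le> r")
        case True
        have "(\<integral>\<^sup>+s. ennreal (?f s) * indicator A u * indicator {0..s} u \<partial>lborel)
            = (\<integral>\<^sup>+s. (ennreal (?f s) * indicator {u..r} s) * indicator A u \<partial>lborel)"
          using True by (intro nn_integral_cong) (auto simp: indicator_def H_def)
        also have "\<dots> = (\<integral>\<^sup>+s. ennreal (?f s) * indicator {u..r} s \<partial>lborel) * indicator A u"
          by (rule nn_integral_multc) measurable
        also have "(\<integral>\<^sup>+s. ennreal (?f s) * indicator {u..r} s \<partial>lborel) = ennreal (?L * h r - ?L * h u)"
        proof (rule nn_integral_FTC_within)
          show "?f \<in> borel_measurable borel" by measurable
          show "((\<lambda>s. ?L * h s) has_real_derivative ?f s) (at s within {u..r})" if "u \<le> s" "s \<le> r" for s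
          proof -
            have "((\<lambda>s. ?L * h s) has_real_derivative ?L * (h s * q s)) (at s within {0..r})"
              using that True by (intro DERIV_cmult hd) auto
            moreover have "?L * (h s * q s) = ?f s" using that True by (simp add: H_def)
            ultimately show ?thesis using True by (auto intro: has_field_derivative_subset)
          qed
          show "0 \<le> ?f s" if "u \<le> s" "s \<le> r" for s by (rule f0)
          show "u \<le> r" using True by simp
        qed
        finally show ?thesis using True by (simp add: hr indicator_def)
      next
        case False
        have "(\<integral>\<^sup>+s. ennreal (?f s) * indicator A u * indicator {0..s} u \<partial>lborel) = (\<integral>\<^sup>+s. 0 \<partial>(lborel :: real measure))"
          using False by (intro nn_integral_cong) (auto simp: indicator_def H_def)
        then show ?thesis using False by (auto simp: indicator_def)
      qed
    qed
    also have "(\<integral>\<^sup>+s. ennreal (?L * H s) * indicator A s \<partial>lborel) = (\<integral>\<^sup>+u. ennreal (?L * H u) * indicator (A \<inter> {0..r}) u \<partial>lborel)"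
      by (intro nn_integral_cong) (auto simp: indicator_def H_def)
    also have "(\<integral>\<^sup>+u. ennreal (?L * H u) * indicator (A \<inter> {0..r}) u \<partial>lborel) + (\<integral>\<^sup>+u. ennreal (?L / r\<^sup>2 - ?L * h u) * indicator (A \<inter> {0..r}) u \<partial>lborel)
        = (\<integral>\<^sup>+u. ennreal (?L * H u) * indicator (A \<inter> {0..r}) u + ennreal (?L / r\<^sup>2 - ?L * H u) * indicator (A \<inter> {0..r}) u \<partial>lborel)"
    proof -
      have "ennreal (?L / r\<^sup>2 - ?L * h u) * indicator (A \<inter> {0..r}) u = ennreal (?L / r\<^sup>2 - ?L * H u) * indicator (A \<inter> {0..r}) u" for u
        by (auto simp: indicator_def H_def)
      then show ?thesis by (simp add: nn_integral_add)
    qed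
    also have "\<dots> = (\<integral>\<^sup>+u. ennreal (?L / r\<^sup>2) * indicator (A \<inter> {0..r}) u \<partial>lborel)"
    proof (rule nn_integral_cong)
      fix u :: real
      have "h u \<le> 1 / r\<^sup>2" if u: "0 \<le> u" "u \<le> r"
      proof -
        have "h u \<le> h r"
        proof (rule DERIV_nonneg_imp_increasing_open[OF u(2)])
          show "continuous_on {u..r} h" using conth by (rule continuous_on_subset) (use u in auto)
          fix x assume x: "u < x" "x < r"
          have "(h has_real_derivative h x * q x) (at x within {0..r})" using hd[of x] x u by simp
          then have "(h has_real_derivative h x * q x) (at x)"
            using x u by (subst (asm) at_within_interior) auto
          then show "\<exists>y. DERIV h x :> y \<and> y \<ge> 0" using h0[of x] q0[of x] x by auto
        qed
        then show ?thesis by (simp add: hr)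
      qed
      then have "u \<in> {0..r} \<Longrightarrow> 0 \<le> ?L / r\<^sup>2 - ?L * H u"
        using L l0 mult_left_mono[of "h u" "1 / r\<^sup>2" ?L] by (auto simp: H_def)
      then show "ennreal (?L * H u) * indicator (A \<inter> {0..r}) u + ennreal (?L / r\<^sup>2 - ?L * H u) * indicator (A \<inter> {0..r}) u
          = ennreal (?L / r\<^sup>2) * indicator (A \<inter> {0..r}) u"
        using H0[of u] L l0 by (auto simp: indicator_def simp flip: ennreal_plus)
    qed
    finally show "(\<integral>\<^sup>+s. ennreal (k s) * width_bound (w s) A \<partial>lborel) \<le> ennreal (?L / r\<^sup>2) * emeasure lborel (A \<inter> {0..r})"
      by (simp add: nn_integral_cmult_indicator)
  qed
qed

end

theorem theorem1p3:
  fixes T :: "'v weighted_graph" and r L :: real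
  assumes "metric_tree T"
    and "0 < r"
    and "L = total_length T"
    and "2 * r \<le> L"
  shows "\<exists>\<nu> :: real list measure.
    prob_space \<nu> \<and>
    sets \<nu> = sets (restrict_space tuple_borel (zero_good_covers T)) \<and>
    (\<forall>A \<in> sets nonneg_borel.
       emeasure (expected_radius_measure \<nu>) A \<le> ennreal (L / r) * emeasure (uniform_radius r) A)"
proof -
  interpret metric_tree T by fact
  obtain N y l par g where "long_path_decomposition T N y l par g"
    using long_path_decomposition_exists by blast
  then interpret long_path_decomposition T N y l par g .
  obtain \<nu> where \<nu>: "prob_space \<nu>" "sets \<nu> = sets (restrict_space tuple_borel (zero_good_covers T))"
    and E: "\<And>A. A \<in> sets nonneg_borel \<Longrightarrow> emeasure (expected_radius_measure \<nu>) A
       \<le> ennreal (total_length T / r\<^sup>2) * emeasure lborel (A \<inter> {0..r})"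
    using cover_measure_if_diameter_le[of r] cover_measure_if_diameter_gt[of r] assms by (cases "l 0 \<le> 2 * r") fastforce+
  have "emeasure (expected_radius_measure \<nu>) A \<le> ennreal (L / r) * emeasure (uniform_radius r) A"
    if A: "A \<in> sets nonneg_borel" for A
  proof -
    have A0: "A \<subseteq> {0..}" "A \<in> sets borel" using A by (auto simp: nonneg_borel_def sets_restrict_space)
    have "emeasure (uniform_radius r) A = emeasure (uniform_measure lborel {0..r}) A"
      unfolding uniform_radius_def using A0 by (intro emeasure_restrict_space) auto
    also have "\<dots> = emeasure lborel (A \<inter> {0..r}) / ennreal r"
      using A0 assms by (subst emeasure_uniform_measure) (auto simp: Int_commute)
    finally have u: "emeasure (uniform_radius r) A = emeasure lborel (A \<inter> {0..r}) / ennreal r" .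
    have "ennreal (L / r) * (emeasure lborel (A \<inter> {0..r}) / ennreal r) = (ennreal (L / r) * ennreal (1 / r)) * emeasure lborel (A \<inter> {0..r})"
      using assms by (simp add: divide_ennreal_def inverse_ennreal inverse_eq_divide mult_ac)
    also have "ennreal (L / r) * ennreal (1 / r) = ennreal (total_length T / r\<^sup>2)"
      using assms by (simp add: ennreal_mult[symmetric] power2_eq_square)
    finally show ?thesis using E[OF A] u by simp
  qed
  with \<nu> show ?thesis by blast
qed

end
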